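(* Let $n\ge1$, let $\mathcal C$ be an $n$-Frobenius category, let $M,N,K\in\mathcal C$, and fix a unit conflation $\delta_N\in\operatorname{Ext}^n(N,\Omega^nN)$. Then the composition $$\circ:\operatorname{Ext}^n(N,\Omega^nK)/\mathcal P\times\operatorname{Ext}^n(M,\Omega^nN)/\mathcal P\to\operatorname{Ext}^n(M,\Omega^nK)/\mathcal P,\qquad(\bar\beta,\bar\gamma)\mapsto\bar\beta\circ\bar\gamma:=\overline{((\beta a_1)b_1^{-1})f},$$ where $\gamma=\delta f$ is a right unit factorization of $\gamma$ and $\delta_N\xleftarrow{a_1}\delta_1\xrightarrow{b_1}\delta$ is a co-angled pair, is well-defined (independent of all choices, including the representatives $\beta,\gamma$).
   Context: Let $\mathcal A$ be an abelian category and $\mathcal C$ a full additive extension-closed subcategory with the inherited exact structure: conflations are short exact sequences of $\mathcal A$ with all terms in $\mathcal C$ (first map an inflation, second a deflation). $\operatorname{Ext}^t(A,B)=\operatorname{Ext}^t_{\mathcal C}(A,B)$ ($t\ge1$) is the abelian group (Baer sum) of equivalence classes of exact sequences $B\to X_{t-1}\to\cdots\to X_0\to A$ spliced from $t$ conflations. $g\gamma$, $\gamma h$ denote push-out along $g$ and pull-back along $h$. $P\in\mathcal C$ is $n$-projective (resp. $n$-injective) if $\operatorname{Ext}^i(P,Y)=0$ (resp. $\operatorname{Ext}^i(Y,P)=0$) for all $i>n$, $Y\in\mathcal C$. $\mathcal C$ is $n$-Frobenius if every object has a deflation from an $n$-projective and an inflation into an $n$-injective, and $n$-projectives and $n$-injectives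 coincide. $\mathcal P(X,Y)\subseteq\operatorname{Ext}^n(X,Y)$ is the subgroup of elements $\eta h$ with $h:X\to P$, $P$ $n$-projective, $\eta\in\operatorname{Ext}^n(P,Y)$; bars denote classes modulo $\mathcal P$. A unit conflation of length $n$ is of the form $B\to P_{n-1}\to\cdots\to P_0\to A$ with all $P_i$ $n$-projective; $B$ is then an $n$-th syzygy $\Omega^nA$ of $A$; $\mathcal U^n(B)$ denotes the class of unit conflations of length $n$ beginning with $B$. A right unit factorization of $\gamma\in\operatorname{Ext}^n(M,\Omega^nN)$ is an equality $\gamma=\delta f$ with $\delta\in\mathcal U^n(\Omega^nN)$ and $f$ a morphism; these always exist. $\Sigma$ is the class of quasi-invertible morphisms: those $f:A\to B$ such that $\operatorname{Ext}^{n+1}(X,A)\to\operatorname{Ext}^{n+1}(X,B)$, $\gamma\mapsto f\gamma$, is an isomorphism for all $X\in\mathcal C$ (equivalently, the analogous condition with pull-backs). For $\delta,\delta'\in\mathcal U^n(B)$, a co-angled pair $\delta\xleftarrow{a}\delta''\xrightarrow{b}\delta'$ (also written $[\delta a,\delta'b]$) consists of deflations $a,b\in\Sigma$ from a common object to the right end terms of $\delta,\delta'$ respectively, such that $\delta a=\delta'b=:\delta''$, with $\delta''\in\mathcal U^n(B)$; such pairs always exist. For $b:X\to X'$ in $\Sigma$ and $\gamma\in\operatorname{Ext}^n(X,Y)$, $\gamma b^{-1}$ denotes an element $\gamma'\in\operatorname{Ext}^n(X',Y)$ with $\gamma-\gamma'b\in\mathcal P$; it exists and is unique modulo $\mathcal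 P$. *)

theory Defs
  imports "HOL-Algebra.Coset"
begin

section \<open>Abelian categories\<close>

text \<open>
  A (small) category with an addition on its hom-sets. Composition and addition are total HOL
  functions whose values matter only on composable, respectively parallel, arrows.
\<close>

record ('o, 'a) addcat =
  obj :: "'o set"
  arr :: "'a set"
  src :: "'a \<Rightarrow> 'o"
  tgt :: "'a \<Rightarrow> 'o"
  idn :: "'o \<Rightarrow> 'a"
  cmp :: "'a \<Rightarrow> 'a \<Rightarrow> 'a"  (infixr "\<cdot>\<index>" 75)
  hplus :: "'a \<Rightarrow> 'a \<Rightarrow> 'a"
  hzero :: "'o \<Rightarrow> 'o \<Rightarrow> 'a"

definition Hom :: "('o, 'a) addcat \<Rightarrow> 'o \<Rightarrow> 'o \<Rightarrow> 'a set" where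
  "Hom \<A> A B = {f \<in> arr \<A>. src \<A> f = A \<and> tgt \<A> f = B}"

definition hom_group :: "('o, 'a) addcat \<Rightarrow> 'o \<Rightarrow> 'o \<Rightarrow> 'a monoid" where
  "hom_group \<A> A B = \<lparr>carrier = Hom \<A> A B, mult = hplus \<A>, one = hzero \<A> A B\<rparr>"

locale preadditive_category =
  fixes \<A> :: "('o, 'a) addcat" (structure)
  assumes src_obj: "f \<in> arr \<A> \<Longrightarrow> src \<A> f \<in> obj \<A>"
    and tgt_obj: "f \<in> arr \<A> \<Longrightarrow> tgt \<A> f \<in> obj \<A>"
    and idn_Hom: "A \<in> obj \<A> \<Longrightarrow> idn \<A> A \<in> Hom \<A> A A"
    and cmp_Hom: "\<lbrakk>f \<in> Hom \<A> A B; g \<in> Hom \<A> B D\<rbrakk> \<Longrightarrow> g \<cdot> f \<in> Hom \<A> A D"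
    and cmp_idn_left: "f \<in> Hom \<A> A B \<Longrightarrow> idn \<A> B \<cdot> f = f"
    and cmp_idn_right: "f \<in> Hom \<A> A B \<Longrightarrow> f \<cdot> idn \<A> A = f"
    and cmp_assoc: "\<lbrakk>f \<in> Hom \<A> A B; g \<in> Hom \<A> B D; h \<in> Hom \<A> D E\<rbrakk>
          \<Longrightarrow> (h \<cdot> g) \<cdot> f = h \<cdot> (g \<cdot> f)"
    and hom_comm_group: "\<lbrakk>A \<in> obj \<A>; B \<in> obj \<A>\<rbrakk> \<Longrightarrow> comm_group (hom_group \<A> A B)"
    and cmp_hplus_left: "\<lbrakk>f \<in> Hom \<A> A B; f' \<in> Hom \<A> A B; g \<in> Hom \<A> B D\<rbrakk>
          \<Longrightarrow> g \<cdot> hplus \<A> f f' = hplus \<A> (g \<cdot> f) (g \<cdot> f')"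
    and cmp_hplus_right: "\<lbrakk>f \<in> Hom \<A> A B; g \<in> Hom \<A> B D; g' \<in> Hom \<A> B D\<rbrakk>
          \<Longrightarrow> hplus \<A> g g' \<cdot> f = hplus \<A> (g \<cdot> f) (g' \<cdot> f)"

definition zero_object :: "('o, 'a) addcat \<Rightarrow> 'o \<Rightarrow> bool" where
  "zero_object \<A> Z \<longleftrightarrow> Z \<in> obj \<A> \<and>
     (\<forall>A\<in>obj \<A>. (\<exists>!f. f \<in> Hom \<A> A Z) \<and> (\<exists>!f. f \<in> Hom \<A> Z A))"

definition biproduct ::
  "('o, 'a) addcat \<Rightarrow> 'o \<Rightarrow> 'o \<Rightarrow> 'o \<Rightarrow> 'a \<Rightarrow> 'a \<Rightarrow> 'a \<Rightarrow> 'a \<Rightarrow> bool" where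
  "biproduct \<A> A B S i1 i2 p1 p2 \<longleftrightarrow>
     i1 \<in> Hom \<A> A S \<and> i2 \<in> Hom \<A> B S \<and> p1 \<in> Hom \<A> S A \<and> p2 \<in> Hom \<A> S B \<and>
     p1 \<cdot>\<^bsub>\<A>\<^esub> i1 = idn \<A> A \<and> p2 \<cdot>\<^bsub>\<A>\<^esub> i2 = idn \<A> B \<and>
     p2 \<cdot>\<^bsub>\<A>\<^esub> i1 = hzero \<A> A B \<and> p1 \<cdot>\<^bsub>\<A>\<^esub> i2 = hzero \<A> B A \<and>
     hplus \<A> (i1 \<cdot>\<^bsub>\<A>\<^esub> p1) (i2 \<cdot>\<^bsub>\<A>\<^esub> p2) = idn \<A> S"

definition mono_arr :: "('o, 'a) addcat \<Rightarrow> 'a \<Rightarrow> bool" where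
  "mono_arr \<A> f \<longleftrightarrow> f \<in> arr \<A> \<and>
     (\<forall>T\<in>obj \<A>. \<forall>u\<in>Hom \<A> T (src \<A> f). \<forall>v\<in>Hom \<A> T (src \<A> f).
        f \<cdot>\<^bsub>\<A>\<^esub> u = f \<cdot>\<^bsub>\<A>\<^esub> v \<longrightarrow> u = v)"

definition epi_arr :: "('o, 'a) addcat \<Rightarrow> 'a \<Rightarrow> bool" where
  "epi_arr \<A> f \<longleftrightarrow> f \<in> arr \<A> \<and>
     (\<forall>T\<in>obj \<A>. \<forall>u\<in>Hom \<A> (tgt \<A> f) T. \<forall>v\<in>Hom \<A> (tgt \<A> f) T.
        u \<cdot>\<^bsub>\<A>\<^esub> f = v \<cdot>\<^bsub>\<A>\<^esub> f \<longrightarrow> u = v)"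

definition is_kernel :: "('o, 'a) addcat \<Rightarrow> 'a \<Rightarrow> 'a \<Rightarrow> bool" where
  "is_kernel \<A> k f \<longleftrightarrow> f \<in> arr \<A> \<and> k \<in> arr \<A> \<and> tgt \<A> k = src \<A> f \<and>
     f \<cdot>\<^bsub>\<A>\<^esub> k = hzero \<A> (src \<A> k) (tgt \<A> f) \<and>
     (\<forall>T\<in>obj \<A>. \<forall>u\<in>Hom \<A> T (src \<A> f). f \<cdot>\<^bsub>\<A>\<^esub> u = hzero \<A> T (tgt \<A> f) \<longrightarrow>
        (\<exists>!w. w \<in> Hom \<A> T (src \<A> k) \<and> k \<cdot>\<^bsub>\<A>\<^esub> w = u))"

definition is_cokernel :: "('o, 'a) addcat \<Rightarrow> 'a \<Rightarrow> 'a \<Rightarrow> bool" where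
  "is_cokernel \<A> c f \<longleftrightarrow> f \<in> arr \<A> \<and> c \<in> arr \<A> \<and> src \<A> c = tgt \<A> f \<and>
     c \<cdot>\<^bsub>\<A>\<^esub> f = hzero \<A> (src \<A> f) (tgt \<A> c) \<and>
     (\<forall>T\<in>obj \<A>. \<forall>u\<in>Hom \<A> (tgt \<A> f) T. u \<cdot>\<^bsub>\<A>\<^esub> f = hzero \<A> (src \<A> f) T \<longrightarrow>
        (\<exists>!w. w \<in> Hom \<A> (tgt \<A> c) T \<and> w \<cdot>\<^bsub>\<A>\<^esub> c = u))"

locale abelian_category = preadditive_category +
  assumes zero_object_exists: "\<exists>Z. zero_object \<A> Z"
    and biproduct_exists: "\<lbrakk>A \<in> obj \<A>; B \<in> obj \<A>\<rbrakk>
          \<Longrightarrow> \<exists>S i1 i2 p1 p2. biproduct \<A> A B S i1 i2 p1 p2"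
    and kernel_exists: "f \<in> arr \<A> \<Longrightarrow> \<exists>k. is_kernel \<A> k f"
    and cokernel_exists: "f \<in> arr \<A> \<Longrightarrow> \<exists>c. is_cokernel \<A> c f"
    and mono_normal: "mono_arr \<A> f \<Longrightarrow> \<exists>g. is_kernel \<A> f g"
    and epi_normal: "epi_arr \<A> f \<Longrightarrow> \<exists>g. is_cokernel \<A> f g"


section \<open>The exact structure on an extension-closed subcategory\<close>

text \<open>A full subcategory is given by its set of objects \<open>\<C>\<close>.\<close>

definition short_exact :: "('o, 'a) addcat \<Rightarrow> 'a \<Rightarrow> 'a \<Rightarrow> bool" where
  "short_exact \<A> i p \<longleftrightarrow> is_kernel \<A> i p \<and> is_cokernel \<A> p i"

definition additive_ext_closed :: "('o, 'a) addcat \<Rightarrow> 'o set \<Rightarrow> bool" where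
  "additive_ext_closed \<A> \<C> \<longleftrightarrow> \<C> \<subseteq> obj \<A> \<and>
     (\<exists>Z\<in>\<C>. zero_object \<A> Z) \<and>
     (\<forall>A\<in>\<C>. \<forall>B\<in>\<C>. \<exists>S\<in>\<C>. \<exists>i1 i2 p1 p2. biproduct \<A> A B S i1 i2 p1 p2) \<and>
     (\<forall>i p. short_exact \<A> i p \<longrightarrow> src \<A> i \<in> \<C> \<longrightarrow> tgt \<A> p \<in> \<C> \<longrightarrow> tgt \<A> i \<in> \<C>)"

definition conflation :: "('o, 'a) addcat \<Rightarrow> 'o set \<Rightarrow> 'a \<Rightarrow> 'a \<Rightarrow> bool" where
  "conflation \<A> \<C> i p \<longleftrightarrow>
     short_exact \<A> i p \<and> src \<A> i \<in> \<C> \<and> tgt \<A> i \<in> \<C> \<and> tgt \<A> p \<in> \<C>"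

definition inflation :: "('o, 'a) addcat \<Rightarrow> 'o set \<Rightarrow> 'a \<Rightarrow> bool" where
  "inflation \<A> \<C> i \<longleftrightarrow> (\<exists>p. conflation \<A> \<C> i p)"

definition deflation :: "('o, 'a) addcat \<Rightarrow> 'o set \<Rightarrow> 'a \<Rightarrow> bool" where
  "deflation \<A> \<C> p \<longleftrightarrow> (\<exists>i. conflation \<A> \<C> i p)"


section \<open>Yoneda extension groups\<close>

text \<open>
  An exact sequence \<open>B \<rightarrow> X\<^sub>t\<^sub>-\<^sub>1 \<rightarrow> \<dots> \<rightarrow> X\<^sub>0 \<rightarrow> A\<close> is the list of its \<open>t + 1\<close> arrows, from left to right;
  \<open>spliced \<A> \<C> t E\<close> says that \<open>E\<close> is spliced from \<open>t\<close> conflations.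
\<close>

inductive spliced :: "('o, 'a) addcat \<Rightarrow> 'o set \<Rightarrow> nat \<Rightarrow> 'a list \<Rightarrow> bool"
  for \<A> :: "('o, 'a) addcat" and \<C> :: "'o set" where
  single: "conflation \<A> \<C> i p \<Longrightarrow> spliced \<A> \<C> 1 [i, p]"
| splice: "\<lbrakk>conflation \<A> \<C> i p; spliced \<A> \<C> t (j # ds); src \<A> j = tgt \<A> p\<rbrakk>
    \<Longrightarrow> spliced \<A> \<C> (Suc t) (i # (j \<cdot>\<^bsub>\<A>\<^esub> p) # ds)"

definition ext_seq :: "('o, 'a) addcat \<Rightarrow> 'o set \<Rightarrow> nat \<Rightarrow> 'o \<Rightarrow> 'o \<Rightarrow> 'a list \<Rightarrow> bool" where
  "ext_seq \<A> \<C> t A B E \<longleftrightarrow> spliced \<A> \<C> t E \<and> src \<A> (hd E) = B \<and> tgt \<A> (last E) = A"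

text \<open>
  A morphism of exact sequences of the same length is the list of its vertical arrows, one for
  each object of the sequence.
\<close>

definition seq_morphism :: "('o, 'a) addcat \<Rightarrow> 'a list \<Rightarrow> 'a list \<Rightarrow> 'a list \<Rightarrow> bool" where
  "seq_morphism \<A> E E' \<phi> \<longleftrightarrow> length E = length E' \<and> length \<phi> = Suc (length E) \<and>
     (\<forall>k<length E.
        \<phi> ! k \<in> Hom \<A> (src \<A> (E ! k)) (src \<A> (E' ! k)) \<and>
        \<phi> ! Suc k \<in> Hom \<A> (tgt \<A> (E ! k)) (tgt \<A> (E' ! k)) \<and>
        \<phi> ! Suc k \<cdot>\<^bsub>\<A>\<^esub> E ! k = E' ! k \<cdot>\<^bsub>\<A>\<^esub> \<phi> ! k)"

definition ext_step :: "('o, 'a) addcat \<Rightarrow> 'o set \<Rightarrow> 'a list \<Rightarrow> 'a list \<Rightarrow> bool" where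
  "ext_step \<A> \<C> E E' \<longleftrightarrow>
     (\<exists>t A B \<phi>. ext_seq \<A> \<C> t A B E \<and> ext_seq \<A> \<C> t A B E' \<and> seq_morphism \<A> E E' \<phi> \<and>
        hd \<phi> = idn \<A> B \<and> last \<phi> = idn \<A> A)"

definition ext_class :: "('o, 'a) addcat \<Rightarrow> 'o set \<Rightarrow> 'a list \<Rightarrow> 'a list set" where
  "ext_class \<A> \<C> E = {E'. equivclp (ext_step \<A> \<C>) E E'}"

definition ext_set :: "('o, 'a) addcat \<Rightarrow> 'o set \<Rightarrow> nat \<Rightarrow> 'o \<Rightarrow> 'o \<Rightarrow> 'a list set set" where
  "ext_set \<A> \<C> t A B = {ext_class \<A> \<C> E | E. ext_seq \<A> \<C> t A B E}"

definition pullback_square :: "('o, 'a) addcat \<Rightarrow> 'a \<Rightarrow> 'a \<Rightarrow> 'a \<Rightarrow> 'a \<Rightarrow> bool" where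
  "pullback_square \<A> q r p h \<longleftrightarrow>
     {q, r, p, h} \<subseteq> arr \<A> \<and> src \<A> q = src \<A> r \<and> tgt \<A> q = src \<A> p \<and> tgt \<A> r = src \<A> h \<and>
     tgt \<A> p = tgt \<A> h \<and> p \<cdot>\<^bsub>\<A>\<^esub> q = h \<cdot>\<^bsub>\<A>\<^esub> r \<and>
     (\<forall>T\<in>obj \<A>. \<forall>u\<in>Hom \<A> T (src \<A> p). \<forall>v\<in>Hom \<A> T (src \<A> h).
        p \<cdot>\<^bsub>\<A>\<^esub> u = h \<cdot>\<^bsub>\<A>\<^esub> v \<longrightarrow>
        (\<exists>!w. w \<in> Hom \<A> T (src \<A> q) \<and> q \<cdot>\<^bsub>\<A>\<^esub> w = u \<and> r \<cdot>\<^bsub>\<A>\<^esub> w = v))"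

definition pushout_square :: "('o, 'a) addcat \<Rightarrow> 'a \<Rightarrow> 'a \<Rightarrow> 'a \<Rightarrow> 'a \<Rightarrow> bool" where
  "pushout_square \<A> i g q r \<longleftrightarrow>
     {i, g, q, r} \<subseteq> arr \<A> \<and> src \<A> i = src \<A> g \<and> src \<A> q = tgt \<A> i \<and> src \<A> r = tgt \<A> g \<and>
     tgt \<A> q = tgt \<A> r \<and> q \<cdot>\<^bsub>\<A>\<^esub> i = r \<cdot>\<^bsub>\<A>\<^esub> g \<and>
     (\<forall>T\<in>obj \<A>. \<forall>u\<in>Hom \<A> (tgt \<A> i) T. \<forall>v\<in>Hom \<A> (tgt \<A> g) T.
        u \<cdot>\<^bsub>\<A>\<^esub> i = v \<cdot>\<^bsub>\<A>\<^esub> g \<longrightarrow>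
        (\<exists>!w. w \<in> Hom \<A> (tgt \<A> q) T \<and> w \<cdot>\<^bsub>\<A>\<^esub> q = u \<and> w \<cdot>\<^bsub>\<A>\<^esub> r = v))"

text \<open>
  The pull-back of \<open>B \<rightarrow> \<dots> \<rightarrow> X\<^sub>0 \<rightarrow> A\<close> along \<open>h : A' \<rightarrow> A\<close> replaces \<open>X\<^sub>0\<close> by the pull-back \<open>X\<^sub>0'\<close> of
  \<open>p : X\<^sub>0 \<rightarrow> A\<close> along \<open>h\<close>; the arrow \<open>d\<close> into \<open>X\<^sub>0\<close> is replaced by the unique \<open>d'\<close> into \<open>X\<^sub>0'\<close> lying
  over \<open>d\<close> and killed by the projection to \<open>A'\<close>. Dually for push-outs.
\<close>

definition seq_pullback :: "('o, 'a) addcat \<Rightarrow> 'a list \<Rightarrow> 'a \<Rightarrow> 'a list \<Rightarrow> bool" where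
  "seq_pullback \<A> E h E' \<longleftrightarrow> (\<exists>es d p d' p' q.
     E = es @ [d, p] \<and> E' = es @ [d', p'] \<and> pullback_square \<A> q p' p h \<and>
     d' \<in> Hom \<A> (src \<A> d) (src \<A> q) \<and> q \<cdot>\<^bsub>\<A>\<^esub> d' = d \<and>
     p' \<cdot>\<^bsub>\<A>\<^esub> d' = hzero \<A> (src \<A> d) (src \<A> h))"

definition seq_pushout :: "('o, 'a) addcat \<Rightarrow> 'a \<Rightarrow> 'a list \<Rightarrow> 'a list \<Rightarrow> bool" where
  "seq_pushout \<A> g E E' \<longleftrightarrow> (\<exists>es i d i' d' q.
     E = i # d # es \<and> E' = i' # d' # es \<and> pushout_square \<A> i g q i' \<and>
     d' \<in> Hom \<A> (tgt \<A> q) (tgt \<A> d) \<and> d' \<cdot>\<^bsub>\<A>\<^esub> q = d \<and>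
     d' \<cdot>\<^bsub>\<A>\<^esub> i' = hzero \<A> (tgt \<A> g) (tgt \<A> d))"

text \<open>
  The operations on extension classes are unions of the classes obtained from all representatives,
  as usual for operations on quotients.
\<close>

definition ext_pull ::
  "('o, 'a) addcat \<Rightarrow> 'o set \<Rightarrow> 'a list set \<Rightarrow> 'a \<Rightarrow> 'a list set" where
  "ext_pull \<A> \<C> \<gamma> h = \<Union>{ext_class \<A> \<C> E' | E E'. E \<in> \<gamma> \<and> seq_pullback \<A> E h E'}"

definition ext_push ::
  "('o, 'a) addcat \<Rightarrow> 'o set \<Rightarrow> 'a \<Rightarrow> 'a list set \<Rightarrow> 'a list set" where
  "ext_push \<A> \<C> g \<gamma> = \<Union>{ext_class \<A> \<C> E' | E E'. E \<in> \<gamma> \<and> seq_pushout \<A> g E E'}"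

definition biprod_of :: "('o, 'a) addcat \<Rightarrow> 'o \<Rightarrow> 'o \<Rightarrow> 'o \<times> 'a \<times> 'a \<times> 'a \<times> 'a" where
  "biprod_of \<A> A B = (SOME (S, i1, i2, p1, p2). biproduct \<A> A B S i1 i2 p1 p2)"

definition dsum_arr :: "('o, 'a) addcat \<Rightarrow> 'a \<Rightarrow> 'a \<Rightarrow> 'a" where
  "dsum_arr \<A> f g =
     (let (_, _, _, p1, p2) = biprod_of \<A> (src \<A> f) (src \<A> g);
          (_, i1, i2, _, _) = biprod_of \<A> (tgt \<A> f) (tgt \<A> g)
      in hplus \<A> (i1 \<cdot>\<^bsub>\<A>\<^esub> f \<cdot>\<^bsub>\<A>\<^esub> p1) (i2 \<cdot>\<^bsub>\<A>\<^esub> g \<cdot>\<^bsub>\<A>\<^esub> p2))"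

definition diagonal :: "('o, 'a) addcat \<Rightarrow> 'o \<Rightarrow> 'a" where
  "diagonal \<A> A = (let (_, i1, i2, _, _) = biprod_of \<A> A A in hplus \<A> i1 i2)"

definition codiagonal :: "('o, 'a) addcat \<Rightarrow> 'o \<Rightarrow> 'a" where
  "codiagonal \<A> A = (let (_, _, _, p1, p2) = biprod_of \<A> A A in hplus \<A> p1 p2)"

definition ext_dsum ::
  "('o, 'a) addcat \<Rightarrow> 'o set \<Rightarrow> 'a list set \<Rightarrow> 'a list set \<Rightarrow> 'a list set" where
  "ext_dsum \<A> \<C> \<gamma> \<gamma>' = \<Union>{ext_class \<A> \<C> (map2 (dsum_arr \<A>) E E') | E E'. E \<in> \<gamma> \<and> E' \<in> \<gamma>'}"

definition baer_sum ::
  "('o, 'a) addcat \<Rightarrow> 'o set \<Rightarrow> 'o \<Rightarrow> 'o \<Rightarrow> 'a list set \<Rightarrow> 'a list set \<Rightarrow> 'a list set" where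
  "baer_sum \<A> \<C> A B \<gamma> \<gamma>' =
     ext_push \<A> \<C> (codiagonal \<A> B) (ext_pull \<A> \<C> (ext_dsum \<A> \<C> \<gamma> \<gamma>') (diagonal \<A> A))"

text \<open>
  The trivial sequence: the split one for \<open>t = 1\<close>, and \<open>B = B \<rightarrow> 0 \<rightarrow> \<dots> \<rightarrow> 0 \<rightarrow> A = A\<close> with zero
  arrows in between for \<open>t \<ge> 2\<close>.
\<close>

definition zero_seq :: "('o, 'a) addcat \<Rightarrow> nat \<Rightarrow> 'o \<Rightarrow> 'o \<Rightarrow> 'a list" where
  "zero_seq \<A> t A B =
     (if t = 1 then (let (_, i1, _, _, p2) = biprod_of \<A> B A in [i1, p2])
      else (let Xs = [B] @ replicate (t - 2) (SOME Z. zero_object \<A> Z) @ [A]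
            in [idn \<A> B] @ map2 (hzero \<A>) Xs (tl Xs) @ [idn \<A> A]))"

text \<open>\<open>Ext \<A> \<C> t A B\<close> is \<open>Ext\<^sup>t(A,B)\<close>, written multiplicatively as a group of HOL-Algebra.\<close>

definition Ext :: "('o, 'a) addcat \<Rightarrow> 'o set \<Rightarrow> nat \<Rightarrow> 'o \<Rightarrow> 'o \<Rightarrow> 'a list set monoid" where
  "Ext \<A> \<C> t A B =
     \<lparr>carrier = ext_set \<A> \<C> t A B, mult = baer_sum \<A> \<C> A B,
      one = ext_class \<A> \<C> (zero_seq \<A> t A B)\<rparr>"


section \<open>n-Frobenius categories\<close>

definition n_projective :: "('o, 'a) addcat \<Rightarrow> 'o set \<Rightarrow> nat \<Rightarrow> 'o \<Rightarrow> bool" where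
  "n_projective \<A> \<C> n P \<longleftrightarrow> P \<in> \<C> \<and>
     (\<forall>i>n. \<forall>Y\<in>\<C>. carrier (Ext \<A> \<C> i P Y) = {\<one>\<^bsub>Ext \<A> \<C> i P Y\<^esub>})"

definition n_injective :: "('o, 'a) addcat \<Rightarrow> 'o set \<Rightarrow> nat \<Rightarrow> 'o \<Rightarrow> bool" where
  "n_injective \<A> \<C> n P \<longleftrightarrow> P \<in> \<C> \<and>
     (\<forall>i>n. \<forall>Y\<in>\<C>. carrier (Ext \<A> \<C> i Y P) = {\<one>\<^bsub>Ext \<A> \<C> i Y P\<^esub>})"

definition n_frobenius :: "('o, 'a) addcat \<Rightarrow> 'o set \<Rightarrow> nat \<Rightarrow> bool" where
  "n_frobenius \<A> \<C> n \<longleftrightarrow>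
     (\<forall>A\<in>\<C>. \<exists>p. deflation \<A> \<C> p \<and> n_projective \<A> \<C> n (src \<A> p) \<and> tgt \<A> p = A) \<and>
     (\<forall>A\<in>\<C>. \<exists>i. inflation \<A> \<C> i \<and> src \<A> i = A \<and> n_injective \<A> \<C> n (tgt \<A> i)) \<and>
     (\<forall>P. n_projective \<A> \<C> n P \<longleftrightarrow> n_injective \<A> \<C> n P)"

definition proj_ext :: "('o, 'a) addcat \<Rightarrow> 'o set \<Rightarrow> nat \<Rightarrow> 'o \<Rightarrow> 'o \<Rightarrow> 'a list set set" where
  "proj_ext \<A> \<C> n X Y =
     {ext_pull \<A> \<C> \<eta> h | \<eta> h P. n_projective \<A> \<C> n P \<and> h \<in> Hom \<A> X P \<and>
        \<eta> \<in> carrier (Ext \<A> \<C> n P Y)}"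

definition stable_Ext ::
  "('o, 'a) addcat \<Rightarrow> 'o set \<Rightarrow> nat \<Rightarrow> 'o \<Rightarrow> 'o \<Rightarrow> 'a list set set monoid" where
  "stable_Ext \<A> \<C> n X Y = Ext \<A> \<C> n X Y Mod proj_ext \<A> \<C> n X Y"

definition stable_class ::
  "('o, 'a) addcat \<Rightarrow> 'o set \<Rightarrow> nat \<Rightarrow> 'o \<Rightarrow> 'o \<Rightarrow> 'a list set \<Rightarrow> 'a list set set" where
  "stable_class \<A> \<C> n X Y \<gamma> = proj_ext \<A> \<C> n X Y #>\<^bsub>Ext \<A> \<C> n X Y\<^esub> \<gamma>"

definition unit_conflation ::
  "('o, 'a) addcat \<Rightarrow> 'o set \<Rightarrow> nat \<Rightarrow> 'o \<Rightarrow> 'o \<Rightarrow> 'a list \<Rightarrow> bool" where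
  "unit_conflation \<A> \<C> n A B E \<longleftrightarrow>
     ext_seq \<A> \<C> n A B E \<and> (\<forall>d\<in>set (butlast E). n_projective \<A> \<C> n (tgt \<A> d))"

definition is_syzygy :: "('o, 'a) addcat \<Rightarrow> 'o set \<Rightarrow> nat \<Rightarrow> 'o \<Rightarrow> 'o \<Rightarrow> bool" where
  "is_syzygy \<A> \<C> n A B \<longleftrightarrow> (\<exists>E. unit_conflation \<A> \<C> n A B E)"

text \<open>
  \<open>unit_ext \<A> \<C> n A B\<close> consists of those members of the class \<open>\<U>\<^sup>n(B)\<close> that end in \<open>A\<close>, regarded
  as elements of \<open>Ext\<^sup>n(A,B)\<close>.
\<close>

definition unit_ext :: "('o, 'a) addcat \<Rightarrow> 'o set \<Rightarrow> nat \<Rightarrow> 'o \<Rightarrow> 'o \<Rightarrow> 'a list set set" where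
  "unit_ext \<A> \<C> n A B = {ext_class \<A> \<C> E | E. unit_conflation \<A> \<C> n A B E}"

definition right_unit_factorization ::
  "('o, 'a) addcat \<Rightarrow> 'o set \<Rightarrow> nat \<Rightarrow> 'o \<Rightarrow> 'o \<Rightarrow> 'a list set \<Rightarrow> 'o \<Rightarrow> 'a list set \<Rightarrow> 'a \<Rightarrow> bool"
  where
  "right_unit_factorization \<A> \<C> n M B \<gamma> A \<delta> f \<longleftrightarrow>
     A \<in> \<C> \<and> \<delta> \<in> unit_ext \<A> \<C> n A B \<and> f \<in> Hom \<A> M A \<and> \<gamma> = ext_pull \<A> \<C> \<delta> f"

definition quasi_invertible :: "('o, 'a) addcat \<Rightarrow> 'o set \<Rightarrow> nat \<Rightarrow> 'a \<Rightarrow> bool" where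
  "quasi_invertible \<A> \<C> n f \<longleftrightarrow>
     f \<in> arr \<A> \<and> src \<A> f \<in> \<C> \<and> tgt \<A> f \<in> \<C> \<and>
     (\<forall>X\<in>\<C>. ext_push \<A> \<C> f \<in>
        iso (Ext \<A> \<C> (n + 1) X (src \<A> f)) (Ext \<A> \<C> (n + 1) X (tgt \<A> f)))"

definition co_angled_pair ::
  "('o, 'a) addcat \<Rightarrow> 'o set \<Rightarrow> nat \<Rightarrow> 'o \<Rightarrow> 'o \<Rightarrow> 'a list set \<Rightarrow> 'o \<Rightarrow> 'a list set
     \<Rightarrow> 'o \<Rightarrow> 'a \<Rightarrow> 'a \<Rightarrow> bool" where
  "co_angled_pair \<A> \<C> n B A \<delta> A' \<delta>' X a b \<longleftrightarrow>
     \<delta> \<in> unit_ext \<A> \<C> n A B \<and> \<delta>' \<in> unit_ext \<A> \<C> n A' B \<and>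
     a \<in> Hom \<A> X A \<and> b \<in> Hom \<A> X A' \<and>
     deflation \<A> \<C> a \<and> deflation \<A> \<C> b \<and> quasi_invertible \<A> \<C> n a \<and> quasi_invertible \<A> \<C> n b \<and>
     ext_pull \<A> \<C> \<delta> a = ext_pull \<A> \<C> \<delta>' b \<and> ext_pull \<A> \<C> \<delta> a \<in> unit_ext \<A> \<C> n X B"

text \<open>\<open>pull_inverse \<A> \<C> n X X' Y \<gamma> b \<gamma>'\<close>: the element \<open>\<gamma>'\<close> is an admissible value of \<open>\<gamma>b\<^sup>-\<^sup>1\<close>.\<close>

definition pull_inverse ::
  "('o, 'a) addcat \<Rightarrow> 'o set \<Rightarrow> nat \<Rightarrow> 'o \<Rightarrow> 'o \<Rightarrow> 'o \<Rightarrow> 'a list set \<Rightarrow> 'a \<Rightarrow> 'a list set \<Rightarrow> bool"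
  where
  "pull_inverse \<A> \<C> n X X' Y \<gamma> b \<gamma>' \<longleftrightarrow>
     \<gamma>' \<in> carrier (Ext \<A> \<C> n X' Y) \<and>
     \<gamma> \<otimes>\<^bsub>Ext \<A> \<C> n X Y\<^esub> inv\<^bsub>Ext \<A> \<C> n X Y\<^esub> (ext_pull \<A> \<C> \<gamma>' b) \<in> proj_ext \<A> \<C> n X Y"

text \<open>
  All values \<open>((\<beta>a)b\<^sup>-\<^sup>1)f\<close> modulo \<open>\<P>\<close> for \<open>\<beta> \<in> Ext\<^sup>n(N,L)\<close>, \<open>\<gamma> \<in> Ext\<^sup>n(M,B)\<close> and \<open>\<delta>\<^sub>N \<in> \<U>\<^sup>n(B)\<close> ending
  in \<open>N\<close>, over all choices of \<open>\<gamma> = \<delta>f\<close>, of the co-angled pair \<open>[\<delta>\<^sub>Na, \<delta>b]\<close> and of \<open>(\<beta>a)b\<^sup>-\<^sup>1\<close>.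
\<close>

definition composition_values ::
  "('o, 'a) addcat \<Rightarrow> 'o set \<Rightarrow> nat \<Rightarrow> 'o \<Rightarrow> 'o \<Rightarrow> 'o \<Rightarrow> 'o \<Rightarrow> 'a list set
     \<Rightarrow> 'a list set \<Rightarrow> 'a list set \<Rightarrow> 'a list set set set" where
  "composition_values \<A> \<C> n M N B L \<delta>N \<beta> \<gamma> =
     {stable_class \<A> \<C> n M L (ext_pull \<A> \<C> \<epsilon> f) | \<epsilon> f A \<delta> X a b.
        right_unit_factorization \<A> \<C> n M B \<gamma> A \<delta> f \<and>
        co_angled_pair \<A> \<C> n B N \<delta>N A \<delta> X a b \<and>
        pull_inverse \<A> \<C> n X A L (ext_pull \<A> \<C> \<beta> a) b \<epsilon>}"

end

theory Submission
  imports Defs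
begin

text \<open>
  Multiplication by a class \<open>\<mu> \<in> Ext\<^sup>n\<^sup>+\<^sup>1(Z,M)\<close> spliced from inflations into n-injectives has kernel
  \<open>\<P>(M,L)\<close> on \<open>Ext\<^sup>n(M,L)\<close>, elements of \<open>\<P>\<close> annihilate \<open>Ext\<^sup>k\<close> for \<open>k > n\<close>, and multiplication by a
  unit conflation is bijective on \<open>Ext\<^sup>k(Z,-)\<close> for \<open>k > n\<close>. Let \<open>\<gamma> = \<delta>f\<close>, let \<open>[\<delta>\<^sub>Na, \<delta>b]\<close> be a co-angled
  pair and let \<open>\<epsilon> = (\<beta>a)b\<^sup>-\<^sup>1\<close>. Since \<open>b\<close> is quasi-invertible, \<open>f\<mu> = bx\<close> for some \<open>x\<close>, so
  \<open>(\<epsilon>f)\<mu> = (\<epsilon>b)x = \<beta>(ax)\<close>, and \<open>\<delta>\<^sub>N(ax) = \<delta>(bx) = \<gamma>\<mu>\<close>. Thus \<open>\<epsilon>f\<close> is determined modulo \<open>\<P>\<close> by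
  \<open>(\<epsilon>f)\<mu> = \<beta>y\<close>, where \<open>y\<close> is the unique class with \<open>\<delta>\<^sub>N y = \<gamma>\<mu>\<close>.

  To see that values exist, map \<open>\<gamma>\<close> and \<open>\<delta>\<^sub>N\<close> to a common unit conflation \<open>\<delta>\<close>, so that \<open>\<gamma> = \<delta>f\<close> and
  \<open>\<delta>\<^sub>N = \<delta>c\<close>, where \<open>c : N \<rightarrow> A\<close> may be taken to be an inflation. Its cokernel is n-projective, so \<open>\<beta>\<close>
  extends along \<open>c\<close> to some \<open>\<epsilon>\<close>. If \<open>p : P\<^sub>0 \<rightarrow> A\<close> is the last map of \<open>\<delta>\<close>, then the projection
  \<open>a : P\<^sub>0 \<oplus> N \<rightarrow> N\<close> and \<open>b = (p, c)\<close> form a co-angled pair with \<open>\<epsilon> = (\<beta>a)b\<^sup>-\<^sup>1\<close>.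
\<close>

section \<open>Arrows of an abelian category\<close>

text \<open>No two choices are compared with each other, and no common refinement of co-angled pairs
  is built: each value satisfies an equation in degree 2n + 1 from which the choices have
  disappeared. The degree n + 1 of \<mu> serves two ends. It exceeds n, so Ext into or out of
  n-projectives vanishes there; and it is the degree in which quasi-invertibility is defined, which
  permits dividing f\<mu> by b. Only the first conflation of \<mu> creates a kernel; the n further
  ones merely raise the degree.

  The obstacle is that Ext consists of classes of lists joined by zigzags of morphisms, with no
  derived functors behind it. The required pieces of the long exact sequences, in both variables,
  are therefore proved from diagrams: degree one directly, higher degrees by splitting off the first
  conflation. Existence rests on dimension shifting along unit conflations, which makes the cokernel
  of an inflation between their right ends n-projective as soon as the inflation pulls one unit back
  to the other.\<close>

lemma Hom_iff: "f \<in> Hom \<A> A B \<longleftrightarrow> f \<in> arr \<A> \<and> src \<A> f = A \<and> tgt \<A> f = B"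
  by (simp add: Hom_def)

text \<open>Dual statements are obtained by interpreting the locales for \<open>opp\<close>. Objects
  and arrows stay the same, so \<open>opp (opp \<A>)\<close> is literally \<A>, and exact sequences
  correspond to their reversed lists.\<close>

definition opp :: "('o, 'a) addcat \<Rightarrow> ('o, 'a) addcat" where
  "opp \<A> = \<lparr>obj = obj \<A>, arr = arr \<A>, src = tgt \<A>, tgt = src \<A>, idn = idn \<A>,
     cmp = (\<lambda>g f. f \<cdot>\<^bsub>\<A>\<^esub> g), hplus = hplus \<A>, hzero = (\<lambda>A B. hzero \<A> B A)\<rparr>"

lemma opp_simps [simp]:
  "obj (opp \<A>) = obj \<A>" "arr (opp \<A>) = arr \<A>" "src (opp \<A>) = tgt \<A>" "tgt (opp \<A>) = src \<A>"
  "idn (opp \<A>) = idn \<A>" "g \<cdot>\<^bsub>opp \<A>\<^esub> f = f \<cdot>\<^bsub>\<A>\<^esub> g" "hplus (opp \<A>) = hplus \<A>"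
  "hzero (opp \<A>) A B = hzero \<A> B A" "opp (opp \<A>) = \<A>"
  by (simp_all add: opp_def)

lemma Hom_opp [simp]: "Hom (opp \<A>) A B = Hom \<A> B A"
  by (auto simp: Hom_def)

section \<open>Calculus of arrows and the additive structure of the hom-sets\<close>

context preadditive_category
begin

abbreviation add_arr (infixl "\<boxplus>" 65) where "f \<boxplus> g \<equiv> hplus \<A> f g"
abbreviation zer where "zer \<equiv> hzero \<A>"
definition "neg f = inv\<^bsub>hom_group \<A> (src \<A> f) (tgt \<A> f)\<^esub> f"

lemma arr_obj [simp]: "f \<in> arr \<A> \<Longrightarrow> src \<A> f \<in> obj \<A>" "f \<in> arr \<A> \<Longrightarrow> tgt \<A> f \<in> obj \<A>"
  by (simp_all add: src_obj tgt_obj)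

lemma arr_idn [simp]: "A \<in> obj \<A> \<Longrightarrow> idn \<A> A \<in> arr \<A>" "A \<in> obj \<A> \<Longrightarrow> src \<A> (idn \<A> A) = A"
  "A \<in> obj \<A> \<Longrightarrow> tgt \<A> (idn \<A> A) = A"
  using idn_Hom by (auto simp: Hom_iff)

lemma arr_cmp [simp]:
  assumes "f \<in> arr \<A>" "g \<in> arr \<A>" "src \<A> g = tgt \<A> f"
  shows "g \<cdot> f \<in> arr \<A>" "src \<A> (g \<cdot> f) = src \<A> f" "tgt \<A> (g \<cdot> f) = tgt \<A> g"
  using cmp_Hom[of f "src \<A> f" "tgt \<A> f" g "tgt \<A> g"] assms by (auto simp: Hom_iff)

lemma idn_cmp [simp]: "f \<in> arr \<A> \<Longrightarrow> tgt \<A> f = B \<Longrightarrow> idn \<A> B \<cdot> f = f"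
  "f \<in> arr \<A> \<Longrightarrow> src \<A> f = A \<Longrightarrow> f \<cdot> idn \<A> A = f"
  using cmp_idn_left cmp_idn_right by (auto simp: Hom_iff)

lemma assoc [simp]: "\<lbrakk>f \<in> arr \<A>; g \<in> arr \<A>; h \<in> arr \<A>; src \<A> g = tgt \<A> f; src \<A> h = tgt \<A> g\<rbrakk>
  \<Longrightarrow> (h \<cdot> g) \<cdot> f = h \<cdot> (g \<cdot> f)"
  using cmp_assoc by (auto simp: Hom_iff)

lemma hom_groupD:
  assumes "A \<in> obj \<A>" "B \<in> obj \<A>"
  shows "comm_group (hom_group \<A> A B)" "carrier (hom_group \<A> A B) = Hom \<A> A B"
    "mult (hom_group \<A> A B) = hplus \<A>" "one (hom_group \<A> A B) = zer A B"
  using hom_comm_group[OF assms] by (auto simp: hom_group_def)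

lemma arr_zer [simp]:
  assumes "A \<in> obj \<A>" "B \<in> obj \<A>"
  shows "zer A B \<in> arr \<A>" "src \<A> (zer A B) = A" "tgt \<A> (zer A B) = B"
proof -
  interpret comm_group "hom_group \<A> A B" by (rule hom_groupD[OF assms])
  show "zer A B \<in> arr \<A>" "src \<A> (zer A B) = A" "tgt \<A> (zer A B) = B"
    using one_closed by (auto simp: hom_group_def Hom_iff)
qed

lemma arr_add [simp]:
  assumes "f \<in> arr \<A>" "g \<in> arr \<A>" "src \<A> g = src \<A> f" "tgt \<A> g = tgt \<A> f"
  shows "f \<boxplus> g \<in> arr \<A>" "src \<A> (f \<boxplus> g) = src \<A> f" "tgt \<A> (f \<boxplus> g) = tgt \<A> f"
proof -
  interpret comm_group "hom_group \<A> (src \<A> f) (tgt \<A> f)" using assms by (simp add: hom_groupD)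
  show "f \<boxplus> g \<in> arr \<A>" "src \<A> (f \<boxplus> g) = src \<A> f" "tgt \<A> (f \<boxplus> g) = tgt \<A> f"
    using m_closed[of f g] assms by (auto simp: hom_group_def Hom_iff)
qed

lemma arr_neg [simp]:
  assumes "f \<in> arr \<A>"
  shows "neg f \<in> arr \<A>" "src \<A> (neg f) = src \<A> f" "tgt \<A> (neg f) = tgt \<A> f"
    "neg f \<boxplus> f = zer (src \<A> f) (tgt \<A> f)" "f \<boxplus> neg f = zer (src \<A> f) (tgt \<A> f)"
proof -
  interpret comm_group "hom_group \<A> (src \<A> f) (tgt \<A> f)" using assms by (simp add: hom_groupD)
  have f: "f \<in> carrier (hom_group \<A> (src \<A> f) (tgt \<A> f))" using assms by (simp add: hom_group_def Hom_iff)
  show "neg f \<in> arr \<A>" "src \<A> (neg f) = src \<A> f" "tgt \<A> (neg f) = tgt \<A> f"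
    using inv_closed[OF f] by (auto simp: neg_def hom_group_def Hom_iff)
  show "neg f \<boxplus> f = zer (src \<A> f) (tgt \<A> f)" "f \<boxplus> neg f = zer (src \<A> f) (tgt \<A> f)"
    using l_inv[OF f] r_inv[OF f] assms by (auto simp: neg_def hom_groupD)
qed

lemma add_simps:
  assumes "f \<in> arr \<A>" "g \<in> arr \<A>" "src \<A> g = src \<A> f" "tgt \<A> g = tgt \<A> f"
  shows add_comm: "f \<boxplus> g = g \<boxplus> f"
    and add_assoc: "h \<in> arr \<A> \<Longrightarrow> src \<A> h = src \<A> f \<Longrightarrow> tgt \<A> h = tgt \<A> f \<Longrightarrow> (f \<boxplus> g) \<boxplus> h = f \<boxplus> (g \<boxplus> h)"
    and add_cancel: "h \<in> arr \<A> \<Longrightarrow> src \<A> h = src \<A> f \<Longrightarrow> tgt \<A> h = tgt \<A> f \<Longrightarrow> f \<boxplus> g = f \<boxplus> h \<Longrightarrow> g = h"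
proof -
  interpret comm_group "hom_group \<A> (src \<A> f) (tgt \<A> f)" using assms by (simp add: hom_groupD)
  note hg = hom_groupD[of "src \<A> f" "tgt \<A> f"]
  have f: "f \<in> carrier (hom_group \<A> (src \<A> f) (tgt \<A> f))" "g \<in> carrier (hom_group \<A> (src \<A> f) (tgt \<A> f))"
    using assms by (simp_all add: hom_group_def Hom_iff)
  show "f \<boxplus> g = g \<boxplus> f" using m_comm[of f g] f by (simp add: hom_group_def)
  assume h: "h \<in> arr \<A>" "src \<A> h = src \<A> f" "tgt \<A> h = tgt \<A> f"
  hence h': "h \<in> carrier (hom_group \<A> (src \<A> f) (tgt \<A> f))" by (simp add: hom_group_def Hom_iff)
  show "(f \<boxplus> g) \<boxplus> h = f \<boxplus> (g \<boxplus> h)" using m_assoc[of f g h] f h' by (simp add: hom_group_def)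
  show "f \<boxplus> g = f \<boxplus> h \<Longrightarrow> g = h" using Units_l_cancel[of f g h] f h' Units_eq by (simp add: hom_group_def)
qed

lemma add_zer [simp]:
  assumes "f \<in> arr \<A>" "src \<A> f = A" "tgt \<A> f = B"
  shows "f \<boxplus> zer A B = f" "zer A B \<boxplus> f = f"
proof -
  interpret comm_group "hom_group \<A> A B" using assms hom_groupD by auto
  show "f \<boxplus> zer A B = f" "zer A B \<boxplus> f = f"
    using l_one[of f] r_one[of f] assms by (simp_all add: hom_group_def Hom_iff)
qed

lemma distrib [simp]:
  "\<lbrakk>f \<in> arr \<A>; f' \<in> arr \<A>; src \<A> f' = src \<A> f; tgt \<A> f' = tgt \<A> f; g \<in> arr \<A>; src \<A> g = tgt \<A> f\<rbrakk>
    \<Longrightarrow> g \<cdot> (f \<boxplus> f') = g \<cdot> f \<boxplus> g \<cdot> f'"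
  "\<lbrakk>f \<in> arr \<A>; f' \<in> arr \<A>; src \<A> f' = src \<A> f; tgt \<A> f' = tgt \<A> f; g \<in> arr \<A>; tgt \<A> g = src \<A> f\<rbrakk>
    \<Longrightarrow> (f \<boxplus> f') \<cdot> g = f \<cdot> g \<boxplus> f' \<cdot> g"
  using cmp_hplus_left[of f "src \<A> f" "tgt \<A> f" f' g "tgt \<A> g"] cmp_hplus_right[of g "src \<A> g" "src \<A> f" f "tgt \<A> f" f']
  by (auto simp: Hom_iff)

lemma zer_cmp [simp]:
  "\<lbrakk>A \<in> obj \<A>; g \<in> arr \<A>; src \<A> g = B\<rbrakk> \<Longrightarrow> g \<cdot> zer A B = zer A (tgt \<A> g)"
  "\<lbrakk>D \<in> obj \<A>; f \<in> arr \<A>; tgt \<A> f = B\<rbrakk> \<Longrightarrow> zer B D \<cdot> f = zer (src \<A> f) D"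
proof -
  assume a: "A \<in> obj \<A>" "g \<in> arr \<A>" "src \<A> g = B"
  hence "g \<cdot> zer A B \<boxplus> g \<cdot> zer A B = g \<cdot> (zer A B \<boxplus> zer A B)" by (subst distrib) auto
  also have "\<dots> = g \<cdot> zer A B \<boxplus> zer A (tgt \<A> g)" using a by auto
  finally show "g \<cdot> zer A B = zer A (tgt \<A> g)" by (rule add_cancel[rotated -1]) (use a in auto)
next
  assume a: "D \<in> obj \<A>" "f \<in> arr \<A>" "tgt \<A> f = B"
  hence "zer B D \<cdot> f \<boxplus> zer B D \<cdot> f = (zer B D \<boxplus> zer B D) \<cdot> f" by (subst distrib) auto
  also have "\<dots> = zer B D \<cdot> f \<boxplus> zer (src \<A> f) D" using a by auto
  finally show "zer B D \<cdot> f = zer (src \<A> f) D" by (rule add_cancel[rotated -1]) (use a in auto)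
qed

lemma neg_cmp:
  "\<lbrakk>f \<in> arr \<A>; g \<in> arr \<A>; src \<A> g = tgt \<A> f\<rbrakk> \<Longrightarrow> g \<cdot> neg f = neg (g \<cdot> f)"
  "\<lbrakk>f \<in> arr \<A>; g \<in> arr \<A>; src \<A> g = tgt \<A> f\<rbrakk> \<Longrightarrow> neg g \<cdot> f = neg (g \<cdot> f)"
proof -
  assume a: "f \<in> arr \<A>" "g \<in> arr \<A>" "src \<A> g = tgt \<A> f"
  have "g \<cdot> f \<boxplus> g \<cdot> neg f = g \<cdot> f \<boxplus> neg (g \<cdot> f)"
    using a by (subst distrib(1)[symmetric]) auto
  thus "g \<cdot> neg f = neg (g \<cdot> f)" by (rule add_cancel[rotated -1]) (use a in auto)
  have "g \<cdot> f \<boxplus> neg g \<cdot> f = g \<cdot> f \<boxplus> neg (g \<cdot> f)"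
    using a by (subst distrib(2)[symmetric]) auto
  thus "neg g \<cdot> f = neg (g \<cdot> f)" by (rule add_cancel[rotated -1]) (use a in auto)
qed

lemma neg_neg [simp]: "f \<in> arr \<A> \<Longrightarrow> neg (neg f) = f"
  by (rule add_cancel[of "neg f"]) auto

lemma diff_zero_eq:
  assumes "f \<boxplus> neg g = zer A B" "f \<in> arr \<A>" "g \<in> arr \<A>" "src \<A> f = A" "tgt \<A> f = B" "src \<A> g = A" "tgt \<A> g = B"
  shows "f = g"
proof -
  have "neg g \<boxplus> f = neg g \<boxplus> g" using assms add_comm[of f "neg g"] by simp
  thus ?thesis by (rule add_cancel[rotated -1]) (use assms in auto)
qed

lemma opp_preadditive: "preadditive_category (opp \<A>)"
proof (rule preadditive_category.intro)
  fix A B assume "A \<in> obj (opp \<A>)" "B \<in> obj (opp \<A>)"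
  moreover have "hom_group (opp \<A>) A B = hom_group \<A> B A" by (simp add: hom_group_def)
  ultimately show "comm_group (hom_group (opp \<A>) A B)" by (simp add: hom_comm_group)
qed (auto simp: Hom_iff)

section \<open>Monomorphisms, kernels and biproducts\<close>

lemma monoI:
  assumes "f \<in> arr \<A>"
    "\<And>u T. \<lbrakk>T \<in> obj \<A>; u \<in> arr \<A>; src \<A> u = T; tgt \<A> u = src \<A> f; f \<cdot> u = zer T (tgt \<A> f)\<rbrakk> \<Longrightarrow> u = zer T (src \<A> f)"
  shows "mono_arr \<A> f"
  unfolding mono_arr_def
proof (intro conjI ballI impI)
  fix T u v assume "T \<in> obj \<A>" "u \<in> Hom \<A> T (src \<A> f)" "v \<in> Hom \<A> T (src \<A> f)" and e: "f \<cdot> u = f \<cdot> v"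
  hence a: "T \<in> obj \<A>" "u \<in> arr \<A>" "v \<in> arr \<A>" "tgt \<A> u = src \<A> f" "tgt \<A> v = src \<A> f" "src \<A> u = T" "src \<A> v = T"
    by (auto simp: Hom_iff)
  have "f \<cdot> (u \<boxplus> neg v) = zer T (tgt \<A> f)"
    using a e assms(1) by (simp add: neg_cmp)
  hence "u \<boxplus> neg v = zer T (src \<A> f)" by (rule assms(2)[rotated 4]) (use a in simp_all)
  thus "u = v" by (rule diff_zero_eq) (use a in auto)
qed (rule assms)

lemma mono_cancel:
  assumes "mono_arr \<A> f" "f \<cdot> u = f \<cdot> v" "u \<in> arr \<A>" "v \<in> arr \<A>" "src \<A> v = src \<A> u" "tgt \<A> u = src \<A> f"
   "tgt \<A> v = src \<A> f"
  shows "u = v"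
proof -
  have "\<forall>T\<in>obj \<A>. \<forall>u\<in>Hom \<A> T (src \<A> f). \<forall>v\<in>Hom \<A> T (src \<A> f). f \<cdot> u = f \<cdot> v \<longrightarrow> u = v"
    using assms(1) by (simp add: mono_arr_def)
  from this[rule_format, of "src \<A> u" u v] show ?thesis using assms by (simp add: Hom_iff)
qed

lemma mono_cancel_zer: "\<lbrakk>mono_arr \<A> f; f \<cdot> u = zer T (tgt \<A> f); u \<in> arr \<A>; src \<A> u = T; tgt \<A> u = src \<A> f\<rbrakk>
   \<Longrightarrow> u = zer T (src \<A> f)"
  by (rule mono_cancel[of f]) (auto simp: mono_arr_def)

end

lemma mono_opp [simp]: "mono_arr (opp \<A>) f = epi_arr \<A> f" "epi_arr (opp \<A>) f = mono_arr \<A> f"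
  by (simp_all add: mono_arr_def epi_arr_def)

lemma kernel_opp [simp]: "is_kernel (opp \<A>) k f = is_cokernel \<A> k f" "is_cokernel (opp \<A>) k f = is_kernel \<A> k f"
  by (auto simp: is_kernel_def is_cokernel_def)

lemma biproduct_opp [simp]: "biproduct (opp \<A>) A B S i1 i2 p1 p2 = biproduct \<A> A B S p1 p2 i1 i2"
  by (auto simp: biproduct_def)

lemma zero_object_opp [simp]: "zero_object (opp \<A>) = zero_object \<A>"
  by (auto simp: zero_object_def fun_eq_iff)

lemma short_exact_opp [simp]: "short_exact (opp \<A>) i p = short_exact \<A> p i"
  by (auto simp: short_exact_def)

lemma pushout_opp: "pushout_square (opp \<A>) p h q p' = pullback_square \<A> q p' p h"
  by (auto simp: pushout_square_def pullback_square_def)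

context preadditive_category
begin

lemma epiI:
  assumes "f \<in> arr \<A>"
    "\<And>u T. \<lbrakk>T \<in> obj \<A>; u \<in> arr \<A>; tgt \<A> u = T; src \<A> u = tgt \<A> f; u \<cdot> f = zer (src \<A> f) T\<rbrakk> \<Longrightarrow> u = zer (tgt \<A> f) T"
  shows "epi_arr \<A> f"
  using preadditive_category.monoI[OF opp_preadditive, of f] assms by auto

lemma epi_cancel: "\<lbrakk>epi_arr \<A> f; u \<cdot> f = v \<cdot> f; u \<in> arr \<A>; v \<in> arr \<A>; tgt \<A> v = tgt \<A> u; src \<A> u = tgt \<A> f;
   src \<A> v = tgt \<A> f\<rbrakk> \<Longrightarrow> u = v"
  using preadditive_category.mono_cancel[OF opp_preadditive, of f u v] by auto

lemma epi_cancel_zer: "\<lbrakk>epi_arr \<A> f; u \<cdot> f = zer (src \<A> f) T; u \<in> arr \<A>; tgt \<A> u = T; src \<A> u = tgt \<A> f\<rbrakk>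
   \<Longrightarrow> u = zer (tgt \<A> f) T"
  using preadditive_category.mono_cancel_zer[OF opp_preadditive, of f u] by auto

text \<open>The uniqueness half of the universal property is stored as \<open>mono_arr\<close>, so
  that later arguments need only a factorization and cancellation.\<close>

lemma kernelD:
  assumes "is_kernel \<A> k f"
  shows "k \<in> arr \<A>" "f \<in> arr \<A>" "tgt \<A> k = src \<A> f" "f \<cdot> k = zer (src \<A> k) (tgt \<A> f)" "mono_arr \<A> k"
    and "\<lbrakk>u \<in> arr \<A>; tgt \<A> u = src \<A> f; f \<cdot> u = zer (src \<A> u) (tgt \<A> f)\<rbrakk>
      \<Longrightarrow> \<exists>w\<in>arr \<A>. src \<A> w = src \<A> u \<and> tgt \<A> w = src \<A> k \<and> k \<cdot> w = u"
proof -
  show k: "k \<in> arr \<A>" "f \<in> arr \<A>" "tgt \<A> k = src \<A> f" "f \<cdot> k = zer (src \<A> k) (tgt \<A> f)"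
    using assms by (auto simp: is_kernel_def)
  have *: "\<exists>!w. w \<in> Hom \<A> (src \<A> u) (src \<A> k) \<and> k \<cdot> w = u"
    if "u \<in> arr \<A>" "tgt \<A> u = src \<A> f" "f \<cdot> u = zer (src \<A> u) (tgt \<A> f)" for u
  proof -
    have "\<forall>T\<in>obj \<A>. \<forall>u\<in>Hom \<A> T (src \<A> f). f \<cdot> u = zer T (tgt \<A> f) \<longrightarrow>
        (\<exists>!w. w \<in> Hom \<A> T (src \<A> k) \<and> k \<cdot> w = u)" using assms by (simp add: is_kernel_def)
    from this[rule_format, of "src \<A> u" u] show ?thesis using that by (simp add: Hom_iff)
  qed
  show "mono_arr \<A> k"
  proof (rule monoI)
    fix u T assume u: "T \<in> obj \<A>" "u \<in> arr \<A>" "src \<A> u = T" "tgt \<A> u = src \<A> k" "k \<cdot> u = zer T (tgt \<A> k)"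
    then have "f \<cdot> zer T (src \<A> f) = zer T (tgt \<A> f)" using k by simp
    hence "\<exists>!w. w \<in> Hom \<A> T (src \<A> k) \<and> k \<cdot> w = zer T (src \<A> f)"
      using *[of "zer T (src \<A> f)"] u k by simp
    moreover have "u \<in> Hom \<A> T (src \<A> k) \<and> k \<cdot> u = zer T (src \<A> f)"
      "zer T (src \<A> k) \<in> Hom \<A> T (src \<A> k) \<and> k \<cdot> zer T (src \<A> k) = zer T (src \<A> f)"
      using u k by (auto simp: Hom_iff)
    ultimately show "u = zer T (src \<A> k)" by blast
  qed (use k in auto)
  show "\<exists>w\<in>arr \<A>. src \<A> w = src \<A> u \<and> tgt \<A> w = src \<A> k \<and> k \<cdot> w = u"
    if "u \<in> arr \<A>" "tgt \<A> u = src \<A> f" "f \<cdot> u = zer (src \<A> u) (tgt \<A> f)" for u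
    using *[OF that] by (auto simp: Hom_iff)
qed

lemma cokernelD:
  assumes "is_cokernel \<A> c f"
  shows "c \<in> arr \<A>" "f \<in> arr \<A>" "src \<A> c = tgt \<A> f" "c \<cdot> f = zer (src \<A> f) (tgt \<A> c)" "epi_arr \<A> c"
    and "\<lbrakk>u \<in> arr \<A>; src \<A> u = tgt \<A> f; u \<cdot> f = zer (src \<A> f) (tgt \<A> u)\<rbrakk>
      \<Longrightarrow> \<exists>w\<in>arr \<A>. src \<A> w = tgt \<A> c \<and> tgt \<A> w = tgt \<A> u \<and> w \<cdot> c = u"
  using preadditive_category.kernelD[OF opp_preadditive, of c f] assms by auto

lemma is_kernelI:
  assumes k: "mono_arr \<A> k" "f \<in> arr \<A>" "tgt \<A> k = src \<A> f" "f \<cdot> k = zer (src \<A> k) (tgt \<A> f)"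
    and *: "\<And>u. \<lbrakk>u \<in> arr \<A>; tgt \<A> u = src \<A> f; f \<cdot> u = zer (src \<A> u) (tgt \<A> f)\<rbrakk>
      \<Longrightarrow> \<exists>w\<in>arr \<A>. src \<A> w = src \<A> u \<and> tgt \<A> w = src \<A> k \<and> k \<cdot> w = u"
  shows "is_kernel \<A> k f"
proof -
  have "\<exists>!w. w \<in> Hom \<A> T (src \<A> k) \<and> k \<cdot> w = u"
    if u: "u \<in> Hom \<A> T (src \<A> f)" "f \<cdot> u = zer T (tgt \<A> f)" for T u
  proof -
    obtain w where w: "w \<in> arr \<A>" "src \<A> w = src \<A> u" "tgt \<A> w = src \<A> k" "k \<cdot> w = u"
      using *[of u] u by (auto simp: Hom_iff)
    show ?thesis
      by (rule ex1I[of _ w]) (use w u mono_cancel[OF k(1)] in \<open>auto simp: Hom_iff\<close>)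
  qed
  thus ?thesis using k unfolding is_kernel_def by (auto simp: mono_arr_def)
qed

lemma is_cokernelI:
  assumes "epi_arr \<A> c" "f \<in> arr \<A>" "src \<A> c = tgt \<A> f" "c \<cdot> f = zer (src \<A> f) (tgt \<A> c)"
    and "\<And>u. \<lbrakk>u \<in> arr \<A>; src \<A> u = tgt \<A> f; u \<cdot> f = zer (src \<A> f) (tgt \<A> u)\<rbrakk>
      \<Longrightarrow> \<exists>w\<in>arr \<A>. src \<A> w = tgt \<A> c \<and> tgt \<A> w = tgt \<A> u \<and> w \<cdot> c = u"
  shows "is_cokernel \<A> c f"
  using preadditive_category.is_kernelI[OF opp_preadditive, of c f] assms by auto

lemma biproductD:
  assumes "biproduct \<A> A B S i1 i2 p1 p2"
  shows "i1 \<in> arr \<A>" "i2 \<in> arr \<A>" "p1 \<in> arr \<A>" "p2 \<in> arr \<A>"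
    "src \<A> i1 = A" "src \<A> i2 = B" "src \<A> p1 = S" "src \<A> p2 = S"
    "tgt \<A> i1 = S" "tgt \<A> i2 = S" "tgt \<A> p1 = A" "tgt \<A> p2 = B"
    "p1 \<cdot> i1 = idn \<A> A" "p2 \<cdot> i2 = idn \<A> B" "p2 \<cdot> i1 = zer A B" "p1 \<cdot> i2 = zer B A"
    "i1 \<cdot> p1 \<boxplus> i2 \<cdot> p2 = idn \<A> S" "A \<in> obj \<A>" "B \<in> obj \<A>" "S \<in> obj \<A>"
  using assms unfolding biproduct_def Hom_iff by auto

text \<open>Composites with a continuation, so that the simplifier can use the biproduct equations inside
  right-associated composites.\<close>

lemma biproduct_cmp:
  assumes "biproduct \<A> A B S i1 i2 p1 p2"
  shows "\<lbrakk>u \<in> arr \<A>; tgt \<A> u = A\<rbrakk> \<Longrightarrow> p1 \<cdot> (i1 \<cdot> u) = u"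
    "\<lbrakk>u \<in> arr \<A>; tgt \<A> u = B\<rbrakk> \<Longrightarrow> p2 \<cdot> (i2 \<cdot> u) = u"
    "\<lbrakk>u \<in> arr \<A>; tgt \<A> u = A\<rbrakk> \<Longrightarrow> p2 \<cdot> (i1 \<cdot> u) = zer (src \<A> u) B"
    "\<lbrakk>u \<in> arr \<A>; tgt \<A> u = B\<rbrakk> \<Longrightarrow> p1 \<cdot> (i2 \<cdot> u) = zer (src \<A> u) A"
    "\<lbrakk>u \<in> arr \<A>; tgt \<A> u = S\<rbrakk> \<Longrightarrow> i1 \<cdot> (p1 \<cdot> u) \<boxplus> i2 \<cdot> (p2 \<cdot> u) = u"
    "\<lbrakk>u \<in> arr \<A>; src \<A> u = S\<rbrakk> \<Longrightarrow> u \<cdot> (i1 \<cdot> p1) \<boxplus> u \<cdot> (i2 \<cdot> p2) = u"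
proof -
  note b = biproductD[OF assms]
  show "p1 \<cdot> (i1 \<cdot> u) = u" if "u \<in> arr \<A>" "tgt \<A> u = A"
    by (subst assoc[symmetric]) (use b that in auto)
  show "p2 \<cdot> (i2 \<cdot> u) = u" if "u \<in> arr \<A>" "tgt \<A> u = B"
    by (subst assoc[symmetric]) (use b that in auto)
  show "p2 \<cdot> (i1 \<cdot> u) = zer (src \<A> u) B" if "u \<in> arr \<A>" "tgt \<A> u = A"
    by (subst assoc[symmetric]) (use b that in auto)
  show "p1 \<cdot> (i2 \<cdot> u) = zer (src \<A> u) A" if "u \<in> arr \<A>" "tgt \<A> u = B"
    by (subst assoc[symmetric]) (use b that in auto)
  show "i1 \<cdot> (p1 \<cdot> u) \<boxplus> i2 \<cdot> (p2 \<cdot> u) = u" if "u \<in> arr \<A>" "tgt \<A> u = S"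
  proof -
    have "i1 \<cdot> (p1 \<cdot> u) \<boxplus> i2 \<cdot> (p2 \<cdot> u) = (i1 \<cdot> p1 \<boxplus> i2 \<cdot> p2) \<cdot> u"
      using b(1-12) that by simp
    thus ?thesis using b that by simp
  qed
  show "u \<cdot> (i1 \<cdot> p1) \<boxplus> u \<cdot> (i2 \<cdot> p2) = u" if "u \<in> arr \<A>" "src \<A> u = S"
  proof -
    have "u \<cdot> (i1 \<cdot> p1) \<boxplus> u \<cdot> (i2 \<cdot> p2) = u \<cdot> (i1 \<cdot> p1 \<boxplus> i2 \<cdot> p2)"
      using b(1-12) that by simp
    thus ?thesis using b that by simp
  qed
qed

end

lemma (in abelian_category) opp_abelian: "abelian_category (opp \<A>)"
proof -
  interpret O: preadditive_category "opp \<A>" by (rule opp_preadditive)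
  show ?thesis
  proof
    fix A B assume "A \<in> obj (opp \<A>)" "B \<in> obj (opp \<A>)"
    thus "\<exists>S i1 i2 p1 p2. biproduct (opp \<A>) A B S i1 i2 p1 p2"
      using biproduct_exists[of A B] by simp blast
  qed (use zero_object_exists kernel_exists cokernel_exists mono_normal epi_normal in auto)
qed

section \<open>Short exact sequences and push-outs\<close>

context abelian_category
begin

text \<open>By normality \<open>k\<close> is the kernel of some \<open>g\<close>, and
  \<open>g\<close> factors through the cokernel \<open>c\<close>. Whatever \<open>c\<close> kills is
  thus killed by \<open>g\<close> and factors through \<open>k\<close>. Exactness therefore has to
  be checked on one side only.\<close>

lemma mono_cokernel_short_exact:
  assumes m: "mono_arr \<A> k" and c: "is_cokernel \<A> c k"
  shows "short_exact \<A> k c"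
proof -
  obtain g where g: "is_kernel \<A> k g" using mono_normal[OF m] by auto
  note G = kernelD[OF g] note C = cokernelD[OF c]
  obtain g' where g': "g' \<in> arr \<A>" "src \<A> g' = tgt \<A> c" "tgt \<A> g' = tgt \<A> g" "g' \<cdot> c = g"
    using C(6)[of g] G(1-4) by auto
  have "is_kernel \<A> k c"
  proof (rule is_kernelI[OF m])
    fix u assume u: "u \<in> arr \<A>" "tgt \<A> u = src \<A> c" "c \<cdot> u = zer (src \<A> u) (tgt \<A> c)"
    have "g \<cdot> u = g' \<cdot> (c \<cdot> u)" using g' u C(1) by (metis assoc)
    hence "g \<cdot> u = zer (src \<A> u) (tgt \<A> g)" using u g' by simp
    thus "\<exists>w\<in>arr \<A>. src \<A> w = src \<A> u \<and> tgt \<A> w = src \<A> k \<and> k \<cdot> w = u"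
      using G(6)[of u] u C(3) G(3) by simp
  qed (use C in auto)
  thus ?thesis using c by (simp add: short_exact_def)
qed

lemma epi_kernel_short_exact:
  assumes m: "epi_arr \<A> p" and c: "is_kernel \<A> k p"
  shows "short_exact \<A> k p"
  using abelian_category.mono_cokernel_short_exact[OF opp_abelian, of p k] assms by simp

lemma short_exactD:
  assumes "short_exact \<A> i p"
  shows "is_kernel \<A> i p" "is_cokernel \<A> p i" "mono_arr \<A> i" "epi_arr \<A> p" "i \<in> arr \<A>" "p \<in> arr \<A>"
    "tgt \<A> i = src \<A> p" "p \<cdot> i = zer (src \<A> i) (tgt \<A> p)"
    "\<lbrakk>u \<in> arr \<A>; tgt \<A> u = src \<A> p; p \<cdot> u = zer (src \<A> u) (tgt \<A> p)\<rbrakk>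
      \<Longrightarrow> \<exists>w\<in>arr \<A>. src \<A> w = src \<A> u \<and> tgt \<A> w = src \<A> i \<and> i \<cdot> w = u"
    "\<lbrakk>u \<in> arr \<A>; src \<A> u = src \<A> p; u \<cdot> i = zer (src \<A> i) (tgt \<A> u)\<rbrakk>
      \<Longrightarrow> \<exists>w\<in>arr \<A>. src \<A> w = tgt \<A> p \<and> tgt \<A> w = tgt \<A> u \<and> w \<cdot> p = u"
  using assms kernelD[of i p] cokernelD[of p i] by (auto simp: short_exact_def)

text \<open>A monomorphism is the kernel of some \<open>h\<close>; being epi as well forces
  \<open>h\<close> to vanish, so the identity factors through \<open>f\<close>.\<close>

lemma mono_epi_iso:
  assumes m: "mono_arr \<A> f" and e: "epi_arr \<A> f"
  shows "\<exists>g\<in>arr \<A>. src \<A> g = tgt \<A> f \<and> tgt \<A> g = src \<A> f \<and> g \<cdot> f = idn \<A> (src \<A> f) \<and> f \<cdot> g = idn \<A> (tgt \<A> f)"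
proof -
  obtain h where h: "is_kernel \<A> f h" using mono_normal[OF m] by auto
  note H = kernelD[OF h]
  have "h = zer (tgt \<A> f) (tgt \<A> h)" by (rule epi_cancel_zer[OF e]) (use H in auto)
  hence "h \<cdot> idn \<A> (tgt \<A> f) = zer (tgt \<A> f) (tgt \<A> h)" using H(1-3) by simp
  then obtain g where g: "g \<in> arr \<A>" "src \<A> g = tgt \<A> f" "tgt \<A> g = src \<A> f" "f \<cdot> g = idn \<A> (tgt \<A> f)"
    using H(6)[of "idn \<A> (tgt \<A> f)"] H(1-3) by auto
  have "g \<cdot> f = idn \<A> (src \<A> f)"
    by (rule mono_cancel[OF m]) (use g H(1-3) in \<open>auto simp del: assoc simp: assoc[symmetric]\<close>)
  thus ?thesis using g by auto
qed

text \<open>The short five lemma, with the inverse of \<open>t\<close> recorded as a morphism of the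
  two sequences in the other direction. This is what makes equivalences of conflations
  symmetric.\<close>

lemma short_five:
  assumes s: "short_exact \<A> i p" "short_exact \<A> i' p'"
    and t: "t \<in> arr \<A>" "src \<A> t = src \<A> p" "tgt \<A> t = src \<A> p'" "t \<cdot> i = i'" "p' \<cdot> t = p"
  shows "\<exists>g\<in>arr \<A>. src \<A> g = src \<A> p' \<and> tgt \<A> g = src \<A> p \<and> g \<cdot> i' = i \<and> p \<cdot> g = p' \<and> t \<cdot> g = idn \<A> (src \<A> p')"
proof -
  note S = short_exactD[OF s(1)] and S' = short_exactD[OF s(2)]
  have ends: "src \<A> i' = src \<A> i" "tgt \<A> p = tgt \<A> p'" using t S(5-7) S'(5-7) by auto
  have "mono_arr \<A> t"
  proof (rule monoI)
    fix u T assume u: "T \<in> obj \<A>" "u \<in> arr \<A>" "src \<A> u = T" "tgt \<A> u = src \<A> t" "t \<cdot> u = zer T (tgt \<A> t)"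
    have "p \<cdot> u = p' \<cdot> (t \<cdot> u)" using t u S'(6) by (metis assoc)
    hence "p \<cdot> u = zer (src \<A> u) (tgt \<A> p)" using u t S'(5-7) ends by simp
    then obtain w where w: "w \<in> arr \<A>" "src \<A> w = src \<A> u" "tgt \<A> w = src \<A> i" "i \<cdot> w = u"
      using S(9)[of u] u t by auto
    have "i' \<cdot> w = t \<cdot> (i \<cdot> w)" using t(1,2,4) w S(5,7) by (metis assoc)
    hence "i' \<cdot> w = zer (src \<A> w) (tgt \<A> i')" using w u t S' by simp
    hence "w = zer (src \<A> w) (src \<A> i')" by (rule mono_cancel_zer[OF S'(3)]) (use w ends in auto)
    thus "u = zer T (src \<A> t)" using w S(5,7) t ends u by (metis zer_cmp(1) arr_obj(1))
  qed (use t in auto)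
  moreover have "epi_arr \<A> t"
  proof (rule epiI)
    fix u T assume u: "T \<in> obj \<A>" "u \<in> arr \<A>" "tgt \<A> u = T" "src \<A> u = tgt \<A> t" "u \<cdot> t = zer (src \<A> t) T"
    have "u \<cdot> i' = (u \<cdot> t) \<cdot> i" using t u(1-4) S(5,7) by simp
    also have "\<dots> = zer (src \<A> i') (tgt \<A> u)" unfolding u(5) using u t S(5-7) ends by simp
    finally have "u \<cdot> i' = zer (src \<A> i') (tgt \<A> u)" .
    then obtain w where w: "w \<in> arr \<A>" "tgt \<A> w = tgt \<A> u" "src \<A> w = tgt \<A> p'" "w \<cdot> p' = u"
      using S'(10)[of u] u t by auto
    have "w \<cdot> p = (w \<cdot> p') \<cdot> t" using t(1,3,5) w S'(6) by (metis assoc)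
    hence "w \<cdot> p = zer (src \<A> p) (tgt \<A> w)" using w u t S' by simp
    hence "w = zer (tgt \<A> p) (tgt \<A> w)" by (rule epi_cancel_zer[OF S(4)]) (use w ends in auto)
    thus "u = zer (tgt \<A> t) T" using w S'(6) t ends u by (metis zer_cmp(2) arr_obj(2))
  qed (use t in auto)
  ultimately obtain g where g: "g \<in> arr \<A>" "src \<A> g = tgt \<A> t" "tgt \<A> g = src \<A> t"
    "g \<cdot> t = idn \<A> (src \<A> t)" "t \<cdot> g = idn \<A> (tgt \<A> t)" using mono_epi_iso by blast
  have "g \<cdot> i' = (g \<cdot> t) \<cdot> i" using g(1-3) t S(5,7) by simp
  hence "g \<cdot> i' = i" using g t S(5,7) by simp
  moreover have "p \<cdot> g = p' \<cdot> (t \<cdot> g)" using g(1-3) t S'(6) by (metis assoc)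
  hence "p \<cdot> g = p'" using g t S'(6) by simp
  ultimately show ?thesis using g t by auto
qed

lemma pushoutD:
  assumes "pushout_square \<A> i g q r"
  shows "i \<in> arr \<A>" "g \<in> arr \<A>" "q \<in> arr \<A>" "r \<in> arr \<A>" "src \<A> i = src \<A> g" "src \<A> q = tgt \<A> i" "src \<A> r = tgt \<A> g"
     "tgt \<A> q = tgt \<A> r" "q \<cdot> i = r \<cdot> g"
    "\<lbrakk>u \<in> arr \<A>; src \<A> u = tgt \<A> i; v \<in> arr \<A>; src \<A> v = tgt \<A> g; tgt \<A> u = tgt \<A> v; u \<cdot> i = v \<cdot> g\<rbrakk> \<Longrightarrow>
       \<exists>w\<in>arr \<A>. src \<A> w = tgt \<A> r \<and> tgt \<A> w = tgt \<A> v \<and> w \<cdot> q = u \<and> w \<cdot> r = v"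
    "\<lbrakk>w \<in> arr \<A>; w' \<in> arr \<A>; src \<A> w = tgt \<A> r; src \<A> w' = tgt \<A> r; tgt \<A> w = tgt \<A> w'; w \<cdot> q = w' \<cdot> q; w \<cdot> r = w' \<cdot> r\<rbrakk>
       \<Longrightarrow> w = w'"
proof -
  show a: "i \<in> arr \<A>" "g \<in> arr \<A>" "q \<in> arr \<A>" "r \<in> arr \<A>" "src \<A> i = src \<A> g" "src \<A> q = tgt \<A> i" "src \<A> r = tgt \<A> g"
     "tgt \<A> q = tgt \<A> r" "q \<cdot> i = r \<cdot> g"
    using assms by (auto simp: pushout_square_def)
  have *: "\<exists>!w. w \<in> Hom \<A> (tgt \<A> r) T \<and> w \<cdot> q = u \<and> w \<cdot> r = v"
    if u: "u \<in> Hom \<A> (tgt \<A> i) T" "v \<in> Hom \<A> (tgt \<A> g) T" "u \<cdot> i = v \<cdot> g" for u v T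
  proof -
    have "\<forall>T\<in>obj \<A>. \<forall>u\<in>Hom \<A> (tgt \<A> i) T. \<forall>v\<in>Hom \<A> (tgt \<A> g) T. u \<cdot> i = v \<cdot> g \<longrightarrow>
        (\<exists>!w. w \<in> Hom \<A> (tgt \<A> q) T \<and> w \<cdot> q = u \<and> w \<cdot> r = v)"
      using assms unfolding pushout_square_def by (elim conjE)
    moreover have "T \<in> obj \<A>" using u(1) by (auto simp: Hom_iff)
    ultimately show ?thesis using u unfolding a(8) by blast
  qed
  show "\<lbrakk>u \<in> arr \<A>; src \<A> u = tgt \<A> i; v \<in> arr \<A>; src \<A> v = tgt \<A> g; tgt \<A> u = tgt \<A> v; u \<cdot> i = v \<cdot> g\<rbrakk> \<Longrightarrow>
       \<exists>w\<in>arr \<A>. src \<A> w = tgt \<A> r \<and> tgt \<A> w = tgt \<A> v \<and> w \<cdot> q = u \<and> w \<cdot> r = v"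
    using *[of u "tgt \<A> v" v] by (auto simp: Hom_iff)
  assume w: "w \<in> arr \<A>" "w' \<in> arr \<A>" "src \<A> w = tgt \<A> r" "src \<A> w' = tgt \<A> r" "tgt \<A> w = tgt \<A> w'" "w \<cdot> q = w' \<cdot> q" "w \<cdot> r = w' \<cdot> r"
  have "(w \<cdot> q) \<cdot> i = (w \<cdot> r) \<cdot> g" using w(1-5) a by simp
  hence "\<exists>!v. v \<in> Hom \<A> (tgt \<A> r) (tgt \<A> w') \<and> v \<cdot> q = w \<cdot> q \<and> v \<cdot> r = w \<cdot> r"
    by (intro *) (use w(1-5) a in \<open>auto simp: Hom_iff\<close>)
  moreover have "w \<in> Hom \<A> (tgt \<A> r) (tgt \<A> w')" "w' \<in> Hom \<A> (tgt \<A> r) (tgt \<A> w')" using w by (auto simp: Hom_iff)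
  ultimately show "w = w'" using w(6,7) by metis
qed

text \<open>The composite of the monomorphisms \<open>i\<close> and \<open>u\<close> has as its
  cokernel the push-out of the cokernel \<open>p\<close> along \<open>u\<close>. This serves to
  enlarge the middle term of a conflation to an n-injective.\<close>

lemma short_exact_cmp:
  assumes s: "short_exact \<A> i p" and e: "short_exact \<A> u q"
    and po: "pushout_square \<A> u p p'' \<alpha>" and t: "tgt \<A> i = src \<A> u"
  shows "short_exact \<A> (u \<cdot> i) p''"
proof -
  note S = short_exactD[OF s] and E = short_exactD[OF e] and P = pushoutD[OF po]
  have m: "mono_arr \<A> (u \<cdot> i)"
  proof (rule monoI)
    fix v T assume v: "T \<in> obj \<A>" "v \<in> arr \<A>" "src \<A> v = T" "tgt \<A> v = src \<A> (u \<cdot> i)" "(u \<cdot> i) \<cdot> v = zer T (tgt \<A> (u \<cdot> i))"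
    have "i \<cdot> v = zer T (src \<A> u)"
      by (rule mono_cancel_zer[OF E(3)]) (use v S(5) E(5) t in auto)
    thus "v = zer T (src \<A> (u \<cdot> i))"
      using mono_cancel_zer[OF S(3), of v T] v S(5) E(5) t by simp
  qed (use S E t in auto)
  have z: "p'' \<cdot> (u \<cdot> i) = zer (src \<A> i) (tgt \<A> p'')"
  proof -
    have "p'' \<cdot> (u \<cdot> i) = (p'' \<cdot> u) \<cdot> i" by (rule assoc[symmetric]) (use P(1-8) S(5-7) E(5-7) t in auto)
    also have "\<dots> = \<alpha> \<cdot> (p \<cdot> i)" unfolding P(9) by (rule assoc) (use P(1-8) S(5-7) E(5-7) t in auto)
    finally show ?thesis using S(5-8) P(1-8) by simp
  qed
  have ex: "\<exists>w\<in>arr \<A>. src \<A> w = tgt \<A> p'' \<and> tgt \<A> w = tgt \<A> v \<and> w \<cdot> p'' = v"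
    if v: "v \<in> arr \<A>" "src \<A> v = tgt \<A> u" "v \<cdot> (u \<cdot> i) = zer (src \<A> i) (tgt \<A> v)" for v
  proof -
    have "(v \<cdot> u) \<cdot> i = zer (src \<A> i) (tgt \<A> (v \<cdot> u))" using v S(5) E(5) t by simp
    then obtain g where g: "g \<in> arr \<A>" "src \<A> g = tgt \<A> p" "tgt \<A> g = tgt \<A> v" "g \<cdot> p = v \<cdot> u"
      using S(10)[of "v \<cdot> u"] v S(7) E(5) t by auto
    obtain w where "w\<in>arr \<A>" "src \<A> w = tgt \<A> \<alpha>" "tgt \<A> w = tgt \<A> g" "w \<cdot> p'' = v"
      using P(10)[of v g] v(1,2) g P(1-8) by auto
    thus ?thesis using P(8) g by auto
  qed
  have "is_cokernel \<A> p'' (u \<cdot> i)"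
  proof (rule is_cokernelI)
    show "epi_arr \<A> p''"
    proof (rule epiI)
      fix w T assume w: "T \<in> obj \<A>" "w \<in> arr \<A>" "tgt \<A> w = T" "src \<A> w = tgt \<A> p''" "w \<cdot> p'' = zer (src \<A> p'') T"
      have "w \<cdot> \<alpha> = zer (tgt \<A> p) T"
      proof (rule epi_cancel_zer[OF S(4)])
        have "(w \<cdot> \<alpha>) \<cdot> p = w \<cdot> (p'' \<cdot> u)" unfolding P(9) by (rule assoc) (use w P(1-8) in auto)
        also have "\<dots> = (w \<cdot> p'') \<cdot> u" by (rule assoc[symmetric]) (use w P(1-8) in auto)
        finally show "(w \<cdot> \<alpha>) \<cdot> p = zer (src \<A> p) T" using w P(1-8) by simp
      qed (use w P(1-8) in auto)
      thus "w = zer (tgt \<A> p'') T" using P(11)[of w "zer (tgt \<A> p'') T"] w P(1-8) by simp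
    qed (use P in auto)
    show "\<exists>w\<in>arr \<A>. src \<A> w = tgt \<A> p'' \<and> tgt \<A> w = tgt \<A> v \<and> w \<cdot> p'' = v"
      if v: "v \<in> arr \<A>" "src \<A> v = tgt \<A> (u \<cdot> i)" "v \<cdot> (u \<cdot> i) = zer (src \<A> (u \<cdot> i)) (tgt \<A> v)" for v
      using ex[of v] v S(5) E(5) t by auto
  qed (use P(1-8) S(5-7) E(5-7) t z in auto)
  thus ?thesis using mono_cokernel_short_exact m by blast
qed

lemma pushout_exists:
  assumes i: "i \<in> arr \<A>" "g \<in> arr \<A>" "src \<A> i = src \<A> g"
  shows "\<exists>q r. pushout_square \<A> i g q r"
proof -
  obtain S i1 i2 p1 p2 where b: "biproduct \<A> (tgt \<A> i) (tgt \<A> g) S i1 i2 p1 p2"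
    using biproduct_exists[of "tgt \<A> i" "tgt \<A> g"] i by auto
  note B = biproductD[OF b] and BC = biproduct_cmp[OF b]
  \<comment> \<open>Because of the sign on \<open>g\<close>, an arrow out of the biproduct vanishes
    on \<open>k\<close> exactly when its two components agree after composition with
    \<open>i\<close> and \<open>g\<close>.\<close>
  define k where "k = i1 \<cdot> i \<boxplus> i2 \<cdot> neg g"
  have k: "k \<in> arr \<A>" "src \<A> k = src \<A> i" "tgt \<A> k = S" using B(1-12) i by (auto simp: k_def)
  obtain c where c: "is_cokernel \<A> c k" using cokernel_exists[OF k(1)] by auto
  note C = cokernelD[OF c]
  have sq: "(c \<cdot> i1) \<cdot> i = (c \<cdot> i2) \<cdot> g"
  proof -
    have "c \<cdot> (i1 \<cdot> i) \<boxplus> neg (c \<cdot> (i2 \<cdot> g)) = c \<cdot> k"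
      unfolding k_def using B(1-12) i C(1,3) k by (simp add: neg_cmp)
    hence "c \<cdot> (i1 \<cdot> i) \<boxplus> neg (c \<cdot> (i2 \<cdot> g)) = zer (src \<A> i) (tgt \<A> c)" using C(4) k by simp
    hence "c \<cdot> (i1 \<cdot> i) = c \<cdot> (i2 \<cdot> g)" by (rule diff_zero_eq) (use B(1-12) i C(1,3) k in auto)
    thus ?thesis using B(1-12) i C(1,3) k by simp
  qed
  have "pushout_square \<A> i g (c \<cdot> i1) (c \<cdot> i2)"
    unfolding pushout_square_def
  proof (intro conjI ballI impI)
    fix T u v assume "T \<in> obj \<A>" "u \<in> Hom \<A> (tgt \<A> i) T" "v \<in> Hom \<A> (tgt \<A> g) T" and e: "u \<cdot> i = v \<cdot> g"
    hence u: "u \<in> arr \<A>" "src \<A> u = tgt \<A> i" "tgt \<A> u = T" "v \<in> arr \<A>" "src \<A> v = tgt \<A> g" "tgt \<A> v = T"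
      by (auto simp: Hom_iff)
    let ?s = "u \<cdot> p1 \<boxplus> v \<cdot> p2"
    have "?s \<cdot> k = u \<cdot> i \<boxplus> neg (v \<cdot> g)" unfolding k_def using B i u BC by (simp add: neg_cmp)
    hence "?s \<cdot> k = zer (src \<A> k) T" using e i u k by simp
    then obtain w where w: "w \<in> arr \<A>" "src \<A> w = tgt \<A> c" "tgt \<A> w = T" "w \<cdot> c = ?s"
      using C(6)[of ?s] k u B(1-12) by auto
    have "w \<cdot> (c \<cdot> i1) = (w \<cdot> c) \<cdot> i1" by (rule assoc[symmetric]) (use w C k B in auto)
    hence w1: "w \<cdot> (c \<cdot> i1) = u" unfolding w(4) using u B by simp
    have "w \<cdot> (c \<cdot> i2) = (w \<cdot> c) \<cdot> i2" by (rule assoc[symmetric]) (use w C k B in auto)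
    hence w2: "w \<cdot> (c \<cdot> i2) = v" unfolding w(4) using u B by simp
    show "\<exists>!w. w \<in> Hom \<A> (tgt \<A> (c \<cdot> i1)) T \<and> w \<cdot> (c \<cdot> i1) = u \<and> w \<cdot> (c \<cdot> i2) = v"
    proof (rule ex1I[of _ w])
      show "w \<in> Hom \<A> (tgt \<A> (c \<cdot> i1)) T \<and> w \<cdot> (c \<cdot> i1) = u \<and> w \<cdot> (c \<cdot> i2) = v"
        using w w1 w2 C k B by (auto simp: Hom_iff)
      fix w' assume a: "w' \<in> Hom \<A> (tgt \<A> (c \<cdot> i1)) T \<and> w' \<cdot> (c \<cdot> i1) = u \<and> w' \<cdot> (c \<cdot> i2) = v"
      hence w': "w' \<in> arr \<A>" "src \<A> w' = tgt \<A> c" "tgt \<A> w' = T" using C k B by (auto simp: Hom_iff)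
      have "w' \<cdot> c = (w' \<cdot> c) \<cdot> (i1 \<cdot> p1) \<boxplus> (w' \<cdot> c) \<cdot> (i2 \<cdot> p2)"
        by (rule BC(6)[symmetric]) (use w' C(1,3) k in auto)
      also have "\<dots> = (w' \<cdot> (c \<cdot> i1)) \<cdot> p1 \<boxplus> (w' \<cdot> (c \<cdot> i2)) \<cdot> p2"
        using w' C(1,3) k B(1-12) by simp
      also have "\<dots> = w \<cdot> c" using a w by simp
      finally show "w' = w" by (rule epi_cancel[OF C(5)]) (use w w' in auto)
    qed
  qed (use B(1-12) C(1,3) k i sq in auto)
  thus ?thesis by blast
qed

text \<open>The push-out object is the cokernel of the monomorphism \<open>(i, - g)\<close> into the biproduct. Normality
  makes \<open>(i, - g)\<close> its kernel, and this forces \<open>r\<close> to be mono.\<close>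

lemma pushout_short_exact:
  assumes s: "short_exact \<A> i p" and po: "pushout_square \<A> i g q r"
    and b: "biproduct \<A> (tgt \<A> i) (tgt \<A> g) S i1 i2 p1 p2"
  shows "short_exact \<A> (i1 \<cdot> i \<boxplus> i2 \<cdot> neg g) (q \<cdot> p1 \<boxplus> r \<cdot> p2)"
    and "\<lbrakk>p' \<in> arr \<A>; src \<A> p' = tgt \<A> q; tgt \<A> p' = tgt \<A> p; p' \<cdot> q = p; p' \<cdot> r = zer (tgt \<A> g) (tgt \<A> p)\<rbrakk>
      \<Longrightarrow> short_exact \<A> r p'"
    and "\<exists>p'\<in>arr \<A>. src \<A> p' = tgt \<A> q \<and> tgt \<A> p' = tgt \<A> p \<and> p' \<cdot> q = p \<and> p' \<cdot> r = zer (tgt \<A> g) (tgt \<A> p)"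
proof -
  note Se = short_exactD[OF s] and P = pushoutD[OF po] and B = biproductD[OF b] and BC = biproduct_cmp[OF b]
  define k where "k = i1 \<cdot> i \<boxplus> i2 \<cdot> neg g"
  define w where "w = q \<cdot> p1 \<boxplus> r \<cdot> p2"
  have k: "k \<in> arr \<A>" "src \<A> k = src \<A> i" "tgt \<A> k = S" using B(1-12) P(1-8) by (auto simp: k_def)
  have w: "w \<in> arr \<A>" "src \<A> w = S" "tgt \<A> w = tgt \<A> r" using B(1-12) P(1-8) by (auto simp: w_def)
  have p1k: "p1 \<cdot> k = i" using B P(1-8) BC by (simp add: k_def)
  have mk: "mono_arr \<A> k"
  proof (rule monoI)
    fix u T assume u: "T \<in> obj \<A>" "u \<in> arr \<A>" "src \<A> u = T" "tgt \<A> u = src \<A> k" "k \<cdot> u = zer T (tgt \<A> k)"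
    have "i \<cdot> u = p1 \<cdot> (k \<cdot> u)" unfolding p1k[symmetric] by (rule assoc) (use u k B in auto)
    hence "i \<cdot> u = zer T (tgt \<A> i)" using u B k by simp
    thus "u = zer T (src \<A> k)" using mono_cancel_zer[OF Se(3)] u k by auto
  qed (use k in auto)
  have wi: "w \<cdot> i1 = q" "w \<cdot> i2 = r" using B P(1-8) by (simp_all add: w_def)
  have cw: "is_cokernel \<A> w k"
  proof (rule is_cokernelI)
    show "epi_arr \<A> w"
    proof (rule epiI)
      fix u T assume u: "T \<in> obj \<A>" "u \<in> arr \<A>" "tgt \<A> u = T" "src \<A> u = tgt \<A> w" "u \<cdot> w = zer (src \<A> w) T"
      have "u \<cdot> q = (u \<cdot> w) \<cdot> i1" "u \<cdot> r = (u \<cdot> w) \<cdot> i2"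
        unfolding wi[symmetric] by (rule assoc[symmetric]; use u w B in auto)+
      hence "u \<cdot> q = zer (tgt \<A> i) T" "u \<cdot> r = zer (tgt \<A> g) T" using u w B by simp_all
      thus "u = zer (tgt \<A> w) T" using P(11)[of u "zer (tgt \<A> r) T"] u w P(1-8) by simp
    qed (use w in auto)
    have "w \<cdot> k = q \<cdot> i \<boxplus> neg (r \<cdot> g)" using B P(1-8) BC by (simp add: k_def w_def neg_cmp)
    thus "w \<cdot> k = zer (src \<A> k) (tgt \<A> w)" using P k w by simp
    fix u assume u: "u \<in> arr \<A>" "src \<A> u = tgt \<A> k" "u \<cdot> k = zer (src \<A> k) (tgt \<A> u)"
    have "(u \<cdot> i1) \<cdot> i \<boxplus> neg ((u \<cdot> i2) \<cdot> g) = u \<cdot> k"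
      unfolding k_def using u B P(1-8) k by (simp add: neg_cmp)
    also have "\<dots> = zer (src \<A> i) (tgt \<A> u)" using u k by simp
    finally have "(u \<cdot> i1) \<cdot> i = (u \<cdot> i2) \<cdot> g" by (rule diff_zero_eq) (use u B(1-12) P(1-8) k in auto)
    then obtain v where v: "v \<in> arr \<A>" "src \<A> v = tgt \<A> r" "tgt \<A> v = tgt \<A> u" "v \<cdot> q = u \<cdot> i1" "v \<cdot> r = u \<cdot> i2"
      using P(10)[of "u \<cdot> i1" "u \<cdot> i2"] u B(1-12) k by auto
    have "v \<cdot> w = (v \<cdot> q) \<cdot> p1 \<boxplus> (v \<cdot> r) \<cdot> p2" using v(1-3) B(1-12) P(1-8) by (simp add: w_def)
    also have "\<dots> = u" unfolding v(4,5) using BC(6)[of u] u k B(1-12) by simp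
    finally show "\<exists>v\<in>arr \<A>. src \<A> v = tgt \<A> w \<and> tgt \<A> v = tgt \<A> u \<and> v \<cdot> w = u" using v w by auto
  qed (use k w in auto)
  show sw: "short_exact \<A> (i1 \<cdot> i \<boxplus> i2 \<cdot> neg g) (q \<cdot> p1 \<boxplus> r \<cdot> p2)"
    using mono_cokernel_short_exact[OF mk cw] by (simp only: k_def w_def)
  hence W: "short_exact \<A> k w" by (simp only: k_def w_def)
  have mr: "mono_arr \<A> r"
  proof (rule monoI)
    fix u T assume u: "T \<in> obj \<A>" "u \<in> arr \<A>" "src \<A> u = T" "tgt \<A> u = src \<A> r" "r \<cdot> u = zer T (tgt \<A> r)"
    \<comment> \<open>If \<open>r\<close> kills \<open>u\<close>, the pair (0, u) lies in the kernel
      of \<open>w\<close>, hence equals \<open>k \<cdot> v\<close>; its first component shows that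
      \<open>i\<close> kills \<open>v\<close>, so both \<open>v\<close> and \<open>u\<close>
      vanish.\<close>
    have "w \<cdot> (i2 \<cdot> u) = r \<cdot> u" unfolding wi[symmetric] by (rule assoc[symmetric]) (use u B w P in auto)
    then obtain v where v: "v \<in> arr \<A>" "src \<A> v = T" "tgt \<A> v = src \<A> k" "k \<cdot> v = i2 \<cdot> u"
      using short_exactD(9)[OF W, of "i2 \<cdot> u"] u B w P(1-8) by auto
    have "i \<cdot> v = p1 \<cdot> (k \<cdot> v)" unfolding p1k[symmetric] by (rule assoc) (use v k B in auto)
    hence "i \<cdot> v = zer T (tgt \<A> i)" unfolding v(4) using BC(4)[of u] u P(1-8) by auto
    hence "v = zer T (src \<A> i)" using mono_cancel_zer[OF Se(3)] v k by auto
    hence "i2 \<cdot> u = zer T S" using v k u by simp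
    hence "p2 \<cdot> (i2 \<cdot> u) = zer T (tgt \<A> g)" using B u by simp
    thus "u = zer T (src \<A> r)" using BC(2)[of u] u P(1-8) by simp
  qed (use P in auto)
  show "short_exact \<A> r p'" if p': "p' \<in> arr \<A>" "src \<A> p' = tgt \<A> q" "tgt \<A> p' = tgt \<A> p" "p' \<cdot> q = p"
     "p' \<cdot> r = zer (tgt \<A> g) (tgt \<A> p)" for p'
  proof (rule mono_cokernel_short_exact[OF mr is_cokernelI])
    show "epi_arr \<A> p'"
    proof (rule epiI)
      fix u T assume u: "T \<in> obj \<A>" "u \<in> arr \<A>" "tgt \<A> u = T" "src \<A> u = tgt \<A> p'" "u \<cdot> p' = zer (src \<A> p') T"
      have "u \<cdot> p = (u \<cdot> p') \<cdot> q" unfolding p'(4)[symmetric] by (rule assoc[symmetric]) (use u p' P in auto)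
      hence "u \<cdot> p = zer (src \<A> p) T" using u p' P(1-8) Se(5-7) by simp
      thus "u = zer (tgt \<A> p') T" using epi_cancel_zer[OF Se(4)] u p' by auto
    qed (use p' in auto)
    fix u assume u: "u \<in> arr \<A>" "src \<A> u = tgt \<A> r" "u \<cdot> r = zer (src \<A> r) (tgt \<A> u)"
    have "(u \<cdot> q) \<cdot> i = (u \<cdot> r) \<cdot> g" using u(1,2) P by simp
    hence "(u \<cdot> q) \<cdot> i = zer (src \<A> i) (tgt \<A> (u \<cdot> q))" unfolding u(3) using u P(1-8) by simp
    then obtain v where v: "v \<in> arr \<A>" "src \<A> v = tgt \<A> p" "tgt \<A> v = tgt \<A> u" "v \<cdot> p = u \<cdot> q"
      using Se(10)[of "u \<cdot> q"] u P(1-8) Se(5-7) by auto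
    have "v \<cdot> p' = u"
    proof (rule P(11))
      show "(v \<cdot> p') \<cdot> q = u \<cdot> q" using v p' P(1-8) by simp
      show "(v \<cdot> p') \<cdot> r = u \<cdot> r" using v p' P(1-8) u by simp
    qed (use v p' u P(1-8) in auto)
    thus "\<exists>v\<in>arr \<A>. src \<A> v = tgt \<A> p' \<and> tgt \<A> v = tgt \<A> u \<and> v \<cdot> p' = u" using v p' by auto
  qed (use p' P in auto)
  have "p \<cdot> i = zer (tgt \<A> g) (tgt \<A> p) \<cdot> g" using Se(5-8) P(1-8) by simp
  thus "\<exists>p'\<in>arr \<A>. src \<A> p' = tgt \<A> q \<and> tgt \<A> p' = tgt \<A> p \<and> p' \<cdot> q = p \<and> p' \<cdot> r = zer (tgt \<A> g) (tgt \<A> p)"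
    using P(10)[of p "zer (tgt \<A> g) (tgt \<A> p)"] Se(5-7) P(1-8) by auto
qed

end

section \<open>Sequences and their morphisms\<close>

locale ext_category = abelian_category \<A> for \<A> :: "('o, 'a) addcat" (structure) +
  fixes \<C> :: "'o set"
  assumes closed: "additive_ext_closed \<A> \<C>"

lemma conflation_opp [simp]: "conflation (opp \<A>) \<C> i p = conflation \<A> \<C> p i"
proof -
  have "tgt \<A> p = src \<A> i" if "short_exact \<A> p i" using that by (simp add: short_exact_def is_kernel_def)
  thus ?thesis by (auto simp: conflation_def)
qed

lemma (in ext_category) opp_ext_category: "ext_category (opp \<A>) \<C>"
  unfolding ext_category_def ext_category_axioms_def
proof
  show "abelian_category (opp \<A>)" by (rule opp_abelian)
  have a: "\<C> \<subseteq> obj \<A>" "\<exists>Z\<in>\<C>. zero_object \<A> Z"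
     "\<And>i p. short_exact \<A> i p \<Longrightarrow> src \<A> i \<in> \<C> \<Longrightarrow> tgt \<A> p \<in> \<C> \<Longrightarrow> tgt \<A> i \<in> \<C>"
    and b: "\<And>A B. A\<in>\<C> \<Longrightarrow> B\<in>\<C> \<Longrightarrow> \<exists>S\<in>\<C>. \<exists>i1 i2 p1 p2. biproduct \<A> A B S i1 i2 p1 p2"
    using closed unfolding additive_ext_closed_def by blast+
  show "additive_ext_closed (opp \<A>) \<C>"
    unfolding additive_ext_closed_def
  proof (intro conjI allI impI ballI)
    fix i p assume "short_exact (opp \<A>) i p" and s: "src (opp \<A>) i \<in> \<C>" "tgt (opp \<A>) p \<in> \<C>"
    hence "short_exact \<A> p i" by simp
    thus "tgt (opp \<A>) i \<in> \<C>" using a(3)[of p i] short_exactD(7)[of p i] s by simp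
  next
    fix A B assume "A \<in> \<C>" "B \<in> \<C>"
    thus "\<exists>S\<in>\<C>. \<exists>i1 i2 p1 p2. biproduct (opp \<A>) A B S i1 i2 p1 p2"
      using b[of A B] unfolding biproduct_opp by blast
  qed (use a in auto)
qed

text \<open>Only the outer vertical arrows matter for equivalence, push-outs and pull-backs, so the
  inner ones are hidden in existential quantifiers. The recursion, unlike the indexing in
  \<open>seq_morphism\<close>, supports induction on the lists.\<close>

fun mor :: "('o, 'a) addcat \<Rightarrow> 'a list \<Rightarrow> 'a list \<Rightarrow> 'a \<Rightarrow> 'a \<Rightarrow> bool" where
  "mor \<A> [] [] f h \<longleftrightarrow> f = h"
| "mor \<A> (e # E) (e' # E') f h \<longleftrightarrow> f \<in> Hom \<A> (src \<A> e) (src \<A> e') \<and>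
     (\<exists>g\<in>Hom \<A> (tgt \<A> e) (tgt \<A> e'). g \<cdot>\<^bsub>\<A>\<^esub> e = e' \<cdot>\<^bsub>\<A>\<^esub> f \<and> mor \<A> E E' g h)"
| "mor \<A> _ _ _ _ \<longleftrightarrow> False"

text \<open>Both end objects are arguments because the inductions reach the empty list, which no
  longer determines them.\<close>

fun is_path :: "('o, 'a) addcat \<Rightarrow> 'o \<Rightarrow> 'a list \<Rightarrow> 'o \<Rightarrow> bool" where
  "is_path \<A> X [] Y \<longleftrightarrow> X = Y"
| "is_path \<A> X (e # E) Y \<longleftrightarrow> e \<in> arr \<A> \<and> src \<A> e = X \<and> is_path \<A> (tgt \<A> e) E Y"

definition splice_seq :: "('o, 'a) addcat \<Rightarrow> 'a list \<Rightarrow> 'a list \<Rightarrow> 'a list" where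
  "splice_seq \<A> E F = butlast E @ (hd F \<cdot>\<^bsub>\<A>\<^esub> last E) # tl F"

lemma seq_morphism_Nil: "seq_morphism \<A> [] E' \<phi> \<longleftrightarrow> E' = [] \<and> (\<exists>f. \<phi> = [f])"
  by (auto simp: seq_morphism_def length_Suc_conv)

lemma seq_morphism_Cons: "seq_morphism \<A> (e # E) (e' # E') (f # g # \<phi>) \<longleftrightarrow>
   f \<in> Hom \<A> (src \<A> e) (src \<A> e') \<and> g \<in> Hom \<A> (tgt \<A> e) (tgt \<A> e') \<and> g \<cdot>\<^bsub>\<A>\<^esub> e = e' \<cdot>\<^bsub>\<A>\<^esub> f \<and>
   seq_morphism \<A> E E' (g # \<phi>)"
  by (auto simp: seq_morphism_def All_less_Suc2)

lemma seq_morphism_mor: "(\<exists>\<phi>. seq_morphism \<A> E E' \<phi> \<and> hd \<phi> = f \<and> last \<phi> = h) \<longleftrightarrow> mor \<A> E E' f h"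
proof (induction \<A> E E' f h rule: mor.induct)
  case (1 \<A> f h)
  show ?case unfolding seq_morphism_Nil by (auto intro: exI[of _ "[f]"])
next
  case (2 \<A> e E e' E' f h)
  show ?case
  proof
    assume "\<exists>\<phi>. seq_morphism \<A> (e # E) (e' # E') \<phi> \<and> hd \<phi> = f \<and> last \<phi> = h"
    then obtain \<phi> where p: "seq_morphism \<A> (e # E) (e' # E') \<phi>" "hd \<phi> = f" "last \<phi> = h" by blast
    then obtain g \<psi> where ps: "\<phi> = f # g # \<psi>"
      by (cases \<phi>; cases "tl \<phi>") (auto simp: seq_morphism_def)
    have "mor \<A> E E' g h" using p unfolding ps seq_morphism_Cons
      by (intro 2[of g, THEN iffD1] exI[of _ "g # \<psi>"]) simp_all
    thus "mor \<A> (e # E) (e' # E') f h" using p unfolding ps seq_morphism_Cons by auto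
  next
    assume "mor \<A> (e # E) (e' # E') f h"
    then obtain g where g: "f \<in> Hom \<A> (src \<A> e) (src \<A> e')" "g\<in>Hom \<A> (tgt \<A> e) (tgt \<A> e')"
      "g \<cdot>\<^bsub>\<A>\<^esub> e = e' \<cdot>\<^bsub>\<A>\<^esub> f" "mor \<A> E E' g h" by auto
    then obtain \<phi> where p: "seq_morphism \<A> E E' \<phi>" "hd \<phi> = g" "last \<phi> = h" using 2[of g] by blast
    then obtain \<psi> where ps: "\<phi> = g # \<psi>" by (cases \<phi>) (auto simp: seq_morphism_def)
    show "\<exists>\<phi>. seq_morphism \<A> (e # E) (e' # E') \<phi> \<and> hd \<phi> = f \<and> last \<phi> = h"
      by (rule exI[of _ "f # g # \<psi>"]) (use p g ps in \<open>simp add: seq_morphism_Cons\<close>)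
  qed
qed (auto simp: seq_morphism_def)

lemma mor_length: "mor \<A> E E' f h \<Longrightarrow> length E = length E'"
  by (induction \<A> E E' f h rule: mor.induct) auto

lemma mor_ConsI: "\<lbrakk>f \<in> Hom \<A> (src \<A> e) (src \<A> e'); g \<in> Hom \<A> (tgt \<A> e) (tgt \<A> e'); g \<cdot>\<^bsub>\<A>\<^esub> e = e' \<cdot>\<^bsub>\<A>\<^esub> f;
    mor \<A> E E' g h\<rbrakk> \<Longrightarrow> mor \<A> (e # E) (e' # E') f h"
  by auto

lemma mor_append: "length E = length E' \<Longrightarrow>
  mor \<A> (E @ F) (E' @ F') f h \<longleftrightarrow> (\<exists>g. mor \<A> E E' f g \<and> mor \<A> F F' g h)"
  by (induction E E' arbitrary: f rule: list_induct2) (simp, simp, blast)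

text \<open>Reversal exchanges domain and codomain of a morphism as well as its two ends; in this
  form statements on push-outs are read as statements on pull-backs.\<close>

lemma mor_opp_rev: "mor (opp \<A>) (rev E) (rev E') f h \<longleftrightarrow> mor \<A> E' E h f"
proof (cases "length E = length E'")
  case True
  thus ?thesis
  proof (induction E E' arbitrary: h rule: list_induct2)
    case (Cons e E e' E')
    have "mor (opp \<A>) [e] [e'] g h \<longleftrightarrow> mor \<A> [e'] [e] h g" for g by auto
    moreover have "mor \<A> ([e'] @ E') ([e] @ E) h f \<longleftrightarrow> (\<exists>g. mor \<A> [e'] [e] h g \<and> mor \<A> E' E g f)"
      by (rule mor_append) simp
    ultimately show ?case using Cons by (simp del: mor.simps add: mor_append) blast
  qed auto
next
  case False
  thus ?thesis using mor_length[of "opp \<A>" "rev E" "rev E'"] mor_length[of \<A> E' E] by auto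
qed

lemma mor_ends: "mor \<A> E E' f h \<Longrightarrow> E \<noteq> [] \<Longrightarrow> E' \<noteq> [] \<and> f \<in> Hom \<A> (src \<A> (hd E)) (src \<A> (hd E')) \<and>
   h \<in> Hom \<A> (tgt \<A> (last E)) (tgt \<A> (last E'))"
proof (induction \<A> E E' f h rule: mor.induct)
  case (2 \<A> e E e' E' f h)
  obtain g where g: "f \<in> Hom \<A> (src \<A> e) (src \<A> e')" "g\<in>Hom \<A> (tgt \<A> e) (tgt \<A> e')" "mor \<A> E E' g h"
    using 2(2) by auto
  show ?case
  proof (cases "E = []")
    case True
    thus ?thesis using g mor_length[OF g(3)] by simp
  next
    case False
    thus ?thesis using g 2(1)[OF g(2,3) False] mor_length[OF g(3)] by auto
  qed
qed auto

lemma is_path_append: "is_path \<A> X (E @ F) Z \<longleftrightarrow> (\<exists>Y. is_path \<A> X E Y \<and> is_path \<A> Y F Z)"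
  by (induction E arbitrary: X) auto

lemma splice_seq_simp [simp]: "splice_seq \<A> (E @ [p]) (j # F) = E @ (j \<cdot>\<^bsub>\<A>\<^esub> p) # F" "splice_seq \<A> [i, p] (j # F) = i # (j \<cdot>\<^bsub>\<A>\<^esub> p) # F"
  by (simp_all add: splice_seq_def)

context preadditive_category
begin

lemma mor_id: "X \<in> obj \<A> \<Longrightarrow> is_path \<A> X E Y \<Longrightarrow> mor \<A> E E (idn \<A> X) (idn \<A> Y)"
proof (induction E arbitrary: X)
  case (Cons e E)
  hence "mor \<A> E E (idn \<A> (tgt \<A> e)) (idn \<A> Y)" by simp
  thus ?case using Cons(2,3) by (auto simp: Hom_iff intro!: bexI[of _ "idn \<A> (tgt \<A> e)"])
qed simp

lemma mor_zero: "\<lbrakk>length E = length E'; X \<in> obj \<A>; X' \<in> obj \<A>; is_path \<A> X E Y; is_path \<A> X' E' Y'\<rbrakk>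
   \<Longrightarrow> mor \<A> E E' (zer X X') (zer Y Y')"
proof (induction E E' arbitrary: X X' rule: list_induct2)
  case (Cons e E e' E')
  hence "mor \<A> E E' (zer (tgt \<A> e) (tgt \<A> e')) (zer Y Y')" by simp
  thus ?case using Cons(3-) by (auto simp: Hom_iff intro!: bexI[of _ "zer (tgt \<A> e) (tgt \<A> e')"])
qed simp

lemma mor_cmp:
  assumes "mor \<A> E E' f h" "mor \<A> E' E'' f' h'" "set E \<subseteq> arr \<A>" "set E' \<subseteq> arr \<A>" "set E'' \<subseteq> arr \<A>"
  shows "mor \<A> E E'' (f' \<cdot> f) (h' \<cdot> h)"
proof -
  have "length E = length E'" "length E' = length E''" using mor_length[OF assms(1)] mor_length[OF assms(2)] by auto
  thus ?thesis using assms
  proof (induction E E' E'' arbitrary: f f' rule: list_induct3)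
    case (Cons e E e' E' e'' E'')
    obtain g where g: "f \<in> Hom \<A> (src \<A> e) (src \<A> e')" "g\<in>Hom \<A> (tgt \<A> e) (tgt \<A> e')"
      "g \<cdot> e = e' \<cdot> f" "mor \<A> E E' g h" using Cons(4) by auto
    obtain g' where g': "f' \<in> Hom \<A> (src \<A> e') (src \<A> e'')" "g'\<in>Hom \<A> (tgt \<A> e') (tgt \<A> e'')"
      "g' \<cdot> e' = e'' \<cdot> f'" "mor \<A> E' E'' g' h'" using Cons(5) by auto
    have m: "mor \<A> E E'' (g' \<cdot> g) (h' \<cdot> h)" using Cons(3)[OF g(4) g'(4)] Cons(6-8) by simp
    have "(g' \<cdot> g) \<cdot> e = g' \<cdot> (e' \<cdot> f)" unfolding g(3)[symmetric]
      by (rule assoc) (use g g' Cons(6-8) in \<open>auto simp: Hom_iff\<close>)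
    also have "\<dots> = (g' \<cdot> e') \<cdot> f"
      by (rule assoc[symmetric]) (use g g' Cons(6-8) in \<open>auto simp: Hom_iff\<close>)
    also have "\<dots> = e'' \<cdot> (f' \<cdot> f)" unfolding g'(3)
      by (rule assoc) (use g g' Cons(6-8) in \<open>auto simp: Hom_iff\<close>)
    finally have "(g' \<cdot> g) \<cdot> e = e'' \<cdot> (f' \<cdot> f)" .
    moreover have "f' \<cdot> f \<in> Hom \<A> (src \<A> e) (src \<A> e'')" "g' \<cdot> g \<in> Hom \<A> (tgt \<A> e) (tgt \<A> e'')"
      using g g' by (auto simp: Hom_iff)
    ultimately show ?case using m by auto
  qed auto
qed

lemma mor_splice_seq:
  assumes "mor \<A> E E' f g" "mor \<A> F F' g h" "E \<noteq> []" "F \<noteq> []" "set E \<subseteq> arr \<A>" "set E' \<subseteq> arr \<A>" "set F \<subseteq> arr \<A>" "set F' \<subseteq> arr \<A>"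
    "src \<A> (hd F) = tgt \<A> (last E)" "src \<A> (hd F') = tgt \<A> (last E')"
  shows "mor \<A> (splice_seq \<A> E F) (splice_seq \<A> E' F') f h"
proof -
  have l: "length E = length E'" "length F = length F'" using mor_length[OF assms(1)] mor_length[OF assms(2)] by auto
  obtain es p where E: "E = es @ [p]" using assms(3) by (cases E rule: rev_cases) auto
  obtain es' p' where E': "E' = es' @ [p']" using assms(3) l by (cases E' rule: rev_cases) auto
  obtain j fs where F: "F = j # fs" using assms(4) by (cases F) auto
  obtain j' fs' where F': "F' = j' # fs'" using assms(4) l by (cases F') auto
  have le: "length es = length es'" using l E E' by simp
  obtain m where m: "mor \<A> es es' f m" "m \<in> Hom \<A> (src \<A> p) (src \<A> p')" "g \<in> Hom \<A> (tgt \<A> p) (tgt \<A> p')" "g \<cdot> p = p' \<cdot> m"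
    using assms(1) unfolding E E' mor_append[OF le] by auto
  obtain k where k: "k \<in> Hom \<A> (tgt \<A> j) (tgt \<A> j')" "k \<cdot> j = j' \<cdot> g" "mor \<A> fs fs' k h"
    using assms(2) unfolding F F' by auto
  have a: "p \<in> arr \<A>" "p' \<in> arr \<A>" "j \<in> arr \<A>" "j' \<in> arr \<A>" "src \<A> j = tgt \<A> p" "src \<A> j' = tgt \<A> p'"
    using assms(5-10) E E' F F' by auto
  have "k \<cdot> (j \<cdot> p) = (k \<cdot> j) \<cdot> p" by (rule assoc[symmetric]) (use a k in \<open>auto simp: Hom_iff\<close>)
  also have "\<dots> = j' \<cdot> (g \<cdot> p)" unfolding k(2) by (rule assoc) (use a m in \<open>auto simp: Hom_iff\<close>)
  also have "\<dots> = (j' \<cdot> p') \<cdot> m" unfolding m(4) by (rule assoc[symmetric]) (use a m in \<open>auto simp: Hom_iff\<close>)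
  finally have "mor \<A> ((j \<cdot> p) # fs) ((j' \<cdot> p') # fs') m h" using k m a by auto
  thus ?thesis unfolding E E' F F' splice_seq_simp mor_append[OF le] using m(1) by blast
qed

text \<open>The converse of splicing, for the first conflation: the middle component is compatible
  with \<open>i\<close> and \<open>i'\<close>, so it descends along the cokernel \<open>p\<close> to
  an arrow \<open>g\<close>, and \<open>g\<close> commutes with \<open>j\<close> and
  \<open>j'\<close> because \<open>p\<close> is epi.\<close>

lemma mor_split:
  assumes "mor \<A> (splice_seq \<A> [i, p] (j # F)) (splice_seq \<A> [i', p'] (j' # F')) f h" "short_exact \<A> i p" "short_exact \<A> i' p'"
    "j \<in> arr \<A>" "j' \<in> arr \<A>" "src \<A> j = tgt \<A> p" "src \<A> j' = tgt \<A> p'"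
  shows "\<exists>g. g \<in> Hom \<A> (tgt \<A> p) (tgt \<A> p') \<and> mor \<A> [i, p] [i', p'] f g \<and> mor \<A> (j # F) (j' # F') g h"
proof -
  have s: "is_kernel \<A> i p" "is_cokernel \<A> p i" "is_kernel \<A> i' p'" "is_cokernel \<A> p' i'"
    using assms by (auto simp: short_exact_def)
  note I = kernelD[OF s(1)] and P = cokernelD[OF s(2)] and I' = kernelD[OF s(3)] and P' = cokernelD[OF s(4)]
  obtain m k where m: "f \<in> Hom \<A> (src \<A> i) (src \<A> i')" "m \<in> Hom \<A> (tgt \<A> i) (tgt \<A> i')" "m \<cdot> i = i' \<cdot> f"
    "k \<in> Hom \<A> (tgt \<A> j) (tgt \<A> j')" "k \<cdot> (j \<cdot> p) = (j' \<cdot> p') \<cdot> m" "mor \<A> F F' k h"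
    using assms(1,4-7) I(1,3) I'(1,3) P(1) P'(1) by auto
  have "(p' \<cdot> m) \<cdot> i = p' \<cdot> (i' \<cdot> f)" unfolding m(3)[symmetric] by (rule assoc) (use m I(1-3) I'(1-3) in \<open>auto simp: Hom_iff\<close>)
  also have "\<dots> = (p' \<cdot> i') \<cdot> f" by (rule assoc[symmetric]) (use m I(1-3) I'(1-3) in \<open>auto simp: Hom_iff\<close>)
  finally have "(p' \<cdot> m) \<cdot> i = zer (src \<A> i) (tgt \<A> (p' \<cdot> m))" using m I(1-4) I'(1-4) by (simp add: Hom_iff)
  then obtain g where g: "g \<in> arr \<A>" "src \<A> g = tgt \<A> p" "tgt \<A> g = tgt \<A> p'" "g \<cdot> p = p' \<cdot> m"
    using P(6)[of "p' \<cdot> m"] m I(1-3) I'(1-3) by (auto simp: Hom_iff)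
  have "k \<cdot> j = j' \<cdot> g"
  proof (rule epi_cancel[OF P(5)])
    have "(k \<cdot> j) \<cdot> p = k \<cdot> (j \<cdot> p)" by (rule assoc) (use m P(1) assms in \<open>auto simp: Hom_iff\<close>)
    also have "\<dots> = j' \<cdot> (p' \<cdot> m)" unfolding m(5) by (rule assoc) (use m I(3) I'(3) P'(1) assms in \<open>auto simp: Hom_iff\<close>)
    also have "\<dots> = (j' \<cdot> g) \<cdot> p" unfolding g(4)[symmetric] by (rule assoc[symmetric]) (use g P(1) assms in \<open>auto simp: Hom_iff\<close>)
    finally show "(k \<cdot> j) \<cdot> p = (j' \<cdot> g) \<cdot> p" .
  qed (use m g assms in \<open>auto simp: Hom_iff\<close>)
  moreover have "m \<in> Hom \<A> (src \<A> p) (src \<A> p')" using m I(3) I'(3) by simp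
  ultimately show ?thesis using m g assms(6,7) by (intro exI[of _ g]) (auto simp: Hom_iff)
qed

end

context ext_category
begin

abbreviation "seq \<equiv> ext_seq \<A> \<C>"
abbreviation "conf \<equiv> conflation \<A> \<C>"

lemma C_obj [simp]: "A \<in> \<C> \<Longrightarrow> A \<in> obj \<A>"
  using closed by (auto simp: additive_ext_closed_def)

lemma C_ext: "short_exact \<A> i p \<Longrightarrow> src \<A> i \<in> \<C> \<Longrightarrow> tgt \<A> p \<in> \<C> \<Longrightarrow> tgt \<A> i \<in> \<C>"
  using closed by (auto simp: additive_ext_closed_def)

lemma conflationI: "\<lbrakk>short_exact \<A> i p; src \<A> i \<in> \<C>; tgt \<A> p \<in> \<C>\<rbrakk> \<Longrightarrow> conf i p"
  using C_ext by (simp add: conflation_def)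

lemma conflationD:
  assumes "conf i p"
  shows "short_exact \<A> i p" "i \<in> arr \<A>" "p \<in> arr \<A>" "tgt \<A> i = src \<A> p" "src \<A> i \<in> \<C>" "src \<A> p \<in> \<C>" "tgt \<A> p \<in> \<C>"
    "p \<cdot> i = zer (src \<A> i) (tgt \<A> p)"
  using assms short_exactD[of i p] by (auto simp: conflation_def)

lemma biproduct_short_exact:
  assumes "biproduct \<A> A B S i1 i2 p1 p2"
  shows "short_exact \<A> i1 p2"
proof -
  note B = biproductD[OF assms] and BC = biproduct_cmp[OF assms]
  show ?thesis
  proof (rule mono_cokernel_short_exact[OF monoI is_cokernelI[OF epiI]])
    fix u T assume u: "T \<in> obj \<A>" "u \<in> arr \<A>" "src \<A> u = T" "tgt \<A> u = src \<A> i1" "i1 \<cdot> u = zer T (tgt \<A> i1)"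
    hence "p1 \<cdot> (i1 \<cdot> u) = zer T (src \<A> i1)" using B by simp
    thus "u = zer T (src \<A> i1)" using BC(1)[of u] u B by simp
  next
    fix u T assume u: "T \<in> obj \<A>" "u \<in> arr \<A>" "tgt \<A> u = T" "src \<A> u = tgt \<A> p2" "u \<cdot> p2 = zer (src \<A> p2) T"
    have "u = (u \<cdot> p2) \<cdot> i2" using u(1-4) B by simp
    also have "\<dots> = zer (tgt \<A> p2) T" unfolding u(5) using u(1) B by simp
    finally show "u = zer (tgt \<A> p2) T" .
  next
    fix u assume u: "u \<in> arr \<A>" "src \<A> u = tgt \<A> i1" "u \<cdot> i1 = zer (src \<A> i1) (tgt \<A> u)"
    have "u = u \<cdot> (i1 \<cdot> p1) \<boxplus> u \<cdot> (i2 \<cdot> p2)" using BC(6)[of u] u B by simp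
    also have "u \<cdot> (i1 \<cdot> p1) = (u \<cdot> i1) \<cdot> p1" using u(1,2) B by simp
    also have "\<dots> = zer S (tgt \<A> u)" unfolding u(3) using u(1) B by simp
    finally have "u = (u \<cdot> i2) \<cdot> p2" using u(1,2) B by simp
    thus "\<exists>w\<in>arr \<A>. src \<A> w = tgt \<A> p2 \<and> tgt \<A> w = tgt \<A> u \<and> w \<cdot> p2 = u"
      using u(1,2) B by (intro bexI[of _ "u \<cdot> i2"]) auto
  qed (use B in auto)
qed

text \<open>Closure provides one biproduct in \<C>. That every biproduct lies there, in particular
  the one picked by \<open>biprod_of\<close>, comes from closure under extensions.\<close>

lemma biproduct_C: "biproduct \<A> A B S i1 i2 p1 p2 \<Longrightarrow> A \<in> \<C> \<Longrightarrow> B \<in> \<C> \<Longrightarrow> S \<in> \<C>"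
  using C_ext[OF biproduct_short_exact] biproductD(5,9,12) by metis

lemma zero_objectD:
  assumes "zero_object \<A> Z"
  shows "Z \<in> obj \<A>" "\<lbrakk>f \<in> arr \<A>; tgt \<A> f = Z; src \<A> f = A\<rbrakk> \<Longrightarrow> f = zer A Z"
    "\<lbrakk>f \<in> arr \<A>; src \<A> f = Z; tgt \<A> f = A\<rbrakk> \<Longrightarrow> f = zer Z A"
proof -
  show Z: "Z \<in> obj \<A>" using assms by (simp add: zero_object_def)
  have u: "\<exists>!f. f \<in> Hom \<A> A Z" "\<exists>!f. f \<in> Hom \<A> Z A" if "A \<in> obj \<A>" for A
    using assms that unfolding zero_object_def by blast+
  show "f = zer A Z" if f: "f \<in> arr \<A>" "tgt \<A> f = Z" "src \<A> f = A"
  proof -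
    have "A \<in> obj \<A>" using f by auto
    thus ?thesis using u(1)[of A] f Z by (auto simp: Hom_iff)
  qed
  show "f = zer Z A" if f: "f \<in> arr \<A>" "src \<A> f = Z" "tgt \<A> f = A"
  proof -
    have "A \<in> obj \<A>" using f by auto
    thus ?thesis using u(2)[of A] f Z by (auto simp: Hom_iff)
  qed
qed

text \<open>The zero object chosen in \<open>zero_seq\<close> need not be the one provided by
  closure. But any zero object is, with zero structure maps, a biproduct of two copies of a given
  one, and biproducts stay in \<C>.\<close>

lemma zero_object_C:
  assumes "zero_object \<A> Z"
  shows "Z \<in> \<C>"
proof -
  obtain Z0 where Z0: "Z0 \<in> \<C>" "zero_object \<A> Z0" using closed by (auto simp: additive_ext_closed_def)
  note zd = zero_objectD[OF assms] zero_objectD[OF Z0(2)]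
  have "idn \<A> Z = zer Z Z" "idn \<A> Z0 = zer Z0 Z0" using zd(2)[of "idn \<A> Z" Z] zd(5)[of "idn \<A> Z0" Z0] zd(1,4) by auto
  hence "biproduct \<A> Z0 Z0 Z (zer Z0 Z) (zer Z0 Z) (zer Z Z0) (zer Z Z0)"
    using zd(1,4) by (simp add: biproduct_def Hom_iff)
  thus ?thesis using biproduct_C Z0 by blast
qed

section \<open>Sequences spliced from conflations, their push-outs and pull-backs\<close>

lemma spliced_facts:
  "spliced \<A> \<C> t E \<Longrightarrow> length E = Suc t \<and> 0 < t \<and> is_path \<A> (src \<A> (hd E)) E (tgt \<A> (last E)) \<and>
     src \<A> (hd E) \<in> \<C> \<and> tgt \<A> (last E) \<in> \<C> \<and> (\<forall>e\<in>set E. e \<in> arr \<A> \<and> src \<A> e \<in> \<C> \<and> tgt \<A> e \<in> \<C>) \<and>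
     (\<exists>i d es. E = i # d # es \<and> d \<cdot> i = zer (src \<A> i) (tgt \<A> d))"
proof (induction rule: spliced.induct)
  case (single i p)
  thus ?case using conflationD[OF single] by auto
next
  case (splice i p t j ds)
  note c = conflationD[OF splice(1)]
  obtain d es where ds: "ds = d # es" using splice(4) by auto
  have "(j \<cdot> p) \<cdot> i = zer (src \<A> i) (tgt \<A> j)" using c splice(3,4) by simp
  thus ?case using c splice(3,4) ds by auto
qed

lemma seqD:
  assumes "seq t A B E"
  shows "length E = Suc t" "0 < t" "is_path \<A> B E A" "A \<in> \<C>" "B \<in> \<C>" "set E \<subseteq> arr \<A>" "E \<noteq> []" "src \<A> (hd E) = B" "tgt \<A> (last E) = A"
    "\<forall>e\<in>set E. src \<A> e \<in> \<C> \<and> tgt \<A> e \<in> \<C>" "\<exists>i d es. E = i # d # es \<and> d \<cdot> i = zer (src \<A> i) (tgt \<A> d)"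
  using assms spliced_facts[of t E] unfolding ext_seq_def by auto

lemma seq_single: "seq (Suc 0) A B E \<longleftrightarrow> (\<exists>i p. E = [i, p] \<and> conf i p \<and> src \<A> i = B \<and> tgt \<A> p = A)"
proof
  assume a: "seq (Suc 0) A B E"
  hence "spliced \<A> \<C> (Suc 0) E" by (simp add: ext_seq_def)
  thus "\<exists>i p. E = [i, p] \<and> conf i p \<and> src \<A> i = B \<and> tgt \<A> p = A"
    by (cases rule: spliced.cases) (use a spliced_facts in \<open>auto simp: ext_seq_def\<close>)
next
  assume "\<exists>i p. E = [i, p] \<and> conf i p \<and> src \<A> i = B \<and> tgt \<A> p = A"
  thus "seq (Suc 0) A B E" using spliced.single by (auto simp: ext_seq_def)
qed

lemma seq_split:
  assumes "seq (Suc t) A B E" "0 < t"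
  shows "\<exists>i p F. conf i p \<and> src \<A> i = B \<and> seq t A (tgt \<A> p) F \<and> E = splice_seq \<A> [i, p] F"
proof -
  have "spliced \<A> \<C> (Suc t) E" using assms by (simp add: ext_seq_def)
  thus ?thesis
  proof (cases rule: spliced.cases)
    case (splice i p j ds)
    have "ds \<noteq> []" using spliced_facts[OF splice(3)] by auto
    thus ?thesis using splice assms(1)
      by (intro exI[of _ i] exI[of _ p] exI[of _ "j # ds"]) (auto simp: ext_seq_def)
  qed (use assms in auto)
qed

lemma spliced_splice_seq:
  "\<lbrakk>spliced \<A> \<C> s E; spliced \<A> \<C> t F; src \<A> (hd F) = tgt \<A> (last E)\<rbrakk> \<Longrightarrow> spliced \<A> \<C> (s + t) (splice_seq \<A> E F)"
proof (induction rule: spliced.induct)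
  case (single i p)
  obtain j ds where F: "F = j # ds" using spliced_facts[OF single(2)] by auto
  show ?case using spliced.splice[of \<A> \<C> i p t j ds] single F by simp
next
  case (splice i p s j ds)
  have ds: "ds \<noteq> []" using spliced_facts[OF splice(2)] by auto
  have s: "spliced \<A> \<C> (s + t) (splice_seq \<A> (j # ds) F)" using splice ds by auto
  moreover have y: "splice_seq \<A> (j # ds) F = j # tl (splice_seq \<A> (j # ds) F)" "splice_seq \<A> (i # (j \<cdot> p) # ds) F = i # (j \<cdot> p) # tl (splice_seq \<A> (j # ds) F)"
    using ds by (auto simp: splice_seq_def)
  ultimately show ?case using spliced.splice[OF splice(1) _ splice(3), of "s + t" "tl (splice_seq \<A> (j # ds) F)"] by simp
qed

lemma splice_seq_ends: "length E \<ge> 2 \<Longrightarrow> length F \<ge> 2 \<Longrightarrow> hd (splice_seq \<A> E F) = hd E \<and> last (splice_seq \<A> E F) = last F"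
  by (cases E; cases F) (auto simp: splice_seq_def)

lemma seq_splice: "\<lbrakk>seq s A B E; seq t Z A F\<rbrakk> \<Longrightarrow> seq (s + t) Z B (splice_seq \<A> E F)"
  using spliced_splice_seq[of s E t F] splice_seq_ends[of E F] seqD(1,2)[of s A B E] seqD(1,2)[of t Z A F]
  by (auto simp: ext_seq_def)

lemma seq_splice1: "\<lbrakk>conf i p; seq t Z (tgt \<A> p) F\<rbrakk> \<Longrightarrow> seq (Suc t) Z (src \<A> i) (splice_seq \<A> [i, p] F)"
  using seq_splice[of "Suc 0" "tgt \<A> p" "src \<A> i" "[i,p]" t Z F] by (auto simp: seq_single)

lemma splice_seq_assoc: "length F \<ge> 2 \<Longrightarrow> splice_seq \<A> (splice_seq \<A> E F) G = splice_seq \<A> E (splice_seq \<A> F G)"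
  by (cases F rule: rev_cases; cases "butlast F") (auto simp: splice_seq_def butlast_append)

lemma spliced_rev: "spliced \<A> \<C> t E \<Longrightarrow> spliced (opp \<A>) \<C> t (rev E)"
proof (induction rule: spliced.induct)
  case (single i p)
  thus ?case using spliced.single[of "opp \<A>" \<C> p i] by simp
next
  case (splice i p t j ds)
  interpret O: ext_category "opp \<A>" \<C> by (rule opp_ext_category)
  have "spliced (opp \<A>) \<C> (Suc 0) [p, i]" using spliced.single[of "opp \<A>" \<C> p i] splice by simp
  hence "spliced (opp \<A>) \<C> (t + Suc 0) (splice_seq (opp \<A>) (rev (j # ds)) [p, i])"
    using O.spliced_splice_seq[OF splice(4), of "Suc 0" "[p, i]"] splice(3) by simp
  thus ?case by (simp add: splice_seq_def)
qed

lemma seq_rev: "ext_seq (opp \<A>) \<C> t B A (rev E) \<longleftrightarrow> seq t A B E"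
proof -
  interpret O: ext_category "opp \<A>" \<C> by (rule opp_ext_category)
  have "spliced (opp \<A>) \<C> t (rev E) \<longleftrightarrow> spliced \<A> \<C> t E"
    using spliced_rev[of t E] O.spliced_rev[of t "rev E"] by auto
  thus ?thesis using spliced_facts[of t E] by (cases "E = []") (auto simp: ext_seq_def hd_rev last_rev)
qed

lemma seq_mor_id: "seq t A B E \<Longrightarrow> mor \<A> E E (idn \<A> B) (idn \<A> A)"
  using mor_id[of B E A] seqD[of t A B E] by simp

text \<open>The third conclusion is the universal property of the push-out of a whole sequence.
  Applied with an identity for \<open>g\<close> it turns a morphism over \<open>f\<close> into an
  equivalence, which is how equalities of classes arise.\<close>

lemma seq_pushoutD:
  assumes E: "seq t A B E" and f: "f \<in> Hom \<A> B B'" "B' \<in> \<C>" and po: "seq_pushout \<A> f E E'"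
  shows "seq t A B' E'" "mor \<A> E E' f (idn \<A> A)"
    "\<lbrakk>mor \<A> E E'' (g \<cdot> f) h; seq t A'' B'' E''; g \<in> Hom \<A> B' B''\<rbrakk> \<Longrightarrow> mor \<A> E' E'' g h"
proof -
  obtain es i d i' d' q where
    e: "E = i # d # es" "E' = i' # d' # es" and sq: "pushout_square \<A> i f q i'"
     "d' \<in> Hom \<A> (tgt \<A> q) (tgt \<A> d)" "d' \<cdot> q = d" "d' \<cdot> i' = zer (tgt \<A> f) (tgt \<A> d)"
    using po unfolding seq_pushout_def by auto
  note P = pushoutD[OF sq(1)] and Ed = seqD[OF E]
  have fB: "src \<A> f = B" "tgt \<A> f = B'" "f \<in> arr \<A>" using f by (auto simp: Hom_iff)
  have d': "d' \<in> arr \<A>" "src \<A> d' = tgt \<A> i'" "tgt \<A> d' = tgt \<A> d" using sq(2) P(8) by (auto simp: Hom_iff)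
  have d: "d \<in> arr \<A>" "src \<A> d = tgt \<A> i" using Ed(3) e by auto
  obtain S i1 i2 p1 p2 where b: "biproduct \<A> (tgt \<A> i) (tgt \<A> f) S i1 i2 p1 p2"
    using biproduct_exists P by force
  have "spliced \<A> \<C> t E" using E by (simp add: ext_seq_def)
  hence "spliced \<A> \<C> t E'"
  proof (cases rule: spliced.cases)
    case (single i0 p0)
    hence eq: "i0 = i" "p0 = d" "es = []" using e by auto
    have "short_exact \<A> i' d'"
      by (rule pushout_short_exact(2)[OF conflationD(1)[OF single(3)[unfolded eq]] sq(1) b]) (use d' sq P in auto)
    hence "conf i' d'" using single(3) conflationD(7)[OF single(3)] P(7) fB f d' eq by (intro conflationI) auto
    thus ?thesis using spliced.single single e eq by simp
  next
    \<comment> \<open>In a longer sequence the push-out concerns the conflation \<open>i\<close>,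
      \<open>p\<close> alone; uniqueness then identifies the prescribed second arrow
      \<open>d'\<close> with \<open>j \<cdot> p'\<close>.\<close>
    case (splice i0 p t' j ds)
    hence eq: "i0 = i" "d = j \<cdot> p" "es = ds" using e by auto
    note c = conflationD[OF splice(3)[unfolded eq]]
    obtain p' where p': "p'\<in>arr \<A>" "src \<A> p' = tgt \<A> q" "tgt \<A> p' = tgt \<A> p" "p' \<cdot> q = p" "p' \<cdot> i' = zer (tgt \<A> f) (tgt \<A> p)"
      using pushout_short_exact(3)[OF c(1) sq(1) b] by blast
    have "short_exact \<A> i' p'"
      by (rule pushout_short_exact(2)[OF c(1) sq(1) b]) (use p' in auto)
    hence cc: "conf i' p'" using c P(7) fB f p' by (intro conflationI) auto
    have j: "j \<in> arr \<A>" using spliced_facts[OF splice(4)] by auto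
    have "d' = j \<cdot> p'"
    proof (rule P(11))
      show "d' \<cdot> q = (j \<cdot> p') \<cdot> q" using sq p' j splice(5) eq P(1-8) by simp
      show "d' \<cdot> i' = (j \<cdot> p') \<cdot> i'" using sq p' j splice(5) eq P(1-8) c(3) by simp
    qed (use d' p' j splice(5) P eq c(3) in auto)
    thus ?thesis using spliced.splice[OF cc splice(4)] splice(1,5) p'(3) e eq by simp
  qed
  thus "seq t A B' E'" using Ed(9) e P(7) fB d' by (auto simp: ext_seq_def)
  have pe: "is_path \<A> (tgt \<A> d) es A" using Ed(3) e by simp
  hence m: "mor \<A> es es (idn \<A> (tgt \<A> d)) (idn \<A> A)" using d by (intro mor_id) auto
  show "mor \<A> E E' f (idn \<A> A)"
    unfolding e
    by (rule mor_ConsI[of _ _ _ _ q], rule_tac [4] mor_ConsI[of _ _ _ _ "idn \<A> (tgt \<A> d)"])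
      (use P(1-9) fB d d' m sq(3) in \<open>auto simp: Hom_iff\<close>)
  assume m: "mor \<A> E E'' (g \<cdot> f) h" and E'': "seq t A'' B'' E''" and g: "g \<in> Hom \<A> B' B''"
  obtain i2 d2 es2 where e2: "E'' = i2 # d2 # es2" "d2 \<cdot> i2 = zer (src \<A> i2) (tgt \<A> d2)" using seqD(11)[OF E''] by blast
  have d2: "d2 \<in> arr \<A>" "src \<A> d2 = tgt \<A> i2" "i2 \<in> arr \<A>" "src \<A> i2 = B''" using seqD(3)[OF E''] e2 by auto
  have g': "g \<in> arr \<A>" "src \<A> g = B'" "tgt \<A> g = B''" using g by (auto simp: Hom_iff)
  obtain u k where "u \<in> Hom \<A> (tgt \<A> i) (tgt \<A> i2)" "u \<cdot> i = i2 \<cdot> (g \<cdot> f)" "k \<in> Hom \<A> (tgt \<A> d) (tgt \<A> d2)"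
    "k \<cdot> d = d2 \<cdot> u" "mor \<A> es es2 k h"
    using m unfolding e e2 by auto
  hence u: "u \<in> arr \<A>" "src \<A> u = tgt \<A> i" "tgt \<A> u = tgt \<A> i2" "u \<cdot> i = (i2 \<cdot> g) \<cdot> f"
     "k \<in> arr \<A>" "src \<A> k = tgt \<A> d" "tgt \<A> k = tgt \<A> d2" "k \<cdot> d = d2 \<cdot> u" "mor \<A> es es2 k h"
    using fB g' d2 by (auto simp: Hom_iff)
  obtain w where w: "w \<in> arr \<A>" "src \<A> w = tgt \<A> i'" "tgt \<A> w = tgt \<A> i2" "w \<cdot> q = u" "w \<cdot> i' = i2 \<cdot> g"
    using P(10)[of u "i2 \<cdot> g"] u(1-4) d2 g' fB by auto
  have kd: "k \<cdot> d' = d2 \<cdot> w"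
  proof (rule P(11))
    have "(k \<cdot> d') \<cdot> q = k \<cdot> d" unfolding sq(3)[symmetric] by (rule assoc) (use u d' P in auto)
    also have "\<dots> = (d2 \<cdot> w) \<cdot> q" unfolding u(8) w(4)[symmetric] by (rule assoc[symmetric]) (use w d2 P in auto)
    finally show "(k \<cdot> d') \<cdot> q = (d2 \<cdot> w) \<cdot> q" .
    have "(k \<cdot> d') \<cdot> i' = zer B' (tgt \<A> d2)" using u d' P(1-8) sq fB f by simp
    moreover have "(d2 \<cdot> w) \<cdot> i' = d2 \<cdot> (i2 \<cdot> g)" unfolding w(5)[symmetric] by (rule assoc) (use w d2 P in auto)
    moreover have "\<dots> = (d2 \<cdot> i2) \<cdot> g" by (rule assoc[symmetric]) (use g' d2 in auto)
    ultimately show "(k \<cdot> d') \<cdot> i' = (d2 \<cdot> w) \<cdot> i'" using e2(2) g' d2 by simp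
  qed (use u d' w d2 in auto)
  show "mor \<A> E' E'' g h"
    unfolding e e2
    by (rule mor_ConsI[of _ _ _ _ w], rule_tac [4] mor_ConsI[of _ _ _ _ k])
      (use kd w u g' d2 d' P(7) fB in \<open>auto simp: Hom_iff\<close>)
qed

lemma seq_pushout_exists:
  assumes E: "seq t A B E" and f: "f \<in> Hom \<A> B B'"
  shows "\<exists>E'. seq_pushout \<A> f E E'"
proof -
  obtain i d es where e: "E = i # d # es" "d \<cdot> i = zer (src \<A> i) (tgt \<A> d)" using seqD(11)[OF E] by blast
  have d: "d \<in> arr \<A>" "src \<A> d = tgt \<A> i" "i \<in> arr \<A>" "src \<A> i = B" "f \<in> arr \<A>" "src \<A> f = B"
    using seqD(3)[OF E] e f by (auto simp: Hom_iff)
  obtain q r where po: "pushout_square \<A> i f q r" using pushout_exists[of i f] d by auto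
  note P = pushoutD[OF po]
  obtain w where "w \<in> arr \<A>" "src \<A> w = tgt \<A> r" "tgt \<A> w = tgt \<A> d" "w \<cdot> q = d" "w \<cdot> r = zer (tgt \<A> f) (tgt \<A> d)"
    using P(10)[of d "zer (tgt \<A> f) (tgt \<A> d)"] d e(2) by auto
  hence "E = i # d # es \<and> r # w # es = r # w # es \<and> pushout_square \<A> i f q r \<and>
     w \<in> Hom \<A> (tgt \<A> q) (tgt \<A> d) \<and> w \<cdot> q = d \<and> w \<cdot> r = zer (tgt \<A> f) (tgt \<A> d)"
    using e po P(8) by (simp add: Hom_iff)
  thus ?thesis unfolding seq_pushout_def by blast
qed

lemma seq_pullback_opp: "seq_pushout (opp \<A>) h (rev E) (rev E') \<longleftrightarrow> seq_pullback \<A> E h E'"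
proof -
  have r: "rev E = i # d # es \<longleftrightarrow> E = rev es @ [d, i]" for E es and i d :: 'a
    by (metis append.assoc append_Cons append_Nil rev.simps(2) rev_rev_ident)
  show ?thesis
    unfolding seq_pushout_def seq_pullback_def r pushout_opp opp_simps Hom_opp
    by (metis rev_rev_ident)
qed

lemma seq_pullbackD:
  assumes E: "seq t A B E" and h: "h \<in> Hom \<A> A' A" "A' \<in> \<C>" and pb: "seq_pullback \<A> E h E'"
  shows "seq t A' B E'" "mor \<A> E' E (idn \<A> B) h"
    "\<lbrakk>mor \<A> E'' E f (h \<cdot> k); seq t A'' B'' E''; k \<in> Hom \<A> A'' A'\<rbrakk> \<Longrightarrow> mor \<A> E'' E' f k"
proof -
  interpret O: ext_category "opp \<A>" \<C> by (rule opp_ext_category)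
  have a: "ext_seq (opp \<A>) \<C> t B A (rev E)" "h \<in> Hom (opp \<A>) A A'" "seq_pushout (opp \<A>) h (rev E) (rev E')"
    using E h pb by (simp_all add: seq_rev seq_pullback_opp)
  note p = O.seq_pushoutD[OF a(1,2) h(2) a(3)]
  show "seq t A' B E'" "mor \<A> E' E (idn \<A> B) h" using p(1,2) by (simp_all add: seq_rev mor_opp_rev)
  show "mor \<A> E'' E' f k" if "mor \<A> E'' E f (h \<cdot> k)" "seq t A'' B'' E''" "k \<in> Hom \<A> A'' A'"
    using p(3)[of "rev E''" k f B'' A''] that by (simp add: seq_rev mor_opp_rev)
qed

lemma seq_pullback_exists:
  assumes E: "seq t A B E" and h: "h \<in> Hom \<A> A' A"
  shows "\<exists>E'. seq_pullback \<A> E h E'"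
proof -
  interpret O: ext_category "opp \<A>" \<C> by (rule opp_ext_category)
  have a: "ext_seq (opp \<A>) \<C> t B A (rev E)" "h \<in> Hom (opp \<A>) A A'"
    using E h by (simp_all add: seq_rev)
  from O.seq_pushout_exists[OF a] obtain E' where "seq_pushout (opp \<A>) h (rev E) (rev (rev E'))" by auto
  thus ?thesis unfolding seq_pullback_opp by blast
qed

end

section \<open>Extension classes\<close>

context preadditive_category
begin

section \<open>Chosen biproducts and direct sums of sequences\<close>

definition "biprod A B = fst (biprod_of \<A> A B)"
definition "bi1 A B = fst (snd (biprod_of \<A> A B))"
definition "bi2 A B = fst (snd (snd (biprod_of \<A> A B)))"
definition "bp1 A B = fst (snd (snd (snd (biprod_of \<A> A B))))"
definition "bp2 A B = snd (snd (snd (snd (biprod_of \<A> A B))))"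

lemma biprod_of_eq: "biprod_of \<A> A B = (biprod A B, bi1 A B, bi2 A B, bp1 A B, bp2 A B)"
  by (simp add: biprod_def bi1_def bi2_def bp1_def bp2_def)

text \<open>Column vectors, and below row vectors, with respect to the chosen biproducts;
  \<open>diagonal\<close>, \<open>codiagonal\<close> and \<open>dsum_arr\<close> are handled by this
  matrix calculus.\<close>

definition "tup f g = bi1 (tgt \<A> f) (tgt \<A> g) \<cdot> f \<boxplus> bi2 (tgt \<A> f) (tgt \<A> g) \<cdot> g"
definition "cotup f g = f \<cdot> bp1 (src \<A> f) (src \<A> g) \<boxplus> g \<cdot> bp2 (src \<A> f) (src \<A> g)"

lemma dsum_arr_eq: "dsum_arr \<A> f g = bi1 (tgt \<A> f) (tgt \<A> g) \<cdot> (f \<cdot> bp1 (src \<A> f) (src \<A> g))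
    \<boxplus> bi2 (tgt \<A> f) (tgt \<A> g) \<cdot> (g \<cdot> bp2 (src \<A> f) (src \<A> g))"
  by (simp add: dsum_arr_def biprod_of_eq Let_def)

end

context abelian_category
begin

lemma biproduct_biprod:
  assumes "A \<in> obj \<A>" "B \<in> obj \<A>"
  shows "biproduct \<A> A B (biprod A B) (bi1 A B) (bi2 A B) (bp1 A B) (bp2 A B)"
proof -
  have "\<exists>x. case x of (S, i1, i2, p1, p2) \<Rightarrow> biproduct \<A> A B S i1 i2 p1 p2"
    using biproduct_exists[OF assms] by auto
  hence "case biprod_of \<A> A B of (S, i1, i2, p1, p2) \<Rightarrow> biproduct \<A> A B S i1 i2 p1 p2"
    unfolding biprod_of_def by (rule someI_ex)
  thus ?thesis by (simp add: biprod_of_eq)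
qed

lemma biprod_simps [simp]:
  assumes "A \<in> obj \<A>" "B \<in> obj \<A>"
  shows "bi1 A B \<in> arr \<A>" "bi2 A B \<in> arr \<A>" "bp1 A B \<in> arr \<A>" "bp2 A B \<in> arr \<A>"
    "src \<A> (bi1 A B) = A" "src \<A> (bi2 A B) = B" "src \<A> (bp1 A B) = biprod A B" "src \<A> (bp2 A B) = biprod A B"
    "tgt \<A> (bi1 A B) = biprod A B" "tgt \<A> (bi2 A B) = biprod A B" "tgt \<A> (bp1 A B) = A" "tgt \<A> (bp2 A B) = B"
    "bp1 A B \<cdot> bi1 A B = idn \<A> A" "bp2 A B \<cdot> bi2 A B = idn \<A> B" "bp2 A B \<cdot> bi1 A B = zer A B" "bp1 A B \<cdot> bi2 A B = zer B A"
    "bi1 A B \<cdot> bp1 A B \<boxplus> bi2 A B \<cdot> bp2 A B = idn \<A> (biprod A B)" "biprod A B \<in> obj \<A>"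
  using biproductD[OF biproduct_biprod[OF assms]] by auto

lemma biprod_cmp [simp]:
  assumes "A \<in> obj \<A>" "B \<in> obj \<A>"
  shows "\<lbrakk>u \<in> arr \<A>; tgt \<A> u = A\<rbrakk> \<Longrightarrow> bp1 A B \<cdot> (bi1 A B \<cdot> u) = u"
    "\<lbrakk>u \<in> arr \<A>; tgt \<A> u = B\<rbrakk> \<Longrightarrow> bp2 A B \<cdot> (bi2 A B \<cdot> u) = u"
    "\<lbrakk>u \<in> arr \<A>; tgt \<A> u = A\<rbrakk> \<Longrightarrow> bp2 A B \<cdot> (bi1 A B \<cdot> u) = zer (src \<A> u) B"
    "\<lbrakk>u \<in> arr \<A>; tgt \<A> u = B\<rbrakk> \<Longrightarrow> bp1 A B \<cdot> (bi2 A B \<cdot> u) = zer (src \<A> u) A"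
  using biproduct_cmp[OF biproduct_biprod[OF assms]] by auto

lemma biprod_eqI:
  assumes "u \<in> arr \<A>" "v \<in> arr \<A>" "tgt \<A> u = biprod A B" "tgt \<A> v = biprod A B" "src \<A> u = src \<A> v" "A \<in> obj \<A>" "B \<in> obj \<A>"
    "bp1 A B \<cdot> u = bp1 A B \<cdot> v" "bp2 A B \<cdot> u = bp2 A B \<cdot> v"
  shows "u = v"
  using biproduct_cmp(5)[OF biproduct_biprod[OF assms(6,7)]] assms by metis

lemma biprod_eqI2:
  assumes "u \<in> arr \<A>" "v \<in> arr \<A>" "src \<A> u = biprod A B" "src \<A> v = biprod A B" "tgt \<A> u = tgt \<A> v" "A \<in> obj \<A>" "B \<in> obj \<A>"
    "u \<cdot> bi1 A B = v \<cdot> bi1 A B" "u \<cdot> bi2 A B = v \<cdot> bi2 A B"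
  shows "u = v"
proof -
  have "w = (w \<cdot> bi1 A B) \<cdot> bp1 A B \<boxplus> (w \<cdot> bi2 A B) \<cdot> bp2 A B" if "w \<in> arr \<A>" "src \<A> w = biprod A B" for w
    using biproduct_cmp(6)[OF biproduct_biprod[OF assms(6,7)], of w] that assms(6,7) by simp
  from this[of u] this[of v] show ?thesis using assms by simp
qed

lemma tup_simps [simp]:
  assumes "f \<in> arr \<A>" "g \<in> arr \<A>" "src \<A> g = src \<A> f"
  shows "tup f g \<in> arr \<A>" "src \<A> (tup f g) = src \<A> f" "tgt \<A> (tup f g) = biprod (tgt \<A> f) (tgt \<A> g)"
    "tgt \<A> f = A \<Longrightarrow> tgt \<A> g = B \<Longrightarrow> bp1 A B \<cdot> tup f g = f"
    "tgt \<A> f = A \<Longrightarrow> tgt \<A> g = B \<Longrightarrow> bp2 A B \<cdot> tup f g = g"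
    "\<lbrakk>u \<in> arr \<A>; tgt \<A> u = src \<A> f\<rbrakk> \<Longrightarrow> tup f g \<cdot> u = tup (f \<cdot> u) (g \<cdot> u)"
  using assms by (auto simp: tup_def)

lemma cotup_simps [simp]:
  assumes "f \<in> arr \<A>" "g \<in> arr \<A>" "tgt \<A> g = tgt \<A> f"
  shows "cotup f g \<in> arr \<A>" "tgt \<A> (cotup f g) = tgt \<A> f" "src \<A> (cotup f g) = biprod (src \<A> f) (src \<A> g)"
    "src \<A> f = A \<Longrightarrow> src \<A> g = B \<Longrightarrow> cotup f g \<cdot> bi1 A B = f"
    "src \<A> f = A \<Longrightarrow> src \<A> g = B \<Longrightarrow> cotup f g \<cdot> bi2 A B = g"
    "\<lbrakk>u \<in> arr \<A>; src \<A> u = tgt \<A> f\<rbrakk> \<Longrightarrow> u \<cdot> cotup f g = cotup (u \<cdot> f) (u \<cdot> g)"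
    "\<lbrakk>u \<in> arr \<A>; v \<in> arr \<A>; tgt \<A> u = src \<A> f; tgt \<A> v = src \<A> g; src \<A> u = src \<A> v\<rbrakk> \<Longrightarrow> cotup f g \<cdot> tup u v = f \<cdot> u \<boxplus> g \<cdot> v"
  using assms by (auto simp: cotup_def tup_def)

lemma dsum_arr_simps [simp]:
  assumes "f \<in> arr \<A>" "g \<in> arr \<A>"
  shows "dsum_arr \<A> f g \<in> arr \<A>" "src \<A> (dsum_arr \<A> f g) = biprod (src \<A> f) (src \<A> g)"
    "tgt \<A> (dsum_arr \<A> f g) = biprod (tgt \<A> f) (tgt \<A> g)"
    "\<lbrakk>u \<in> arr \<A>; v \<in> arr \<A>; tgt \<A> u = src \<A> f; tgt \<A> v = src \<A> g; src \<A> u = src \<A> v\<rbrakk>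
       \<Longrightarrow> dsum_arr \<A> f g \<cdot> tup u v = tup (f \<cdot> u) (g \<cdot> v)"
    "\<lbrakk>u \<in> arr \<A>; v \<in> arr \<A>; src \<A> u = tgt \<A> f; src \<A> v = tgt \<A> g; tgt \<A> u = tgt \<A> v\<rbrakk>
       \<Longrightarrow> cotup u v \<cdot> dsum_arr \<A> f g = cotup (u \<cdot> f) (v \<cdot> g)"
    "\<lbrakk>tgt \<A> f = A; tgt \<A> g = B\<rbrakk> \<Longrightarrow> bp1 A B \<cdot> dsum_arr \<A> f g = f \<cdot> bp1 (src \<A> f) (src \<A> g)"
    "\<lbrakk>tgt \<A> f = A; tgt \<A> g = B\<rbrakk> \<Longrightarrow> bp2 A B \<cdot> dsum_arr \<A> f g = g \<cdot> bp2 (src \<A> f) (src \<A> g)"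
    "\<lbrakk>src \<A> f = A; src \<A> g = B\<rbrakk> \<Longrightarrow> dsum_arr \<A> f g \<cdot> bi1 A B = bi1 (tgt \<A> f) (tgt \<A> g) \<cdot> f"
    "\<lbrakk>src \<A> f = A; src \<A> g = B\<rbrakk> \<Longrightarrow> dsum_arr \<A> f g \<cdot> bi2 A B = bi2 (tgt \<A> f) (tgt \<A> g) \<cdot> g"
  using assms by (auto simp: dsum_arr_eq tup_def cotup_def)

lemma dsum_arr_cmp:
  assumes "f \<in> arr \<A>" "g \<in> arr \<A>" "f' \<in> arr \<A>" "g' \<in> arr \<A>" "tgt \<A> f' = src \<A> f" "tgt \<A> g' = src \<A> g"
  shows "dsum_arr \<A> f g \<cdot> dsum_arr \<A> f' g' = dsum_arr \<A> (f \<cdot> f') (g \<cdot> g')"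
  using assms by (auto simp: dsum_arr_eq)

lemma tup_proj: "A \<in> obj \<A> \<Longrightarrow> B \<in> obj \<A> \<Longrightarrow> tup (bp1 A B) (bp2 A B) = idn \<A> (biprod A B)"
  by (simp add: tup_def)

lemma diagonal_eq: "A \<in> obj \<A> \<Longrightarrow> diagonal \<A> A = tup (idn \<A> A) (idn \<A> A)"
  by (simp add: diagonal_def biprod_of_eq tup_def)

lemma codiagonal_eq: "A \<in> obj \<A> \<Longrightarrow> codiagonal \<A> A = cotup (idn \<A> A) (idn \<A> A)"
  by (simp add: codiagonal_def biprod_of_eq cotup_def)

lemma dsum_short_exact:
  assumes s: "short_exact \<A> i p" "short_exact \<A> i' p'"
  shows "short_exact \<A> (dsum_arr \<A> i i') (dsum_arr \<A> p p')"
proof -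
  note S = short_exactD[OF s(1)] and S' = short_exactD[OF s(2)]
  let ?i = "dsum_arr \<A> i i'" and ?p = "dsum_arr \<A> p p'"
  show ?thesis
  proof (rule epi_kernel_short_exact[OF epiI is_kernelI[OF monoI]])
    fix u T assume u: "T \<in> obj \<A>" "u \<in> arr \<A>" "tgt \<A> u = T" "src \<A> u = tgt \<A> ?p" "u \<cdot> ?p = zer (src \<A> ?p) T"
    hence us: "src \<A> u = biprod (tgt \<A> p) (tgt \<A> p')" using S(6) S'(6) by simp
    have "(u \<cdot> bi1 (tgt \<A> p) (tgt \<A> p')) \<cdot> p = (u \<cdot> ?p) \<cdot> bi1 (src \<A> p) (src \<A> p')"
      using S(6) S'(6) u(1-3) us by simp
    also have "\<dots> = zer (src \<A> p) T" unfolding u(5) using u(1) S(6) S'(6) by simp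
    finally have 1: "u \<cdot> bi1 (tgt \<A> p) (tgt \<A> p') = zer (tgt \<A> p) T"
      by (rule epi_cancel_zer[OF S(4)]) (use u us S(6) S'(6) in auto)
    have "(u \<cdot> bi2 (tgt \<A> p) (tgt \<A> p')) \<cdot> p' = (u \<cdot> ?p) \<cdot> bi2 (src \<A> p) (src \<A> p')"
      using S(6) S'(6) u(1-3) us by simp
    also have "\<dots> = zer (src \<A> p') T" unfolding u(5) using u(1) S(6) S'(6) by simp
    finally have 2: "u \<cdot> bi2 (tgt \<A> p) (tgt \<A> p') = zer (tgt \<A> p') T"
      by (rule epi_cancel_zer[OF S'(4)]) (use u us S(6) S'(6) in auto)
    show "u = zer (tgt \<A> ?p) T"
      by (rule biprod_eqI2[of _ _ "tgt \<A> p" "tgt \<A> p'"]) (use 1 2 us u S(6) S'(6) in auto)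
  next
    fix u T assume u: "T \<in> obj \<A>" "u \<in> arr \<A>" "src \<A> u = T" "tgt \<A> u = src \<A> ?i" "?i \<cdot> u = zer T (tgt \<A> ?i)"
    hence us: "tgt \<A> u = biprod (src \<A> i) (src \<A> i')" using S(5) S'(5) by simp
    have "i \<cdot> (bp1 (src \<A> i) (src \<A> i') \<cdot> u) = (bp1 (tgt \<A> i) (tgt \<A> i') \<cdot> ?i) \<cdot> u"
      using S(5) S'(5) u(1-3) us by simp
    also have "\<dots> = bp1 (tgt \<A> i) (tgt \<A> i') \<cdot> (?i \<cdot> u)" by (rule assoc) (use S(5) S'(5) u us in auto)
    also have "\<dots> = zer T (tgt \<A> i)" unfolding u(5) using u(1) S(5) S'(5) by simp
    finally have 1: "bp1 (src \<A> i) (src \<A> i') \<cdot> u = zer T (src \<A> i)"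
      by (rule mono_cancel_zer[OF S(3)]) (use u us S(5) S'(5) in auto)
    have "i' \<cdot> (bp2 (src \<A> i) (src \<A> i') \<cdot> u) = (bp2 (tgt \<A> i) (tgt \<A> i') \<cdot> ?i) \<cdot> u"
      using S(5) S'(5) u(1-3) us by simp
    also have "\<dots> = bp2 (tgt \<A> i) (tgt \<A> i') \<cdot> (?i \<cdot> u)" by (rule assoc) (use S(5) S'(5) u us in auto)
    also have "\<dots> = zer T (tgt \<A> i')" unfolding u(5) using u(1) S(5) S'(5) by simp
    finally have 2: "bp2 (src \<A> i) (src \<A> i') \<cdot> u = zer T (src \<A> i')"
      by (rule mono_cancel_zer[OF S'(3)]) (use u us S(5) S'(5) in auto)
    show "u = zer T (src \<A> ?i)"
      by (rule biprod_eqI[of _ _ "src \<A> i" "src \<A> i'"]) (use 1 2 us u S(5) S'(5) in auto)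
  next
    show "?p \<cdot> ?i = zer (src \<A> ?i) (tgt \<A> ?p)"
      by (rule biprod_eqI[of _ _ "tgt \<A> p" "tgt \<A> p'"]) (use S(5-8) S'(5-8) in \<open>auto simp: dsum_arr_cmp\<close>)
  next
    fix u assume u: "u \<in> arr \<A>" "tgt \<A> u = src \<A> ?p" "?p \<cdot> u = zer (src \<A> u) (tgt \<A> ?p)"
    have us: "tgt \<A> u = biprod (src \<A> p) (src \<A> p')" using u S(6) S'(6) by simp
    have "p \<cdot> (bp1 (src \<A> p) (src \<A> p') \<cdot> u) = (bp1 (tgt \<A> p) (tgt \<A> p') \<cdot> ?p) \<cdot> u"
      using S(6) S'(6) u(1) us by simp
    also have "\<dots> = bp1 (tgt \<A> p) (tgt \<A> p') \<cdot> (?p \<cdot> u)" by (rule assoc) (use S(6) S'(6) u us in auto)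
    also have "\<dots> = zer (src \<A> u) (tgt \<A> p)" unfolding u(3) using u(1) S(6) S'(6) by simp
    finally obtain w where w: "w \<in> arr \<A>" "src \<A> w = src \<A> u" "tgt \<A> w = src \<A> i" "i \<cdot> w = bp1 (src \<A> p) (src \<A> p') \<cdot> u"
      using S(9)[of "bp1 (src \<A> p) (src \<A> p') \<cdot> u"] u(1) us S(6) S'(6) by auto
    have "p' \<cdot> (bp2 (src \<A> p) (src \<A> p') \<cdot> u) = (bp2 (tgt \<A> p) (tgt \<A> p') \<cdot> ?p) \<cdot> u"
      using S(6) S'(6) u(1) us by simp
    also have "\<dots> = bp2 (tgt \<A> p) (tgt \<A> p') \<cdot> (?p \<cdot> u)" by (rule assoc) (use S(6) S'(6) u us in auto)
    also have "\<dots> = zer (src \<A> u) (tgt \<A> p')" unfolding u(3) using u(1) S(6) S'(6) by simp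
    finally obtain w' where w': "w' \<in> arr \<A>" "src \<A> w' = src \<A> u" "tgt \<A> w' = src \<A> i'" "i' \<cdot> w' = bp2 (src \<A> p) (src \<A> p') \<cdot> u"
      using S'(9)[of "bp2 (src \<A> p) (src \<A> p') \<cdot> u"] u(1) us S(6) S'(6) by auto
    have "?i \<cdot> tup w w' = u"
      by (rule biprod_eqI[of _ _ "src \<A> p" "src \<A> p'"]) (use w w' u(1) us S(5-7) S'(5-7) in auto)
    thus "\<exists>w\<in>arr \<A>. src \<A> w = src \<A> u \<and> tgt \<A> w = src \<A> ?i \<and> ?i \<cdot> w = u"
      using w w' u(1) us S(5-7) S'(5-7) by (intro bexI[of _ "tup w w'"]) auto
  qed (use S(5-7) S'(5-7) in auto)
qed

lemma mor_tup:
  assumes "mor \<A> W E f h" "mor \<A> W E' f' h'" "set W \<subseteq> arr \<A>" "set E \<subseteq> arr \<A>" "set E' \<subseteq> arr \<A>"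
  shows "mor \<A> W (map2 (dsum_arr \<A>) E E') (tup f f') (tup h h')"
proof -
  have "length W = length E" "length E = length E'" using mor_length[OF assms(1)] mor_length[OF assms(2)] by auto
  thus ?thesis using assms
  proof (induction W E E' arbitrary: f f' rule: list_induct3)
    case (Cons w W e E e' E')
    obtain g where g: "f \<in> Hom \<A> (src \<A> w) (src \<A> e)" "g \<in> Hom \<A> (tgt \<A> w) (tgt \<A> e)" "g \<cdot> w = e \<cdot> f" "mor \<A> W E g h"
      using Cons(4) by auto
    obtain g' where g': "f' \<in> Hom \<A> (src \<A> w) (src \<A> e')" "g' \<in> Hom \<A> (tgt \<A> w) (tgt \<A> e')" "g' \<cdot> w = e' \<cdot> f'" "mor \<A> W E' g' h'"
      using Cons(5) by auto
    have m: "mor \<A> W (map2 (dsum_arr \<A>) E E') (tup g g') (tup h h')" using Cons(3)[OF g(4) g'(4)] Cons(6-) by simp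
    have a: "w \<in> arr \<A>" "e \<in> arr \<A>" "e' \<in> arr \<A>" using Cons(6-) by auto
    show ?case unfolding zip_Cons_Cons list.map prod.case
      by (rule mor_ConsI[OF _ _ _ m]) (use a g(1-3) g'(1-3) in \<open>auto simp: Hom_iff\<close>)
  qed auto
qed

lemma mor_cotup:
  assumes "mor \<A> E W f h" "mor \<A> E' W f' h'" "set W \<subseteq> arr \<A>" "set E \<subseteq> arr \<A>" "set E' \<subseteq> arr \<A>"
  shows "mor \<A> (map2 (dsum_arr \<A>) E E') W (cotup f f') (cotup h h')"
proof -
  have "length W = length E" "length E = length E'" using mor_length[OF assms(1)] mor_length[OF assms(2)] by auto
  thus ?thesis using assms
  proof (induction W E E' arbitrary: f f' rule: list_induct3)
    case (Cons w W e E e' E')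
    obtain g where g: "f \<in> Hom \<A> (src \<A> e) (src \<A> w)" "g \<in> Hom \<A> (tgt \<A> e) (tgt \<A> w)" "g \<cdot> e = w \<cdot> f" "mor \<A> E W g h"
      using Cons(4) by auto
    obtain g' where g': "f' \<in> Hom \<A> (src \<A> e') (src \<A> w)" "g' \<in> Hom \<A> (tgt \<A> e') (tgt \<A> w)" "g' \<cdot> e' = w \<cdot> f'" "mor \<A> E' W g' h'"
      using Cons(5) by auto
    have m: "mor \<A> (map2 (dsum_arr \<A>) E E') W (cotup g g') (cotup h h')" using Cons(3)[OF g(4) g'(4)] Cons(6-) by simp
    have a: "w \<in> arr \<A>" "e \<in> arr \<A>" "e' \<in> arr \<A>" using Cons(6-) by auto
    show ?case unfolding zip_Cons_Cons list.map prod.case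
      by (rule mor_ConsI[OF _ _ _ m]) (use a g(1-3) g'(1-3) in \<open>auto simp: Hom_iff\<close>)
  qed auto
qed

end

context ext_category
begin

lemma biprod_C [simp]: "A \<in> \<C> \<Longrightarrow> B \<in> \<C> \<Longrightarrow> biprod A B \<in> \<C>"
  using biproduct_C[OF biproduct_biprod] by simp

lemma seq_dsum:
  "\<lbrakk>seq t A B E; seq t A' B' E'\<rbrakk> \<Longrightarrow> seq t (biprod A A') (biprod B B') (map2 (dsum_arr \<A>) E E')"
proof (induction t arbitrary: B B' E E')
  case 0
  thus ?case using seqD(2) by blast
next
  case (Suc t)
  have conf: "conf (dsum_arr \<A> i i') (dsum_arr \<A> p p')" if "conf i p" "conf i' p'" for i i' p p'
    using conflationD[OF that(1)] conflationD[OF that(2)] by (intro conflationI dsum_short_exact) auto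
  show ?case
  proof (cases "t = 0")
    case True
    then obtain i p i' p' where "E = [i, p]" "conf i p" "src \<A> i = B" "tgt \<A> p = A"
      "E' = [i', p']" "conf i' p'" "src \<A> i' = B'" "tgt \<A> p' = A'" using Suc(2,3) by (auto simp: seq_single)
    thus ?thesis using conf[of i p i' p'] conflationD[of i p] conflationD[of i' p'] True by (auto simp: seq_single)
  next
    case False
    obtain i p F where E: "conf i p" "src \<A> i = B" "seq t A (tgt \<A> p) F" "E = splice_seq \<A> [i, p] F"
      using seq_split[OF Suc(2)] False by auto
    obtain i' p' F' where E': "conf i' p'" "src \<A> i' = B'" "seq t A' (tgt \<A> p') F'" "E' = splice_seq \<A> [i', p'] F'"
      using seq_split[OF Suc(3)] False by auto
    obtain j fs where F: "F = j # fs" using seqD(11)[OF E(3)] by auto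
    obtain j' fs' where F': "F' = j' # fs'" using seqD(11)[OF E'(3)] by auto
    have j: "j \<in> arr \<A>" "src \<A> j = tgt \<A> p" "j' \<in> arr \<A>" "src \<A> j' = tgt \<A> p'"
      using seqD(3)[OF E(3)] seqD(3)[OF E'(3)] F F' by auto
    note c = conflationD[OF E(1)] conflationD[OF E'(1)]
    have "seq t (biprod A A') (biprod (tgt \<A> p) (tgt \<A> p')) (map2 (dsum_arr \<A>) F F')" by (rule Suc(1)) (use E E' in auto)
    hence "seq (Suc t) (biprod A A') (biprod B B') (splice_seq \<A> [dsum_arr \<A> i i', dsum_arr \<A> p p'] (map2 (dsum_arr \<A>) F F'))"
      using seq_splice1[OF conf[OF E(1) E'(1)], of t "biprod A A'"] c E(2) E'(2) by simp
    thus ?thesis using E(4) E'(4) F F' j c by (simp add: dsum_arr_cmp)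
  qed
qed

section \<open>Equivalence classes, their push-outs and pull-backs\<close>

abbreviation "cls \<equiv> ext_class \<A> \<C>"
abbreviation "ext \<equiv> ext_set \<A> \<C>"
abbreviation "push \<equiv> ext_push \<A> \<C>"
abbreviation "pull \<equiv> ext_pull \<A> \<C>"

lemma ext_step_mor: "ext_step \<A> \<C> E E' \<longleftrightarrow>
   (\<exists>t A B. seq t A B E \<and> seq t A B E' \<and> mor \<A> E E' (idn \<A> B) (idn \<A> A))"
  unfolding ext_step_def seq_morphism_mor[symmetric] by blast

lemma cls_eq: "cls E = cls E' \<longleftrightarrow> equivclp (ext_step \<A> \<C>) E E'"
  unfolding ext_class_def by (auto intro: equivclp_sym equivclp_trans)

lemma cls_self: "E \<in> cls E"
  by (simp add: ext_class_def)

lemma cls_mem: "E' \<in> cls E \<Longrightarrow> cls E' = cls E"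
  unfolding cls_eq by (auto simp: ext_class_def intro: equivclp_sym)

lemma cls_mor: "\<lbrakk>seq t A B E; seq t A B E'; mor \<A> E E' (idn \<A> B) (idn \<A> A)\<rbrakk> \<Longrightarrow> cls E = cls E'"
  unfolding cls_eq by (rule r_into_equivclp) (auto simp: ext_step_mor)

lemma seq_unique: "seq t A B E \<Longrightarrow> seq t' A' B' E \<Longrightarrow> t' = t \<and> A' = A \<and> B' = B"
  using seqD(1)[of t A B E] seqD(1)[of t' A' B' E] by (auto simp: ext_seq_def)

text \<open>Induction along the zigzag joining two equivalent sequences. Steps in both directions
  must be treated, since the generating relation is not symmetric by definition; length and ends
  stay fixed because a sequence determines them.\<close>

lemma cls_induct:
  assumes "cls E = cls E'" "seq t A B E"
    and "P E" "\<And>X Y. \<lbrakk>seq t A B X; seq t A B Y; mor \<A> X Y (idn \<A> B) (idn \<A> A) \<or> mor \<A> Y X (idn \<A> B) (idn \<A> A); P X\<rbrakk> \<Longrightarrow> P Y"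
  shows "P E' \<and> seq t A B E'"
proof -
  have "equivclp (ext_step \<A> \<C>) E E'" using assms(1) by (simp add: cls_eq)
  thus ?thesis
  proof (induction rule: equivclp_induct)
    case base
    thus ?case using assms by simp
  next
    case (step y z)
    have y: "P y" "seq t A B y" using step by auto
    obtain t' A' B' where s: "seq t' A' B' y" "seq t' A' B' z"
      and m: "mor \<A> y z (idn \<A> B') (idn \<A> A') \<or> mor \<A> z y (idn \<A> B') (idn \<A> A')"
      using step(2) unfolding ext_step_mor by blast
    have "t' = t" "A' = A" "B' = B" using seq_unique[OF y(2) s(1)] by auto
    thus ?case using assms(4)[OF y(2), of z] s m y by auto
  qed
qed

lemma extI: "seq t A B E \<Longrightarrow> cls E \<in> ext t A B"
  by (auto simp: ext_set_def)

lemma extE: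
  assumes "\<gamma> \<in> ext t A B"
  obtains E where "seq t A B E" "\<gamma> = cls E"
  using assms by (auto simp: ext_set_def)

lemma ext_obj: "\<gamma> \<in> ext t A B \<Longrightarrow> A \<in> \<C> \<and> B \<in> \<C> \<and> 0 < t"
  using seqD(2,4,5) extE by metis

lemma seq_mor_cmp: "\<lbrakk>mor \<A> E E' f h; mor \<A> E' E'' f' h'; seq t A B E; seq t' A' B' E'; seq t'' A'' B'' E''\<rbrakk>
   \<Longrightarrow> mor \<A> E E'' (f' \<cdot> f) (h' \<cdot> h)"
  by (rule mor_cmp) (use seqD(6) in blast)+

lemma seq_mor_Hom:
  assumes "mor \<A> E E' f h" "seq t A B E" "seq t' A' B' E'"
  shows "f \<in> Hom \<A> B B'" "h \<in> Hom \<A> A A'" "t' = t"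
  using mor_ends[OF assms(1)] seqD[OF assms(2)] seqD[OF assms(3)] mor_length[OF assms(1)] by auto

text \<open>The union in \<open>ext_push\<close> collapses to a single class, which may be computed
  from any \<open>E'\<close> that receives a morphism from \<open>E\<close> over \<open>f\<close>
  and the identity. The zigzag from \<open>E\<close> is followed with the invariant that each
  sequence on it has such a target in the class of \<open>E'\<close>.\<close>

lemma push_cls:
  assumes E: "seq t A B E" and f: "f \<in> Hom \<A> B B'" "B' \<in> \<C>" and E': "seq t A B' E'" "mor \<A> E E' f (idn \<A> A)"
  shows "push f (cls E) = cls E'"
proof -
  have f': "f \<in> arr \<A>" "src \<A> f = B" "tgt \<A> f = B'" using f by (auto simp: Hom_iff)
  have B: "B' \<in> obj \<A>" "A \<in> obj \<A>" "B \<in> obj \<A>" using f(2) seqD(4,5)[OF E] by auto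
  have *: "cls F = cls E'" if F: "X \<in> cls E" "seq_pushout \<A> f X F" for X F
  proof -
    let ?P = "\<lambda>X. \<exists>X'. seq t A B' X' \<and> mor \<A> X X' f (idn \<A> A) \<and> cls X' = cls E'"
    have 1: "cls E = cls X" using F(1) cls_mem by simp
    have "?P X \<and> seq t A B X"
    proof (rule cls_induct[OF 1 E])
      show "?P E" using E' by blast
      fix X Y assume X: "seq t A B X" "seq t A B Y" and "?P X"
        and m: "mor \<A> X Y (idn \<A> B) (idn \<A> A) \<or> mor \<A> Y X (idn \<A> B) (idn \<A> A)"
      then obtain X' where X': "seq t A B' X'" "mor \<A> X X' f (idn \<A> A)" "cls X' = cls E'" by blast
      from m show "?P Y"
      proof
        assume "mor \<A> Y X (idn \<A> B) (idn \<A> A)"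
        from seq_mor_cmp[OF this X'(2) X(2,1) X'(1)] have "mor \<A> Y X' f (idn \<A> A)" using f' B by simp
        thus ?thesis using X' by blast
      next
        \<comment> \<open>This step leads away from \<open>X\<close>, so it cannot be composed with
          the morphism to \<open>X'\<close>. The push-out of \<open>X\<close> maps both to
          \<open>X'\<close> and to the push-out of \<open>Y\<close>, which connects the two.\<close>
        assume mm: "mor \<A> X Y (idn \<A> B) (idn \<A> A)"
        obtain Y' where po: "seq_pushout \<A> f Y Y'" using seq_pushout_exists[OF X(2) f(1)] by blast
        note y = seq_pushoutD[OF X(2) f po]
        obtain X'' where po': "seq_pushout \<A> f X X''" using seq_pushout_exists[OF X(1) f(1)] by blast
        note x = seq_pushoutD[OF X(1) f po']
        have "mor \<A> X'' X' (idn \<A> B') (idn \<A> A)"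
          by (rule x(3)[OF _ X'(1)]) (use X' f' B in \<open>auto simp: Hom_iff\<close>)
        hence c1: "cls X'' = cls X'" using cls_mor x(1) X'(1) by blast
        have "mor \<A> X Y' f (idn \<A> A)" using seq_mor_cmp[OF mm y(2) X(1,2) y(1)] f' B by simp
        hence "mor \<A> X'' Y' (idn \<A> B') (idn \<A> A)"
          by (intro x(3)[OF _ y(1)]) (use f' B in \<open>auto simp: Hom_iff\<close>)
        hence "cls X'' = cls Y'" using cls_mor x(1) y(1) by blast
        thus ?thesis using y(1,2) c1 X' by auto
      qed
    qed
    then obtain X' where X': "seq t A B' X'" "mor \<A> X X' f (idn \<A> A)" "cls X' = cls E'" and X: "seq t A B X" by blast
    note x = seq_pushoutD[OF X f F(2)]
    have "mor \<A> F X' (idn \<A> B') (idn \<A> A)"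
      by (rule x(3)[OF _ X'(1)]) (use X' f' B in \<open>auto simp: Hom_iff\<close>)
    thus ?thesis using cls_mor[OF x(1) X'(1)] X' by simp
  qed
  obtain E'' where "seq_pushout \<A> f E E''" using seq_pushout_exists[OF E f(1)] by blast
  hence "{ext_class \<A> \<C> F | X F. X \<in> cls E \<and> seq_pushout \<A> f X F} = {cls E'}" using * cls_self by blast
  thus ?thesis unfolding ext_push_def by simp
qed

lemma opp_step: "ext_step (opp \<A>) \<C> (rev E) (rev E') \<longleftrightarrow> ext_step \<A> \<C> E' E"
proof -
  interpret O: ext_category "opp \<A>" \<C> by (rule opp_ext_category)
  show ?thesis unfolding ext_step_mor O.ext_step_mor by (auto simp: mor_opp_rev seq_rev)
qed

lemma opp_equivclp: "equivclp (ext_step (opp \<A>) \<C>) (rev E) (rev E') \<longleftrightarrow> equivclp (ext_step \<A> \<C>) E E'"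
proof
  show "equivclp (ext_step (opp \<A>) \<C>) (rev E) (rev E')" if "equivclp (ext_step \<A> \<C>) E E'" using that
  proof (induction rule: equivclp_induct)
    case (step y z)
    have "equivclp (ext_step (opp \<A>) \<C>) (rev y) (rev z)"
      using step(2) opp_step by (metis equivclp_sym r_into_equivclp)
    thus ?case using step(3) by (meson equivclp_trans)
  qed auto
  have "equivclp (ext_step \<A> \<C>) (rev X) (rev Y)" if "equivclp (ext_step (opp \<A>) \<C>) X Y" for X Y using that
  proof (induction rule: equivclp_induct)
    case (step y z)
    have "equivclp (ext_step \<A> \<C>) (rev y) (rev z)"
      using step(2) opp_step[of "rev y" "rev z"] opp_step[of "rev z" "rev y"] by (metis equivclp_sym r_into_equivclp rev_rev_ident)
    thus ?case using step(3) by (meson equivclp_trans)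
  qed auto
  from this[of "rev E" "rev E'"] show "equivclp (ext_step \<A> \<C>) E E'"
    if "equivclp (ext_step (opp \<A>) \<C>) (rev E) (rev E')" using that by simp
qed

lemma opp_cls: "ext_class (opp \<A>) \<C> (rev E) = rev ` cls E"
proof -
  have "x \<in> ext_class (opp \<A>) \<C> (rev E) \<longleftrightarrow> x \<in> rev ` cls E" for x
    using opp_equivclp[of E "rev x"] unfolding ext_class_def by (force simp: image_iff)
  thus ?thesis by blast
qed

lemma opp_cls_eq: "ext_class (opp \<A>) \<C> (rev E) = ext_class (opp \<A>) \<C> (rev E') \<longleftrightarrow> cls E = cls E'"
  by (simp add: opp_cls inj_image_eq_iff)

lemma opp_push: "ext_push (opp \<A>) \<C> h (rev ` \<gamma>) = rev ` pull \<gamma> h"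
proof -
  have "{ext_class (opp \<A>) \<C> E' | E E'. E \<in> rev ` \<gamma> \<and> seq_pushout (opp \<A>) h E E'} =
    {ext_class (opp \<A>) \<C> (rev E') | E E'. E \<in> \<gamma> \<and> seq_pullback \<A> E h E'}" (is "?l = ?r")
  proof
    show "?l \<subseteq> ?r"
    proof
      fix x assume "x \<in> ?l"
      then obtain E E' where "x = ext_class (opp \<A>) \<C> E'" "E \<in> \<gamma>" "seq_pushout (opp \<A>) h (rev E) E'" by auto
      thus "x \<in> ?r" using seq_pullback_opp[of h E "rev E'"] by auto (metis rev_rev_ident)
    qed
    show "?r \<subseteq> ?l" using seq_pullback_opp by blast
  qed
  also have "\<dots> = (\<lambda>X. rev ` X) ` {cls E' | E E'. E \<in> \<gamma> \<and> seq_pullback \<A> E h E'}"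
    unfolding opp_cls by blast
  finally show ?thesis unfolding ext_push_def ext_pull_def by (simp only: image_Union)
qed

lemma pull_cls:
  assumes E: "seq t A B E" and h: "h \<in> Hom \<A> A' A" "A' \<in> \<C>" and E': "seq t A' B E'" "mor \<A> E' E (idn \<A> B) h"
  shows "pull (cls E) h = cls E'"
proof -
  interpret O: ext_category "opp \<A>" \<C> by (rule opp_ext_category)
  have "ext_push (opp \<A>) \<C> h (ext_class (opp \<A>) \<C> (rev E)) = ext_class (opp \<A>) \<C> (rev E')"
    by (rule O.push_cls[of t B A]) (use assms in \<open>auto simp: seq_rev mor_opp_rev\<close>)
  hence "rev ` pull (cls E) h = rev ` cls E'" by (simp add: opp_cls opp_push)
  thus ?thesis by (simp add: inj_image_eq_iff)
qed

lemma push_ex: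
  assumes E: "seq t A B E" and f: "f \<in> Hom \<A> B B'" "B' \<in> \<C>"
  obtains E' where "seq t A B' E'" "mor \<A> E E' f (idn \<A> A)" "push f (cls E) = cls E'"
    "\<And>E'' t'' A'' B'' g h. \<lbrakk>mor \<A> E E'' (g \<cdot> f) h; seq t'' A'' B'' E''; g \<in> Hom \<A> B' B''\<rbrakk> \<Longrightarrow> mor \<A> E' E'' g h"
proof -
  obtain E' where po: "seq_pushout \<A> f E E'" using seq_pushout_exists[OF E f(1)] by blast
  note y = seq_pushoutD[OF E f po]
  have s: "seq t'' A'' B'' E'' \<Longrightarrow> mor \<A> E E'' (g \<cdot> f) h \<Longrightarrow> seq t A'' B'' E''" for t'' A'' B'' E'' g h
    using seqD(1) E mor_length by (metis Suc_inject)
  show thesis by (rule that[OF y(1,2) push_cls[OF E f y(1,2)]]) (use y(3) s in blast)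
qed

lemma pull_ex:
  assumes E: "seq t A B E" and h: "h \<in> Hom \<A> A' A" "A' \<in> \<C>"
  obtains E' where "seq t A' B E'" "mor \<A> E' E (idn \<A> B) h" "pull (cls E) h = cls E'"
    "\<And>E'' t'' A'' B'' f k. \<lbrakk>mor \<A> E'' E f (h \<cdot> k); seq t'' A'' B'' E''; k \<in> Hom \<A> A'' A'\<rbrakk> \<Longrightarrow> mor \<A> E'' E' f k"
proof -
  obtain E' where po: "seq_pullback \<A> E h E'" using seq_pullback_exists[OF E h(1)] by blast
  note y = seq_pullbackD[OF E h po]
  have s: "seq t'' A'' B'' E'' \<Longrightarrow> mor \<A> E'' E f k \<Longrightarrow> seq t A'' B'' E''" for t'' A'' B'' E'' f k
    using seqD(1) E mor_length by (metis Suc_inject)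
  show thesis by (rule that[OF y(1,2) pull_cls[OF E h y(1,2)]]) (use y(3) s in blast)
qed

lemma push_in: "\<gamma> \<in> ext t A B \<Longrightarrow> f \<in> Hom \<A> B B' \<Longrightarrow> B' \<in> \<C> \<Longrightarrow> push f \<gamma> \<in> ext t A B'"
  by (metis extE extI push_ex)

lemma pull_in: "\<gamma> \<in> ext t A B \<Longrightarrow> h \<in> Hom \<A> A' A \<Longrightarrow> A' \<in> \<C> \<Longrightarrow> pull \<gamma> h \<in> ext t A' B"
  by (metis extE extI pull_ex)

text \<open>The morphism factors through the push-out of \<open>E\<close> and then through the
  pull-back of \<open>E'\<close>; what remains is an equivalence. An identity between a push-out and
  a pull-back thus only needs one morphism of sequences.\<close>

lemma push_pull_mor:
  assumes m: "mor \<A> E E' f h" and E: "seq t A B E" "seq t A' B' E'"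
  shows "push f (cls E) = pull (cls E') h"
proof -
  note H = seq_mor_Hom[OF m E] and C = seqD(4,5)[OF E(1)] seqD(4,5)[OF E(2)]
  obtain E1 where E1: "seq t A B' E1" "push f (cls E) = cls E1"
    "\<And>E'' t'' A'' B'' g h. \<lbrakk>mor \<A> E E'' (g \<cdot> f) h; seq t'' A'' B'' E''; g \<in> Hom \<A> B' B''\<rbrakk> \<Longrightarrow> mor \<A> E1 E'' g h"
    using push_ex[OF E(1) H(1) C(4)] by metis
  obtain E2 where E2: "seq t A B' E2" "pull (cls E') h = cls E2"
    "\<And>E'' t'' A'' B'' f k. \<lbrakk>mor \<A> E'' E' f (h \<cdot> k); seq t'' A'' B'' E''; k \<in> Hom \<A> A'' A\<rbrakk> \<Longrightarrow> mor \<A> E'' E2 f k"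
    using pull_ex[OF E(2) H(2) C(1)] by metis
  have "mor \<A> E1 E' (idn \<A> B') h" by (rule E1(3)[OF _ E(2)]) (use H m C in \<open>auto simp: Hom_iff\<close>)
  hence "mor \<A> E1 E2 (idn \<A> B') (idn \<A> A)" by (intro E2(3)[OF _ E1(1)]) (use H C in \<open>auto simp: Hom_iff\<close>)
  thus ?thesis using cls_mor[OF E1(1) E2(1)] E1 E2 by simp
qed

end

section \<open>Yoneda products and Baer sums\<close>

definition yoneda_prod :: "('o, 'a) addcat \<Rightarrow> 'o set \<Rightarrow> 'a list set \<Rightarrow> 'a list set \<Rightarrow> 'a list set" where
  "yoneda_prod \<A> \<C> \<gamma> \<mu> = \<Union>{ext_class \<A> \<C> (splice_seq \<A> E F) | E F. E \<in> \<gamma> \<and> F \<in> \<mu>}"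

lemma carrier_Ext [simp]: "carrier (Ext \<A> \<C> t A B) = ext_set \<A> \<C> t A B"
  and mult_Ext [simp]: "mult (Ext \<A> \<C> t A B) = baer_sum \<A> \<C> A B"
  and one_Ext [simp]: "one (Ext \<A> \<C> t A B) = ext_class \<A> \<C> (zero_seq \<A> t A B)"
  by (simp_all add: Ext_def)

context ext_category
begin

abbreviation "yprod \<equiv> yoneda_prod \<A> \<C>"
abbreviation "bsum \<equiv> baer_sum \<A> \<C>"

section \<open>Identities between push-outs, pull-backs and Yoneda products\<close>

lemma push_id [simp]:
  assumes "\<gamma> \<in> ext t A B" shows "push (idn \<A> B) \<gamma> = \<gamma>"
proof -
  obtain E where E: "seq t A B E" "\<gamma> = cls E" using assms by (rule extE)
  show ?thesis unfolding E by (rule push_cls[OF E(1)]) (use E(1) seq_mor_id seqD(4,5) in \<open>auto simp: Hom_iff\<close>)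
qed

lemma pull_id [simp]:
  assumes "\<gamma> \<in> ext t A B" shows "pull \<gamma> (idn \<A> A) = \<gamma>"
proof -
  obtain E where E: "seq t A B E" "\<gamma> = cls E" using assms by (rule extE)
  show ?thesis unfolding E by (rule pull_cls[OF E(1)]) (use E(1) seq_mor_id seqD(4,5) in \<open>auto simp: Hom_iff\<close>)
qed

lemma push_push:
  assumes "\<gamma> \<in> ext t A B" "f \<in> Hom \<A> B B'" "g \<in> Hom \<A> B' B''" "B' \<in> \<C>" "B'' \<in> \<C>"
  shows "push g (push f \<gamma>) = push (g \<cdot> f) \<gamma>"
proof -
  obtain E where E: "seq t A B E" "\<gamma> = cls E" using assms(1) by (rule extE)
  obtain E' where E': "seq t A B' E'" "mor \<A> E E' f (idn \<A> A)" "push f (cls E) = cls E'"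
    using push_ex[OF E(1) assms(2,4)] by metis
  obtain E'' where E'': "seq t A B'' E''" "mor \<A> E' E'' g (idn \<A> A)" "push g (cls E') = cls E''"
    using push_ex[OF E'(1) assms(3,5)] by metis
  have "mor \<A> E E'' (g \<cdot> f) (idn \<A> A)"
    using seq_mor_cmp[OF E'(2) E''(2) E(1) E'(1) E''(1)] seqD(4)[OF E(1)] by simp
  thus ?thesis unfolding E(2) E'(3) E''(3)
    by (intro push_cls[symmetric, OF E(1) _ assms(5) E''(1)]) (use assms in \<open>auto simp: Hom_iff\<close>)
qed

lemma pull_pull:
  assumes "\<gamma> \<in> ext t A B" "f \<in> Hom \<A> A' A" "g \<in> Hom \<A> A'' A'" "A' \<in> \<C>" "A'' \<in> \<C>"
  shows "pull (pull \<gamma> f) g = pull \<gamma> (f \<cdot> g)"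
proof -
  obtain E where E: "seq t A B E" "\<gamma> = cls E" using assms(1) by (rule extE)
  obtain E' where E': "seq t A' B E'" "mor \<A> E' E (idn \<A> B) f" "pull (cls E) f = cls E'"
    using pull_ex[OF E(1) assms(2,4)] by metis
  obtain E'' where E'': "seq t A'' B E''" "mor \<A> E'' E' (idn \<A> B) g" "pull (cls E') g = cls E''"
    using pull_ex[OF E'(1) assms(3,5)] by metis
  have "mor \<A> E'' E (idn \<A> B) (f \<cdot> g)"
    using seq_mor_cmp[OF E''(2) E'(2) E''(1) E'(1) E(1)] seqD(5)[OF E(1)] by simp
  thus ?thesis unfolding E(2) E'(3) E''(3)
    by (intro pull_cls[symmetric, OF E(1) _ assms(5) E''(1)]) (use assms in \<open>auto simp: Hom_iff\<close>)
qed

lemma push_pull: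
  assumes "\<gamma> \<in> ext t A B" "f \<in> Hom \<A> B B'" "h \<in> Hom \<A> A' A" "B' \<in> \<C>" "A' \<in> \<C>"
  shows "push f (pull \<gamma> h) = pull (push f \<gamma>) h"
proof -
  obtain E where E: "seq t A B E" "\<gamma> = cls E" using assms(1) by (rule extE)
  obtain E' where E': "seq t A' B E'" "mor \<A> E' E (idn \<A> B) h" "pull (cls E) h = cls E'"
    using pull_ex[OF E(1) assms(3,5)] by metis
  obtain E'' where E'': "seq t A B' E''" "mor \<A> E E'' f (idn \<A> A)" "push f (cls E) = cls E''"
    using push_ex[OF E(1) assms(2,4)] by metis
  have "mor \<A> E' E'' (f \<cdot> idn \<A> B) (idn \<A> A \<cdot> h)"
    using seq_mor_cmp[OF E'(2) E''(2) E'(1) E(1) E''(1)] .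
  hence "mor \<A> E' E'' f h" using assms by (simp add: Hom_iff)
  from push_pull_mor[OF this E'(1) E''(1)] show ?thesis unfolding E(2) E'(3) E''(3) .
qed

text \<open>The two factors are varied along their zigzags one after the other, each step being
  spliced with an identity morphism of the other factor.\<close>

lemma prod_cls:
  assumes E: "seq s A B E" and F: "seq t Z A F"
  shows "yprod (cls E) (cls F) = cls (splice_seq \<A> E F)"
proof -
  have Y: "mor \<A> (splice_seq \<A> X U) (splice_seq \<A> Y V) (idn \<A> B) (idn \<A> Z)"
    if "seq s A B X" "seq s A B Y" "seq t Z A U" "seq t Z A V" "mor \<A> X Y (idn \<A> B) (idn \<A> A)" "mor \<A> U V (idn \<A> A) (idn \<A> Z)"
    for X Y U V by (rule mor_splice_seq[OF that(5,6)]) (use seqD(6-9)[OF that(1)] seqD(6-9)[OF that(2)] seqD(6-9)[OF that(3)] seqD(6-9)[OF that(4)] in auto)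
  have *: "cls (splice_seq \<A> E' F') = cls (splice_seq \<A> E F)" if a: "E' \<in> cls E" "F' \<in> cls F" for E' F'
  proof -
    have c: "cls E = cls E'" "cls F = cls F'" using a cls_mem by auto
    have 1: "cls (splice_seq \<A> E' F) = cls (splice_seq \<A> E F) \<and> seq s A B E'"
    proof (rule cls_induct[OF c(1) E])
      fix X Y assume x: "seq s A B X" "seq s A B Y" "mor \<A> X Y (idn \<A> B) (idn \<A> A) \<or> mor \<A> Y X (idn \<A> B) (idn \<A> A)"
         "cls (splice_seq \<A> X F) = cls (splice_seq \<A> E F)"
      have "cls (splice_seq \<A> X F) = cls (splice_seq \<A> Y F)"
        using x(3) Y[OF x(1,2) F F _ seq_mor_id[OF F]] Y[OF x(2,1) F F _ seq_mor_id[OF F]]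
          cls_mor[OF seq_splice[OF x(1) F] seq_splice[OF x(2) F]] cls_mor[OF seq_splice[OF x(2) F] seq_splice[OF x(1) F]] by metis
      thus "cls (splice_seq \<A> Y F) = cls (splice_seq \<A> E F)" using x by simp
    qed simp
    hence E': "seq s A B E'" by simp
    have 2: "cls (splice_seq \<A> E' F') = cls (splice_seq \<A> E' F) \<and> seq t Z A F'"
    proof (rule cls_induct[OF c(2) F])
      fix X Y assume x: "seq t Z A X" "seq t Z A Y" "mor \<A> X Y (idn \<A> A) (idn \<A> Z) \<or> mor \<A> Y X (idn \<A> A) (idn \<A> Z)"
         "cls (splice_seq \<A> E' X) = cls (splice_seq \<A> E' F)"
      have "cls (splice_seq \<A> E' X) = cls (splice_seq \<A> E' Y)"
        using x(3) Y[OF E' E' x(1,2) seq_mor_id[OF E']] Y[OF E' E' x(2,1) seq_mor_id[OF E']]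
          cls_mor[OF seq_splice[OF E' x(1)] seq_splice[OF E' x(2)]] cls_mor[OF seq_splice[OF E' x(2)] seq_splice[OF E' x(1)]] by metis
      thus "cls (splice_seq \<A> E' Y) = cls (splice_seq \<A> E' F)" using x by simp
    qed simp
    show ?thesis using 1 2 by simp
  qed
  hence "{ext_class \<A> \<C> (splice_seq \<A> E' F') | E' F'. E' \<in> cls E \<and> F' \<in> cls F} = {cls (splice_seq \<A> E F)}"
    using cls_self by blast
  thus ?thesis unfolding yoneda_prod_def by simp
qed

lemma prod_in: "\<gamma> \<in> ext s A B \<Longrightarrow> \<mu> \<in> ext t Z A \<Longrightarrow> yprod \<gamma> \<mu> \<in> ext (s + t) Z B"
proof -
  assume a: "\<gamma> \<in> ext s A B" "\<mu> \<in> ext t Z A"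
  obtain E where E: "seq s A B E" "\<gamma> = cls E" using a(1) by (rule extE)
  obtain F where F: "seq t Z A F" "\<mu> = cls F" using a(2) by (rule extE)
  show ?thesis unfolding E(2) F(2) prod_cls[OF E(1) F(1)] by (rule extI[OF seq_splice[OF E(1) F(1)]])
qed

lemma prod_push:
  assumes "\<gamma> \<in> ext s A B" "\<mu> \<in> ext t Z A" "f \<in> Hom \<A> B B'" "B' \<in> \<C>"
  shows "yprod (push f \<gamma>) \<mu> = push f (yprod \<gamma> \<mu>)"
proof -
  obtain E where E: "seq s A B E" "\<gamma> = cls E" using assms(1) by (rule extE)
  obtain F where F: "seq t Z A F" "\<mu> = cls F" using assms(2) by (rule extE)
  obtain E' where E': "seq s A B' E'" "mor \<A> E E' f (idn \<A> A)" "push f (cls E) = cls E'"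
    using push_ex[OF E(1) assms(3,4)] by metis
  have "mor \<A> (splice_seq \<A> E F) (splice_seq \<A> E' F) f (idn \<A> Z)"
    by (rule mor_splice_seq[OF E'(2) seq_mor_id[OF F(1)]])
       (use seqD(6-9)[OF E(1)] seqD(6-9)[OF E'(1)] seqD(6-9)[OF F(1)] in auto)
  from push_cls[OF seq_splice[OF E(1) F(1)] assms(3,4) seq_splice[OF E'(1) F(1)] this]
  show ?thesis unfolding E(2) F(2) E'(3) prod_cls[OF E(1) F(1)] prod_cls[OF E'(1) F(1)] by simp
qed

lemma prod_pull:
  assumes "\<gamma> \<in> ext s A B" "\<mu> \<in> ext t Z A" "h \<in> Hom \<A> Z' Z" "Z' \<in> \<C>"
  shows "yprod \<gamma> (pull \<mu> h) = pull (yprod \<gamma> \<mu>) h"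
proof -
  obtain E where E: "seq s A B E" "\<gamma> = cls E" using assms(1) by (rule extE)
  obtain F where F: "seq t Z A F" "\<mu> = cls F" using assms(2) by (rule extE)
  obtain F' where F': "seq t Z' A F'" "mor \<A> F' F (idn \<A> A) h" "pull (cls F) h = cls F'"
    using pull_ex[OF F(1) assms(3,4)] by metis
  have "mor \<A> (splice_seq \<A> E F') (splice_seq \<A> E F) (idn \<A> B) h"
    by (rule mor_splice_seq[OF seq_mor_id[OF E(1)] F'(2)])
       (use seqD(6-9)[OF E(1)] seqD(6-9)[OF F'(1)] seqD(6-9)[OF F(1)] in auto)
  from pull_cls[OF seq_splice[OF E(1) F(1)] assms(3,4) seq_splice[OF E(1) F'(1)] this]
  show ?thesis unfolding E(2) F(2) F'(3) prod_cls[OF E(1) F(1)] prod_cls[OF E(1) F'(1)] by simp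
qed

text \<open>Splicing the morphism from the pull-back with the morphism to the push-out gives an
  equivalence. This balancing moves \<open>f\<close> from one factor to the other in the later
  computations with products.\<close>

lemma prod_mid:
  assumes "\<gamma> \<in> ext s A B" "\<mu> \<in> ext t Z A'" "f \<in> Hom \<A> A' A"
  shows "yprod (pull \<gamma> f) \<mu> = yprod \<gamma> (push f \<mu>)"
proof -
  obtain E where E: "seq s A B E" "\<gamma> = cls E" using assms(1) by (rule extE)
  obtain F where F: "seq t Z A' F" "\<mu> = cls F" using assms(2) by (rule extE)
  obtain E' where E': "seq s A' B E'" "mor \<A> E' E (idn \<A> B) f" "pull (cls E) f = cls E'"
    using pull_ex[OF E(1) assms(3) seqD(5)[OF F(1)]] by metis
  obtain F' where F': "seq t Z A F'" "mor \<A> F F' f (idn \<A> Z)" "push f (cls F) = cls F'"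
    using push_ex[OF F(1) assms(3) seqD(4)[OF E(1)]] by metis
  have "mor \<A> (splice_seq \<A> E' F) (splice_seq \<A> E F') (idn \<A> B) (idn \<A> Z)"
    by (rule mor_splice_seq[OF E'(2) F'(2)])
       (use seqD(6-9)[OF E(1)] seqD(6-9)[OF F'(1)] seqD(6-9)[OF F(1)] seqD(6-9)[OF E'(1)] in auto)
  from cls_mor[OF seq_splice[OF E'(1) F(1)] seq_splice[OF E(1) F'(1)] this]
  show ?thesis unfolding E(2) F(2) F'(3) E'(3) prod_cls[OF E'(1) F(1)] prod_cls[OF E(1) F'(1)] .
qed

lemma prod_assoc:
  assumes "\<gamma> \<in> ext s A B" "\<mu> \<in> ext t Z A" "\<nu> \<in> ext r Y Z"
  shows "yprod (yprod \<gamma> \<mu>) \<nu> = yprod \<gamma> (yprod \<mu> \<nu>)"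
proof -
  obtain E where E: "seq s A B E" "\<gamma> = cls E" using assms(1) by (rule extE)
  obtain F where F: "seq t Z A F" "\<mu> = cls F" using assms(2) by (rule extE)
  obtain G where G: "seq r Y Z G" "\<nu> = cls G" using assms(3) by (rule extE)
  have l: "length F \<ge> 2" using seqD(1,2)[OF F(1)] by simp
  show ?thesis unfolding E(2) F(2) G(2)
    using E(1) F(1) G(1) by (simp add: prod_cls[of _ _ _ _ _ Z] prod_cls[OF F(1) G(1)] prod_cls[OF seq_splice[OF E(1) F(1)] G(1)]
      prod_cls[OF E(1) F(1)] prod_cls[OF E(1) seq_splice[OF F(1) G(1)]] splice_seq_assoc[OF l])
qed

lemma dsum_mor_id:
  assumes X: "seq t A B X" "seq t A B Y" "mor \<A> X Y (idn \<A> B) (idn \<A> A)"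
    and U: "seq t A' B' U" "seq t A' B' V" "mor \<A> U V (idn \<A> B') (idn \<A> A')"
  shows "cls (map2 (dsum_arr \<A>) X U) = cls (map2 (dsum_arr \<A>) Y V)"
proof -
  note x = seqD(1,3,4,5,6)[OF X(1)] and y = seqD(1,3,4,5,6)[OF X(2)] and u = seqD(1,3,4,5,6)[OF U(1)] and v = seqD(1,3,4,5,6)[OF U(2)]
  let ?D = "map2 (dsum_arr \<A>) X U"
  have D: "set ?D \<subseteq> arr \<A>" using seqD(6)[OF seq_dsum[OF X(1) U(1)]] .
  \<comment> \<open>Sequences of equal length always have a zero morphism between them; combined
    with identities it yields the two projections from the direct sum.\<close>
  have "mor \<A> U X (zer B' B) (zer A' A)" "mor \<A> X U (zer B B') (zer A A')"
    using mor_zero[of U X B' B A' A] mor_zero[of X U B B' A A'] x u by auto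
  from mor_cotup[OF seq_mor_id[OF X(1)] this(1)] mor_cotup[OF this(2) seq_mor_id[OF U(1)]]
  have "mor \<A> ?D X (cotup (idn \<A> B) (zer B' B)) (cotup (idn \<A> A) (zer A' A))"
    "mor \<A> ?D U (cotup (zer B B') (idn \<A> B')) (cotup (zer A A') (idn \<A> A'))" using x u by auto
  hence "mor \<A> ?D X (bp1 B B') (bp1 A A')" "mor \<A> ?D U (bp2 B B') (bp2 A A')"
    using x u by (simp_all add: cotup_def)
  hence "mor \<A> ?D Y (idn \<A> B \<cdot> bp1 B B') (idn \<A> A \<cdot> bp1 A A')" "mor \<A> ?D V (idn \<A> B' \<cdot> bp2 B B') (idn \<A> A' \<cdot> bp2 A A')"
    using mor_cmp[OF _ X(3) D] mor_cmp[OF _ U(3) D] x y u v by blast+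
  hence "mor \<A> ?D Y (bp1 B B') (bp1 A A')" "mor \<A> ?D V (bp2 B B') (bp2 A A')" using x u by simp_all
  from mor_tup[OF this D] have "mor \<A> ?D (map2 (dsum_arr \<A>) Y V) (idn \<A> (biprod B B')) (idn \<A> (biprod A A'))"
    using x u y v by (simp add: tup_proj)
  from cls_mor[OF seq_dsum[OF X(1) U(1)] seq_dsum[OF X(2) U(2)] this] show ?thesis .
qed

lemma dsum_cls:
  assumes E: "seq t A B E" and F: "seq t A' B' F"
  shows "ext_dsum \<A> \<C> (cls E) (cls F) = cls (map2 (dsum_arr \<A>) E F)"
proof -
  have *: "cls (map2 (dsum_arr \<A>) E' F') = cls (map2 (dsum_arr \<A>) E F)" if a: "E' \<in> cls E" "F' \<in> cls F" for E' F'
  proof -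
    have c: "cls E = cls E'" "cls F = cls F'" using a cls_mem by auto
    have 1: "cls (map2 (dsum_arr \<A>) E' F) = cls (map2 (dsum_arr \<A>) E F) \<and> seq t A B E'"
      by (rule cls_induct[OF c(1) E]) (use dsum_mor_id[OF _ _ _ F F seq_mor_id[OF F]] in metis)+
    hence E': "seq t A B E'" by simp
    have 2: "cls (map2 (dsum_arr \<A>) E' F') = cls (map2 (dsum_arr \<A>) E' F) \<and> seq t A' B' F'"
      by (rule cls_induct[OF c(2) F]) (use dsum_mor_id[OF E' E' seq_mor_id[OF E']] in metis)+
    show ?thesis using 1 2 by simp
  qed
  hence "{ext_class \<A> \<C> (map2 (dsum_arr \<A>) E' F') | E' F'. E' \<in> cls E \<and> F' \<in> cls F} = {cls (map2 (dsum_arr \<A>) E F)}"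
    using cls_self by blast
  thus ?thesis unfolding ext_dsum_def by simp
qed

text \<open>The class over a biproduct with components \<gamma> and \<gamma>'. Its existence and
  uniqueness express that Ext is additive in the second variable, before any group structure is
  available.\<close>

definition "pair A \<gamma> \<gamma>' = pull (ext_dsum \<A> \<C> \<gamma> \<gamma>') (diagonal \<A> A)"

lemma dsum_proj:
  assumes "\<gamma> \<in> ext t A B" "\<gamma>' \<in> ext t A' B'"
  shows "ext_dsum \<A> \<C> \<gamma> \<gamma>' \<in> ext t (biprod A A') (biprod B B')"
    "push (bp1 B B') (ext_dsum \<A> \<C> \<gamma> \<gamma>') = pull \<gamma> (bp1 A A')"
    "push (bp2 B B') (ext_dsum \<A> \<C> \<gamma> \<gamma>') = pull \<gamma>' (bp2 A A')"
proof -
  obtain E where E: "seq t A B E" "\<gamma> = cls E" using assms(1) by (rule extE)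
  obtain F where F: "seq t A' B' F" "\<gamma>' = cls F" using assms(2) by (rule extE)
  note x = seqD(1,3,4,5,6)[OF E(1)] and u = seqD(1,3,4,5,6)[OF F(1)]
  let ?D = "map2 (dsum_arr \<A>) E F"
  note D = seq_dsum[OF E(1) F(1)]
  have "mor \<A> F E (zer B' B) (zer A' A)" "mor \<A> E F (zer B B') (zer A A')"
    using mor_zero[of F E B' B A' A] mor_zero[of E F B B' A A'] x u by auto
  from mor_cotup[OF seq_mor_id[OF E(1)] this(1)] mor_cotup[OF this(2) seq_mor_id[OF F(1)]]
  have "mor \<A> ?D E (cotup (idn \<A> B) (zer B' B)) (cotup (idn \<A> A) (zer A' A))"
    "mor \<A> ?D F (cotup (zer B B') (idn \<A> B')) (cotup (zer A A') (idn \<A> A'))" using x u by auto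
  hence "mor \<A> ?D E (bp1 B B') (bp1 A A')" "mor \<A> ?D F (bp2 B B') (bp2 A A')"
    using x u by (simp_all add: cotup_def)
  thus "push (bp1 B B') (ext_dsum \<A> \<C> \<gamma> \<gamma>') = pull \<gamma> (bp1 A A')"
    "push (bp2 B B') (ext_dsum \<A> \<C> \<gamma> \<gamma>') = pull \<gamma>' (bp2 A A')"
    unfolding E(2) F(2) dsum_cls[OF E(1) F(1)] using push_pull_mor D E F by blast+
  show "ext_dsum \<A> \<C> \<gamma> \<gamma>' \<in> ext t (biprod A A') (biprod B B')"
    unfolding E(2) F(2) dsum_cls[OF E(1) F(1)] using D by (rule extI)
qed

lemma pair_proj:
  assumes "\<gamma> \<in> ext t A B" "\<gamma>' \<in> ext t A B'"
  shows "pair A \<gamma> \<gamma>' \<in> ext t A (biprod B B')" "push (bp1 B B') (pair A \<gamma> \<gamma>') = \<gamma>" "push (bp2 B B') (pair A \<gamma> \<gamma>') = \<gamma>'"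
proof -
  note o = ext_obj[OF assms(1)] ext_obj[OF assms(2)] and d = dsum_proj[OF assms]
  have D: "diagonal \<A> A \<in> Hom \<A> A (biprod A A)" using o by (simp add: diagonal_eq Hom_iff)
  show "pair A \<gamma> \<gamma>' \<in> ext t A (biprod B B')" unfolding pair_def by (rule pull_in[OF d(1) D]) (use o in auto)
  have h: "bp1 B B' \<in> Hom \<A> (biprod B B') B" "bp2 B B' \<in> Hom \<A> (biprod B B') B'"
    "bp1 A A \<in> Hom \<A> (biprod A A) A" "bp2 A A \<in> Hom \<A> (biprod A A) A" using o by (auto simp: Hom_iff)
  have i: "bp1 A A \<cdot> diagonal \<A> A = idn \<A> A" "bp2 A A \<cdot> diagonal \<A> A = idn \<A> A" using o by (auto simp: diagonal_eq)
  have "push (bp1 B B') (pair A \<gamma> \<gamma>') = pull (pull \<gamma> (bp1 A A)) (diagonal \<A> A)"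
    unfolding pair_def d(2)[symmetric] by (rule push_pull[OF d(1) h(1) D]) (use o in auto)
  also have "\<dots> = \<gamma>" using pull_pull[OF assms(1) h(3) D] o i assms by simp
  finally show "push (bp1 B B') (pair A \<gamma> \<gamma>') = \<gamma>" .
  have "push (bp2 B B') (pair A \<gamma> \<gamma>') = pull (pull \<gamma>' (bp2 A A)) (diagonal \<A> A)"
    unfolding pair_def d(3)[symmetric] by (rule push_pull[OF d(1) h(2) D]) (use o in auto)
  also have "\<dots> = \<gamma>'" using pull_pull[OF assms(2) h(4) D] o i assms by simp
  finally show "push (bp2 B B') (pair A \<gamma> \<gamma>') = \<gamma>'" .
qed

text \<open>\<open>W\<close> maps to its push-outs along the two projections, hence to their direct
  sum, with the diagonal at the right end. So \<open>W\<close> represents the pull-back that defines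
  \<open>pair\<close>.\<close>

lemma pair_unique:
  assumes w: "\<omega> \<in> ext t A (biprod B B')" and BB: "B \<in> \<C>" "B' \<in> \<C>"
  shows "pair A (push (bp1 B B') \<omega>) (push (bp2 B B') \<omega>) = \<omega>"
proof -
  obtain W where W: "seq t A (biprod B B') W" "\<omega> = cls W" using w by (rule extE)
  have h: "bp1 B B' \<in> Hom \<A> (biprod B B') B" "bp2 B B' \<in> Hom \<A> (biprod B B') B'" using BB by (auto simp: Hom_iff)
  obtain E where E: "seq t A B E" "mor \<A> W E (bp1 B B') (idn \<A> A)" "push (bp1 B B') (cls W) = cls E"
    using push_ex[OF W(1) h(1) BB(1)] by metis
  obtain E' where E': "seq t A B' E'" "mor \<A> W E' (bp2 B B') (idn \<A> A)" "push (bp2 B B') (cls W) = cls E'"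
    using push_ex[OF W(1) h(2) BB(2)] by metis
  have A: "A \<in> \<C>" using seqD(4)[OF E(1)] .
  from mor_tup[OF E(2) E'(2)] have "mor \<A> W (map2 (dsum_arr \<A>) E E') (tup (bp1 B B') (bp2 B B')) (tup (idn \<A> A) (idn \<A> A))"
    using seqD(6)[OF W(1)] seqD(6)[OF E(1)] seqD(6)[OF E'(1)] by blast
  hence m: "mor \<A> W (map2 (dsum_arr \<A>) E E') (idn \<A> (biprod B B')) (diagonal \<A> A)" using BB A by (simp add: tup_proj diagonal_eq)
  show ?thesis unfolding W(2) E(3) E'(3) pair_def dsum_cls[OF E(1) E'(1)]
    by (rule pull_cls[OF seq_dsum[OF E(1) E'(1)] _ A W(1) m]) (use A in \<open>simp add: diagonal_eq Hom_iff\<close>)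
qed

lemma ext_biprod_eqI:
  assumes "\<omega> \<in> ext t A (biprod B B')" "\<omega>' \<in> ext t A (biprod B B')" "B \<in> \<C>" "B' \<in> \<C>"
   "push (bp1 B B') \<omega> = push (bp1 B B') \<omega>'" "push (bp2 B B') \<omega> = push (bp2 B B') \<omega>'"
  shows "\<omega> = \<omega>'"
  by (rule trans[OF pair_unique[OF assms(1,3,4), symmetric]]) (simp only: assms(5,6) pair_unique[OF assms(2-4)])

lemma bsum_pair: "bsum A B \<gamma> \<gamma>' = push (codiagonal \<A> B) (pair A \<gamma> \<gamma>')"
  by (simp add: baer_sum_def pair_def)

text \<open>This identity, together with the existence of \<open>pair\<close>, transports the group axioms and the
  additivity of all operations from the hom-groups to the extension groups.\<close>

lemma push_add:
  assumes w: "\<omega> \<in> ext t A B" and f: "f \<in> Hom \<A> B D" "g \<in> Hom \<A> B D" and D: "D \<in> \<C>"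
  shows "push (f \<boxplus> g) \<omega> = bsum A D (push f \<omega>) (push g \<omega>)"
proof -
  note o = ext_obj[OF w]
  have fg: "f \<in> arr \<A>" "src \<A> f = B" "tgt \<A> f = D" "g \<in> arr \<A>" "src \<A> g = B" "tgt \<A> g = D" using f by (auto simp: Hom_iff)
  have t: "tup f g \<in> Hom \<A> B (biprod D D)" using fg by (simp add: Hom_iff)
  have h: "bp1 D D \<in> Hom \<A> (biprod D D) D" "bp2 D D \<in> Hom \<A> (biprod D D) D" using D by (auto simp: Hom_iff)
  have in1: "push f \<omega> \<in> ext t A D" "push g \<omega> \<in> ext t A D" using push_in[OF w] f D by auto
  note p = pair_proj[OF in1]
  have "pair A (push f \<omega>) (push g \<omega>) = push (tup f g) \<omega>"
    by (rule ext_biprod_eqI[OF p(1) push_in[OF w t] D D])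
      (use D fg p push_push[OF w t h(1)] push_push[OF w t h(2)] in simp_all)
  moreover have "codiagonal \<A> D \<cdot> tup f g = f \<boxplus> g" using D fg by (simp add: codiagonal_eq)
  moreover have "codiagonal \<A> D \<in> Hom \<A> (biprod D D) D" using D by (simp add: codiagonal_eq Hom_iff)
  ultimately show ?thesis unfolding bsum_pair using push_push[OF w t, of "codiagonal \<A> D" D] D by simp
qed

lemma bsum_eq_push:
  assumes "\<gamma> \<in> ext t A B" "\<gamma>' \<in> ext t A B"
  shows "bsum A B \<gamma> \<gamma>' = push (bp1 B B \<boxplus> bp2 B B) (pair A \<gamma> \<gamma>')"
proof -
  note p = pair_proj[OF assms] and o = ext_obj[OF assms(1)]
  show ?thesis using push_add[OF p(1), of "bp1 B B" B "bp2 B B"] p o by (simp add: Hom_iff)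
qed

lemma bsum_in: "\<gamma> \<in> ext t A B \<Longrightarrow> \<gamma>' \<in> ext t A B \<Longrightarrow> bsum A B \<gamma> \<gamma>' \<in> ext t A B"
  using pair_proj(1)[of \<gamma> t A B \<gamma>' B] ext_obj[of \<gamma> t A B]
  by (simp add: bsum_eq_push push_in Hom_iff)

lemma push_bsum:
  assumes "\<gamma> \<in> ext t A B" "\<gamma>' \<in> ext t A B" and f: "f \<in> Hom \<A> B D" "D \<in> \<C>"
  shows "push f (bsum A B \<gamma> \<gamma>') = bsum A D (push f \<gamma>) (push f \<gamma>')"
proof -
  note p = pair_proj[OF assms(1,2)] and o = ext_obj[OF assms(1)]
  have fg: "f \<in> arr \<A>" "src \<A> f = B" "tgt \<A> f = D" using f by (auto simp: Hom_iff)
  have h: "bp1 B B \<in> Hom \<A> (biprod B B) B" "bp2 B B \<in> Hom \<A> (biprod B B) B" "bp1 B B \<boxplus> bp2 B B \<in> Hom \<A> (biprod B B) B" using o by (auto simp: Hom_iff)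
  have "push f (bsum A B \<gamma> \<gamma>') = push (f \<cdot> (bp1 B B \<boxplus> bp2 B B)) (pair A \<gamma> \<gamma>')"
    unfolding bsum_eq_push[OF assms(1,2)] by (rule push_push[OF p(1) h(3) f(1)]) (use o f in auto)
  also have "\<dots> = push (f \<cdot> bp1 B B \<boxplus> f \<cdot> bp2 B B) (pair A \<gamma> \<gamma>')" using fg o by simp
  also have "\<dots> = bsum A D (push (f \<cdot> bp1 B B) (pair A \<gamma> \<gamma>')) (push (f \<cdot> bp2 B B) (pair A \<gamma> \<gamma>'))"
    by (rule push_add[OF p(1)]) (use fg o f in \<open>auto simp: Hom_iff\<close>)
  finally show ?thesis using push_push[OF p(1) h(1) f(1)] push_push[OF p(1) h(2) f(1)] o f p by simp
qed

lemma pull_bsum: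
  assumes "\<gamma> \<in> ext t A B" "\<gamma>' \<in> ext t A B" and f: "f \<in> Hom \<A> A' A" "A' \<in> \<C>"
  shows "pull (bsum A B \<gamma> \<gamma>') f = bsum A' B (pull \<gamma> f) (pull \<gamma>' f)"
proof -
  note p = pair_proj[OF assms(1,2)] and o = ext_obj[OF assms(1)]
  have h: "bp1 B B \<in> Hom \<A> (biprod B B) B" "bp2 B B \<in> Hom \<A> (biprod B B) B" "bp1 B B \<boxplus> bp2 B B \<in> Hom \<A> (biprod B B) B" using o by (auto simp: Hom_iff)
  have "pull (bsum A B \<gamma> \<gamma>') f = push (bp1 B B \<boxplus> bp2 B B) (pull (pair A \<gamma> \<gamma>') f)"
    unfolding bsum_eq_push[OF assms(1,2)] by (rule push_pull[symmetric, OF p(1) h(3) f(1)]) (use o f in auto)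
  also have "\<dots> = bsum A' B (push (bp1 B B) (pull (pair A \<gamma> \<gamma>') f)) (push (bp2 B B) (pull (pair A \<gamma> \<gamma>') f))"
    by (rule push_add[OF pull_in[OF p(1) f] h(1,2)]) (use o in auto)
  finally show ?thesis using push_pull[OF p(1) h(1) f(1)] push_pull[OF p(1) h(2) f(1)] o f p by simp
qed

lemma prod_bsum_left:
  assumes "\<gamma> \<in> ext s A B" "\<gamma>' \<in> ext s A B" and m: "\<mu> \<in> ext t Z A"
  shows "yprod (bsum A B \<gamma> \<gamma>') \<mu> = bsum Z B (yprod \<gamma> \<mu>) (yprod \<gamma>' \<mu>)"
proof -
  note p = pair_proj[OF assms(1,2)] and o = ext_obj[OF assms(1)]
  have h: "bp1 B B \<in> Hom \<A> (biprod B B) B" "bp2 B B \<in> Hom \<A> (biprod B B) B" "bp1 B B \<boxplus> bp2 B B \<in> Hom \<A> (biprod B B) B" using o by (auto simp: Hom_iff)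
  have "yprod (bsum A B \<gamma> \<gamma>') \<mu> = push (bp1 B B \<boxplus> bp2 B B) (yprod (pair A \<gamma> \<gamma>') \<mu>)"
    unfolding bsum_eq_push[OF assms(1,2)] by (rule prod_push[OF p(1) m h(3)]) (use o in auto)
  also have "\<dots> = bsum Z B (push (bp1 B B) (yprod (pair A \<gamma> \<gamma>') \<mu>)) (push (bp2 B B) (yprod (pair A \<gamma> \<gamma>') \<mu>))"
    by (rule push_add[OF prod_in[OF p(1) m] h(1,2)]) (use o in auto)
  finally show ?thesis using prod_push[OF p(1) m h(1)] prod_push[OF p(1) m h(2)] o p by simp
qed

text \<open>Duality does not give this from \<open>push_add\<close>: the Baer sum is defined
  asymmetrically, with biproducts chosen in \<A>. Instead, the codiagonal of \<open>E\<close> is a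
  morphism of sequences, which moves the codiagonal from the left end to the right end.\<close>

lemma pull_add:
  assumes g: "\<gamma> \<in> ext t A B" and f: "f \<in> Hom \<A> X A" "g \<in> Hom \<A> X A" and X: "X \<in> \<C>"
  shows "pull \<gamma> (f \<boxplus> g) = bsum X B (pull \<gamma> f) (pull \<gamma> g)"
proof -
  note o = ext_obj[OF g] and d = dsum_proj[OF g g]
  have fg: "f \<in> arr \<A>" "src \<A> f = X" "tgt \<A> f = A" "g \<in> arr \<A>" "src \<A> g = X" "tgt \<A> g = A" using f by (auto simp: Hom_iff)
  obtain E where E: "seq t A B E" "\<gamma> = cls E" using g by (rule extE)
  have "mor \<A> (map2 (dsum_arr \<A>) E E) E (codiagonal \<A> B) (codiagonal \<A> A)"
    using mor_cotup[OF seq_mor_id[OF E(1)] seq_mor_id[OF E(1)]] seqD(6)[OF E(1)] o by (simp add: codiagonal_eq)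
  from push_pull_mor[OF this seq_dsum[OF E(1) E(1)] E(1)]
  have cod: "push (codiagonal \<A> B) (ext_dsum \<A> \<C> \<gamma> \<gamma>) = pull \<gamma> (codiagonal \<A> A)"
    by (simp add: E(2) dsum_cls[OF E(1) E(1)])
  have t: "tup f g \<in> Hom \<A> X (biprod A A)" using fg by (simp add: Hom_iff)
  have h: "bp1 B B \<in> Hom \<A> (biprod B B) B" "bp2 B B \<in> Hom \<A> (biprod B B) B" "codiagonal \<A> B \<in> Hom \<A> (biprod B B) B"
    "bp1 A A \<in> Hom \<A> (biprod A A) A" "bp2 A A \<in> Hom \<A> (biprod A A) A" "codiagonal \<A> A \<in> Hom \<A> (biprod A A) A" using o by (auto simp: Hom_iff codiagonal_eq)
  have in1: "pull \<gamma> f \<in> ext t X B" "pull \<gamma> g \<in> ext t X B" using pull_in[OF g] f X by auto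
  note p = pair_proj[OF in1]
  have "pair X (pull \<gamma> f) (pull \<gamma> g) = pull (ext_dsum \<A> \<C> \<gamma> \<gamma>) (tup f g)"
  proof (rule ext_biprod_eqI[OF p(1) pull_in[OF d(1) t X]])
    have "push (bp1 B B) (pull (ext_dsum \<A> \<C> \<gamma> \<gamma>) (tup f g)) = pull (pull \<gamma> (bp1 A A)) (tup f g)"
      using push_pull[OF d(1) h(1) t] o X d by simp
    also have "\<dots> = pull \<gamma> f" using pull_pull[OF g h(4) t] o X fg by simp
    finally show "push (bp1 B B) (pair X (pull \<gamma> f) (pull \<gamma> g)) = push (bp1 B B) (pull (ext_dsum \<A> \<C> \<gamma> \<gamma>) (tup f g))" using p by simp
    have "push (bp2 B B) (pull (ext_dsum \<A> \<C> \<gamma> \<gamma>) (tup f g)) = pull (pull \<gamma> (bp2 A A)) (tup f g)"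
      using push_pull[OF d(1) h(2) t] o X d by simp
    also have "\<dots> = pull \<gamma> g" using pull_pull[OF g h(5) t] o X fg by simp
    finally show "push (bp2 B B) (pair X (pull \<gamma> f) (pull \<gamma> g)) = push (bp2 B B) (pull (ext_dsum \<A> \<C> \<gamma> \<gamma>) (tup f g))" using p by simp
  qed (use o in auto)
  hence "bsum X B (pull \<gamma> f) (pull \<gamma> g) = pull (pull \<gamma> (codiagonal \<A> A)) (tup f g)"
    unfolding bsum_pair using push_pull[OF d(1) h(3) t] o X cod by simp
  also have "\<dots> = pull \<gamma> (codiagonal \<A> A \<cdot> tup f g)" by (rule pull_pull[OF g h(6) t]) (use o X in auto)
  also have "codiagonal \<A> A \<cdot> tup f g = f \<boxplus> g" using o fg by (simp add: codiagonal_eq)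
  finally show ?thesis by simp
qed

text \<open>The sum is a push-out along the sum of the two projections. Balancing moves this arrow
  over to \<gamma>, where \<open>pull_add\<close> splits it.\<close>

lemma prod_bsum_right:
  assumes g: "\<gamma> \<in> ext s A B" and m: "\<mu> \<in> ext t Z A" "\<mu>' \<in> ext t Z A"
  shows "yprod \<gamma> (bsum Z A \<mu> \<mu>') = bsum Z B (yprod \<gamma> \<mu>) (yprod \<gamma> \<mu>')"
proof -
  note p = pair_proj[OF m] and o = ext_obj[OF g]
  have h: "bp1 A A \<in> Hom \<A> (biprod A A) A" "bp2 A A \<in> Hom \<A> (biprod A A) A" "bp1 A A \<boxplus> bp2 A A \<in> Hom \<A> (biprod A A) A" using o by (auto simp: Hom_iff)
  have in1: "pull \<gamma> (bp1 A A) \<in> ext s (biprod A A) B" "pull \<gamma> (bp2 A A) \<in> ext s (biprod A A) B" using pull_in[OF g] h o by auto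
  have "yprod \<gamma> (bsum Z A \<mu> \<mu>') = yprod (pull \<gamma> (bp1 A A \<boxplus> bp2 A A)) (pair Z \<mu> \<mu>')"
    unfolding bsum_eq_push[OF m] by (rule prod_mid[symmetric, OF g p(1) h(3)])
  also have "pull \<gamma> (bp1 A A \<boxplus> bp2 A A) = bsum (biprod A A) B (pull \<gamma> (bp1 A A)) (pull \<gamma> (bp2 A A))"
    by (rule pull_add[OF g h(1,2)]) (use o in auto)
  also have "yprod \<dots> (pair Z \<mu> \<mu>') = bsum Z B (yprod \<gamma> \<mu>) (yprod \<gamma> \<mu>')"
    unfolding prod_bsum_left[OF in1 p(1)] prod_mid[OF g p(1) h(1)] prod_mid[OF g p(1) h(2)] p ..
  finally show ?thesis .
qed

section \<open>The zero class and the group axioms\<close>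

lemma zero_conf:
  assumes "zero_object \<A> Z" "B \<in> \<C>"
  shows "conf (idn \<A> B) (zer B Z)"
proof -
  note z = zero_objectD[OF assms(1)] and C = zero_object_C[OF assms(1)]
  have "short_exact \<A> (idn \<A> B) (zer B Z)"
  proof (rule mono_cokernel_short_exact[OF monoI is_cokernelI[OF epiI]])
    fix u T assume u: "u \<in> arr \<A>" "tgt \<A> u = T" "src \<A> u = tgt \<A> (zer B Z)"
    thus "u = zer (tgt \<A> (zer B Z)) T" using z(3)[of u T] assms z(1) by simp
  next
    fix u assume u: "u \<in> arr \<A>" "src \<A> u = tgt \<A> (idn \<A> B)" "u \<cdot> idn \<A> B = zer (src \<A> (idn \<A> B)) (tgt \<A> u)"
    have "zer Z (tgt \<A> u) \<cdot> zer B Z = u" using u assms z(1) by simp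
    thus "\<exists>w\<in>arr \<A>. src \<A> w = tgt \<A> (zer B Z) \<and> tgt \<A> w = tgt \<A> u \<and> w \<cdot> zer B Z = u"
      using u(1) z(1) assms by (intro bexI[of _ "zer Z (tgt \<A> u)"]) auto
  qed (use z(1) assms in auto)
  thus ?thesis by (rule conflationI) (use z(1) assms C in auto)
qed

lemma zero_conf':
  assumes "zero_object \<A> Z" "A \<in> \<C>"
  shows "conf (zer Z A) (idn \<A> A)"
proof -
  interpret O: ext_category "opp \<A>" \<C> by (rule opp_ext_category)
  show ?thesis using O.zero_conf[of Z A] assms by simp
qed

text \<open>Captures the trivial sequence without reference to its shape: a morphism that is zero on
  the left and the identity on the right exhibits it as the push-out along zero of every sequence of
  that length ending in A.\<close>

definition "terminal_seq t A B E \<longleftrightarrow> seq t A B E \<and> (\<forall>F B'. seq t A B' F \<longrightarrow> mor \<A> F E (zer B' B) (idn \<A> A))"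

lemma terminal_seq_Suc:
  assumes F: "terminal_seq t A Z F" and Z: "zero_object \<A> Z" and B: "B \<in> \<C>"
  shows "terminal_seq (Suc t) A B (splice_seq \<A> [idn \<A> B, zer B Z] F)"
  unfolding terminal_seq_def
proof (intro conjI allI impI)
  note c = zero_conf[OF Z B] and z = zero_objectD[OF Z]
  have F': "seq t A Z F" "\<And>E B'. seq t A B' E \<Longrightarrow> mor \<A> E F (zer B' Z) (idn \<A> A)" using F by (auto simp: terminal_seq_def)
  show "seq (Suc t) A B (splice_seq \<A> [idn \<A> B, zer B Z] F)" using seq_splice1[OF c] F' B z(1) by simp
  fix E B' assume E: "seq (Suc t) A B' E"
  obtain i p G where G: "conf i p" "src \<A> i = B'" "seq t A (tgt \<A> p) G" "E = splice_seq \<A> [i, p] G"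
    using seq_split[OF E seqD(2)[OF F'(1)]] by auto
  note cp = conflationD[OF G(1)]
  have "mor \<A> [i, p] [idn \<A> B, zer B Z] (zer B' B) (zer (tgt \<A> p) Z)"
    by (rule mor_ConsI[of _ _ _ _ "zer (tgt \<A> i) B"], rule_tac [4] mor_ConsI[of _ _ _ _ "zer (tgt \<A> p) Z"])
       (use cp B G z(1) in \<open>auto simp: Hom_iff\<close>)
  thus "mor \<A> E (splice_seq \<A> [idn \<A> B, zer B Z] F) (zer B' B) (idn \<A> A)"
    unfolding G(4) by (rule mor_splice_seq[OF _ F'(2)[OF G(3)]])
      (use cp B z(1) seqD(6-9)[OF G(3)] seqD(6-9)[OF F'(1)] in auto)
qed

lemma terminal_zero_seq:
  assumes A: "A \<in> \<C>" and t: "0 < t"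
  shows "B \<in> \<C> \<Longrightarrow> terminal_seq t A B (zero_seq \<A> t A B)"
  using t
proof (induction t arbitrary: B)
  case (Suc t)
  define Z where "Z = (SOME Z. zero_object \<A> Z)"
  have Z: "zero_object \<A> Z" unfolding Z_def using zero_object_exists by (rule someI_ex)
  note z = zero_objectD[OF Z] and ZC = zero_object_C[OF Z] and B = Suc(2)
  \<comment> \<open>The trivial sequence of length 1 is a split one, so that of length 2 is not
    literally obtained from it by prepending a conflation; its tail is 0 \<rightarrow> A = A
    instead. From length 3 on the recursion is uniform.\<close>
  consider "t = 0" | "t = 1" | "t \<ge> 2" by linarith
  thus ?case
  proof cases
    case 1
    have e: "zero_seq \<A> 1 A B = [bi1 B A, bp2 B A]" by (simp add: zero_seq_def biprod_of_eq)
    have c: "conf (bi1 B A) (bp2 B A)"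
      by (rule conflationI[OF biproduct_short_exact[OF biproduct_biprod]]) (use A B in auto)
    have "mor \<A> [i, p] [bi1 B A, bp2 B A] (zer (src \<A> i) B) (idn \<A> A)" if "conf i p" "tgt \<A> p = A" for i p
      by (rule mor_ConsI[of _ _ _ _ "bi2 B A \<cdot> p"], rule_tac [4] mor_ConsI[of _ _ _ _ "idn \<A> A"])
         (use conflationD[OF that(1)] A B that in \<open>auto simp: Hom_iff\<close>)
    thus ?thesis unfolding 1 One_nat_def[symmetric] e terminal_seq_def
      using c A B by (auto simp: seq_single)
  next
    case 2
    have "terminal_seq 1 A Z [zer Z A, idn \<A> A]"
      unfolding terminal_seq_def
    proof (intro conjI allI impI)
      show "seq 1 A Z [zer Z A, idn \<A> A]" using zero_conf'[OF Z A] A z(1) by (simp add: seq_single)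
      fix F B' assume "seq 1 A B' F"
      then obtain i p where F: "F = [i, p]" "conf i p" "src \<A> i = B'" "tgt \<A> p = A" by (auto simp: seq_single)
      show "mor \<A> F [zer Z A, idn \<A> A] (zer B' Z) (idn \<A> A)" unfolding F(1)
        by (rule mor_ConsI[of _ _ _ _ "p"], rule_tac [4] mor_ConsI[of _ _ _ _ "idn \<A> A"])
           (use conflationD[OF F(2)] F A z(1) in \<open>auto simp: Hom_iff\<close>)
    qed
    from terminal_seq_Suc[OF this Z B]
    have "terminal_seq (Suc t) A B (splice_seq \<A> [idn \<A> B, zer B Z] [zer Z A, idn \<A> A])" using 2 by simp
    moreover have "zero_seq \<A> (Suc t) A B = splice_seq \<A> [idn \<A> B, zer B Z] [zer Z A, idn \<A> A]"
      using 2 A B z(1) by (simp add: zero_seq_def)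
    ultimately show ?thesis by simp
  next
    case 3
    then obtain k where k: "t = Suc (Suc k)" by (metis Suc_le_D numeral_2_eq_2 add_2_eq_Suc le_add_diff_inverse)
    have e: "zero_seq \<A> (Suc t) A B = splice_seq \<A> [idn \<A> B, zer B Z] (zero_seq \<A> t A Z)"
      using B z(1) by (simp add: zero_seq_def k Z_def[symmetric])
    have "terminal_seq t A Z (zero_seq \<A> t A Z)" using Suc(1)[OF ZC] 3 by simp
    from terminal_seq_Suc[OF this Z B] show ?thesis unfolding e .
  qed
qed simp

lemma zero_in: "\<lbrakk>A \<in> \<C>; B \<in> \<C>; 0 < t\<rbrakk> \<Longrightarrow> cls (zero_seq \<A> t A B) \<in> ext t A B"
  using terminal_zero_seq[of A t B] extI by (auto simp: terminal_seq_def)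

lemma push_zer:
  assumes "\<gamma> \<in> ext t A B" "B' \<in> \<C>"
  shows "push (zer B B') \<gamma> = cls (zero_seq \<A> t A B')"
proof -
  obtain E where E: "seq t A B E" "\<gamma> = cls E" using assms(1) by (rule extE)
  have "terminal_seq t A B' (zero_seq \<A> t A B')" using terminal_zero_seq[of A t B'] assms seqD(2,4)[OF E(1)] by simp
  hence *: "seq t A B' (zero_seq \<A> t A B')" "mor \<A> E (zero_seq \<A> t A B') (zer B B') (idn \<A> A)"
    using E by (auto simp: terminal_seq_def)
  show ?thesis unfolding E(2)
    by (rule push_cls[OF E(1) _ _ *]) (use assms seqD(5)[OF E(1)] in \<open>auto simp: Hom_iff\<close>)
qed

lemma Ext_comm_group:
  assumes A: "A \<in> \<C>" and B: "B \<in> \<C>" and t: "0 < t"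
  shows "comm_group (Ext \<A> \<C> t A B)"
proof (rule comm_groupI)
  have Bo: "B \<in> obj \<A>" "biprod B B \<in> \<C>" using B by auto
  have i: "idn \<A> B \<in> Hom \<A> B B" "zer B B \<in> Hom \<A> B B" "neg (idn \<A> B) \<in> Hom \<A> B B" using B by (auto simp: Hom_iff)
  fix x assume "x \<in> carrier (Ext \<A> \<C> t A B)"
  hence x: "x \<in> ext t A B" by simp
  show "\<one>\<^bsub>Ext \<A> \<C> t A B\<^esub> \<otimes>\<^bsub>Ext \<A> \<C> t A B\<^esub> x = x"
    using push_add[OF x i(2,1) B] push_zer[OF x B] x B by simp
  \<comment> \<open>The inverse is the push-out along minus the identity, since -1 + 1 = 0 acts as
    zero.\<close>
  have "bsum A B (push (neg (idn \<A> B)) x) x = cls (zero_seq \<A> t A B)"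
    using push_add[OF x i(3,1) B] push_zer[OF x B] x B by simp
  thus "\<exists>y\<in>carrier (Ext \<A> \<C> t A B). y \<otimes>\<^bsub>Ext \<A> \<C> t A B\<^esub> x = \<one>\<^bsub>Ext \<A> \<C> t A B\<^esub>"
    using push_in[OF x i(3) B] by auto
  fix y assume "y \<in> carrier (Ext \<A> \<C> t A B)"
  hence y: "y \<in> ext t A B" by simp
  note p = pair_proj[OF x y]
  have h: "bp1 B B \<in> Hom \<A> (biprod B B) B" "bp2 B B \<in> Hom \<A> (biprod B B) B" using B by (auto simp: Hom_iff)
  show "x \<otimes>\<^bsub>Ext \<A> \<C> t A B\<^esub> y \<in> carrier (Ext \<A> \<C> t A B)" using bsum_in[OF x y] by simp
  have "bp1 B B \<boxplus> bp2 B B = bp2 B B \<boxplus> bp1 B B" using add_comm B by simp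
  thus "x \<otimes>\<^bsub>Ext \<A> \<C> t A B\<^esub> y = y \<otimes>\<^bsub>Ext \<A> \<C> t A B\<^esub> x"
    using push_add[OF p(1) h B] push_add[OF p(1) h(2,1) B] p by simp
  fix w assume "w \<in> carrier (Ext \<A> \<C> t A B)"
  hence w: "w \<in> ext t A B" by simp
  note q = pair_proj[OF p(1) w]
  \<comment> \<open>Associativity becomes an identity between sums of three projections once the
    three classes are combined into a single class over a threefold biproduct.\<close>
  let ?W = "biprod (biprod B B) B" and ?q = "bp1 (biprod B B) B" and ?c = "bp2 (biprod B B) B" and ?p = "pair A (pair A x y) w"
  let ?a = "bp1 B B \<cdot> ?q" and ?b = "bp2 B B \<cdot> ?q"
  have k: "?q \<in> Hom \<A> ?W (biprod B B)" "?a \<in> Hom \<A> ?W B" "?b \<in> Hom \<A> ?W B" "?c \<in> Hom \<A> ?W B" "?a \<boxplus> ?b \<in> Hom \<A> ?W B" "?b \<boxplus> ?c \<in> Hom \<A> ?W B"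
    using Bo by (auto simp: Hom_iff)
  have e: "push ?a ?p = x" "push ?b ?p = y" "push ?c ?p = w"
    using push_push[OF q(1) k(1) h(1)] push_push[OF q(1) k(1) h(2)] p q B by auto
  have "(?a \<boxplus> ?b) \<boxplus> ?c = ?a \<boxplus> (?b \<boxplus> ?c)" using k by (intro add_assoc) (auto simp: Hom_iff)
  thus "x \<otimes>\<^bsub>Ext \<A> \<C> t A B\<^esub> y \<otimes>\<^bsub>Ext \<A> \<C> t A B\<^esub> w = x \<otimes>\<^bsub>Ext \<A> \<C> t A B\<^esub> (y \<otimes>\<^bsub>Ext \<A> \<C> t A B\<^esub> w)"
    using push_add[OF q(1) k(5,4) B] push_add[OF q(1) k(2,6) B] push_add[OF q(1) k(2,3) B] push_add[OF q(1) k(3,4) B] e by simp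
qed (use zero_in assms in auto)

lemma push_hom: "\<lbrakk>f \<in> Hom \<A> B B'; A \<in> \<C>; B \<in> \<C>; B' \<in> \<C>; 0 < t\<rbrakk> \<Longrightarrow> group_hom (Ext \<A> \<C> t A B) (Ext \<A> \<C> t A B') (push f)"
  by (simp add: group_hom_def group_hom_axioms_def hom_def Ext_comm_group[THEN comm_group.axioms(2)] push_bsum push_in)

lemma pull_hom: "\<lbrakk>f \<in> Hom \<A> A' A; A \<in> \<C>; B \<in> \<C>; A' \<in> \<C>; 0 < t\<rbrakk> \<Longrightarrow> group_hom (Ext \<A> \<C> t A B) (Ext \<A> \<C> t A' B) (\<lambda>\<gamma>. pull \<gamma> f)"
  by (simp add: group_hom_def group_hom_axioms_def hom_def Ext_comm_group[THEN comm_group.axioms(2)] pull_bsum pull_in)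

lemma prod_hom_left: "\<lbrakk>\<mu> \<in> ext t Z A; B \<in> \<C>; 0 < s\<rbrakk> \<Longrightarrow> group_hom (Ext \<A> \<C> s A B) (Ext \<A> \<C> (s + t) Z B) (\<lambda>\<gamma>. yprod \<gamma> \<mu>)"
  using ext_obj[of \<mu> t Z A]
  by (simp add: group_hom_def group_hom_axioms_def hom_def Ext_comm_group[THEN comm_group.axioms(2)] prod_bsum_left prod_in)

lemma prod_hom_right: "\<lbrakk>\<gamma> \<in> ext s A B; Z \<in> \<C>; 0 < t\<rbrakk> \<Longrightarrow> group_hom (Ext \<A> \<C> t Z A) (Ext \<A> \<C> (s + t) Z B) (yprod \<gamma>)"
  using ext_obj[of \<gamma> s A B]
  by (simp add: group_hom_def group_hom_axioms_def hom_def Ext_comm_group[THEN comm_group.axioms(2)] prod_bsum_right prod_in)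

section \<open>Exactness\<close>

abbreviation "ext_zero t A B \<equiv> ext_class \<A> \<C> (zero_seq \<A> t A B)"

lemma push_ext_zero: "\<lbrakk>f \<in> Hom \<A> B B'; A \<in> \<C>; B \<in> \<C>; B' \<in> \<C>; 0 < t\<rbrakk> \<Longrightarrow> push f (ext_zero t A B) = ext_zero t A B'"
  using group_hom.hom_one[OF push_hom] by simp

lemma pull_ext_zero: "\<lbrakk>f \<in> Hom \<A> A' A; A \<in> \<C>; B \<in> \<C>; A' \<in> \<C>; 0 < t\<rbrakk> \<Longrightarrow> pull (ext_zero t A B) f = ext_zero t A' B"
  using group_hom.hom_one[OF pull_hom] by simp

lemma prod_ext_zero_left: "\<lbrakk>\<mu> \<in> ext t Z A; B \<in> \<C>; 0 < s\<rbrakk> \<Longrightarrow> yprod (ext_zero s A B) \<mu> = ext_zero (s + t) Z B"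
  using group_hom.hom_one[OF prod_hom_left] by simp

lemma prod_ext_zero_right: "\<lbrakk>\<gamma> \<in> ext s A B; Z \<in> \<C>; 0 < t\<rbrakk> \<Longrightarrow> yprod \<gamma> (ext_zero t Z A) = ext_zero (s + t) Z B"
  using group_hom.hom_one[OF prod_hom_right] by simp

section \<open>Exactness in degree one\<close>

lemma mor1E:
  assumes "mor \<A> [i, p] [i', p'] f h"
  obtains m where "f \<in> Hom \<A> (src \<A> i) (src \<A> i')" "m \<in> Hom \<A> (tgt \<A> i) (tgt \<A> i')" "m \<cdot> i = i' \<cdot> f"
    "h \<in> Hom \<A> (tgt \<A> p) (tgt \<A> p')" "h \<cdot> p = p' \<cdot> m"
  using assms by auto

lemma mor1I:
  assumes "f \<in> Hom \<A> (src \<A> i) (src \<A> i')" "m \<in> Hom \<A> (tgt \<A> i) (tgt \<A> i')" "m \<cdot> i = i' \<cdot> f"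
    "h \<in> Hom \<A> (tgt \<A> p) (tgt \<A> p')" "h \<cdot> p = p' \<cdot> m" "src \<A> p = tgt \<A> i" "src \<A> p' = tgt \<A> i'"
  shows "mor \<A> [i, p] [i', p'] f h"
  using assms by auto

lemma seq_conflation: "conf i p \<Longrightarrow> seq (Suc 0) (tgt \<A> p) (src \<A> i) [i, p]"
  by (auto simp: seq_single)

lemma ext_conflation: "conf i p \<Longrightarrow> cls [i, p] \<in> ext (Suc 0) (tgt \<A> p) (src \<A> i)"
  using seq_conflation extI by blast

lemma push_conflation:
  assumes c: "conf a b" and f: "f \<in> Hom \<A> (src \<A> a) B'" "B' \<in> \<C>"
  obtains a' b' where "conf a' b'" "src \<A> a' = B'" "tgt \<A> b' = tgt \<A> b" "push f (cls [a, b]) = cls [a', b']"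
    "mor \<A> [a, b] [a', b'] f (idn \<A> (tgt \<A> b))"
proof -
  obtain E' where "seq (Suc 0) (tgt \<A> b) B' E'" "push f (cls [a, b]) = cls E'" "mor \<A> [a, b] E' f (idn \<A> (tgt \<A> b))"
    using push_ex[OF seq_conflation[OF c] f] by metis
  thus thesis using that unfolding seq_single by blast
qed

text \<open>In degree one every generating morphism is invertible, so a zigzag collapses to a single
  morphism in \<open>cls1_mor\<close>. This opens degree one to direct diagram arguments.\<close>

lemma mor1_sym:
  assumes c: "conf i p" "conf i' p'" and e: "src \<A> i = B" "src \<A> i' = B" "tgt \<A> p = A" "tgt \<A> p' = A"
    and m: "mor \<A> [i, p] [i', p'] (idn \<A> B) (idn \<A> A)"
  shows "mor \<A> [i', p'] [i, p] (idn \<A> B) (idn \<A> A)"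
proof -
  note C = conflationD[OF c(1)] and C' = conflationD[OF c(2)]
  obtain m where m: "m \<in> Hom \<A> (tgt \<A> i) (tgt \<A> i')" "m \<cdot> i = i'" "p = p' \<cdot> m"
    using m by (rule mor1E) (use C C' e in simp)
  then obtain g where "g\<in>arr \<A>" "src \<A> g = src \<A> p'" "tgt \<A> g = src \<A> p" "g \<cdot> i' = i" "p \<cdot> g = p'"
    using short_five[OF C(1) C'(1), of m] C(4) C'(4) unfolding Hom_iff by metis
  thus ?thesis using C C' e by (intro mor1I[of _ _ _ g]) (auto simp: Hom_iff)
qed

lemma cls1_mor:
  assumes c: "conf i p" "conf i' p'" and e: "src \<A> i = B" "src \<A> i' = B" "tgt \<A> p = A" "tgt \<A> p' = A"
    and eq: "cls [i, p] = cls [i', p']"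
  shows "mor \<A> [i, p] [i', p'] (idn \<A> B) (idn \<A> A)"
proof -
  have s: "seq (Suc 0) A B [i, p]" using seq_conflation[OF c(1)] e by simp
  have "mor \<A> [i, p] [i', p'] (idn \<A> B) (idn \<A> A) \<and> seq (Suc 0) A B [i', p']"
  proof (rule cls_induct[OF eq s])
    show "mor \<A> [i, p] [i, p] (idn \<A> B) (idn \<A> A)" by (rule seq_mor_id[OF s])
    fix X Y assume x: "seq (Suc 0) A B X" "seq (Suc 0) A B Y"
      and m: "mor \<A> X Y (idn \<A> B) (idn \<A> A) \<or> mor \<A> Y X (idn \<A> B) (idn \<A> A)"
      and ih: "mor \<A> [i, p] X (idn \<A> B) (idn \<A> A)"
    have "mor \<A> X Y (idn \<A> B) (idn \<A> A)" using m x mor1_sym by (auto simp: seq_single simp del: mor.simps)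
    from seq_mor_cmp[OF ih this s x] show "mor \<A> [i, p] Y (idn \<A> B) (idn \<A> A)" using seqD(4,5)[OF s] by simp
  qed
  thus ?thesis by simp
qed

lemma zero_seq_1: "zero_seq \<A> (Suc 0) A B = [bi1 B A, bp2 B A]"
  by (simp add: zero_seq_def biprod_of_eq)

lemma biproduct_conflation: "A \<in> \<C> \<Longrightarrow> B \<in> \<C> \<Longrightarrow> conf (bi1 B A) (bp2 B A)"
  by (rule conflationI[OF biproduct_short_exact[OF biproduct_biprod]]) auto

lemma cls_zero_retract:
  assumes c: "conf a b" and z: "cls [a, b] = ext_zero (Suc 0) (tgt \<A> b) (src \<A> a)"
  shows "\<exists>r\<in>arr \<A>. src \<A> r = tgt \<A> a \<and> tgt \<A> r = src \<A> a \<and> r \<cdot> a = idn \<A> (src \<A> a)"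
proof -
  note C = conflationD[OF c]
  let ?B = "src \<A> a" and ?A = "tgt \<A> b"
  have "mor \<A> [a, b] [bi1 ?B ?A, bp2 ?B ?A] (idn \<A> ?B) (idn \<A> ?A)"
    by (rule cls1_mor[OF c biproduct_conflation]) (use C z zero_seq_1 in auto)
  then obtain m where "m \<in> Hom \<A> (tgt \<A> a) (tgt \<A> (bi1 ?B ?A))" "m \<cdot> a = bi1 ?B ?A \<cdot> idn \<A> ?B" by (rule mor1E)
  hence m: "m \<in> arr \<A>" "src \<A> m = tgt \<A> a" "tgt \<A> m = biprod ?B ?A" "m \<cdot> a = bi1 ?B ?A" using C by (auto simp: Hom_iff)
  show ?thesis by (rule bexI[of _ "bp1 ?B ?A \<cdot> m"]) (use m C in auto)
qed

text \<open>The pulled-back deflation is split by the identity of the middle term: (i, id) maps the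
  trivial sequence to the given one over \<open>p\<close>.\<close>

lemma pull_own_deflation:
  assumes c: "conf i p"
  shows "pull (cls [i, p]) p = ext_zero (Suc 0) (src \<A> p) (src \<A> i)"
  unfolding zero_seq_1
proof (rule pull_cls[OF seq_conflation[OF c]])
  note C = conflationD[OF c]
  let ?m = "cotup i (idn \<A> (src \<A> p))"
  show "mor \<A> [bi1 (src \<A> i) (src \<A> p), bp2 (src \<A> i) (src \<A> p)] [i, p] (idn \<A> (src \<A> i)) p"
  proof (rule mor1I[of _ _ _ ?m])
    have "p \<cdot> (i \<cdot> bp1 (src \<A> i) (src \<A> p)) = (p \<cdot> i) \<cdot> bp1 (src \<A> i) (src \<A> p)" using C(2-7) by simp
    thus "p \<cdot> bp2 (src \<A> i) (src \<A> p) = p \<cdot> ?m" using C by (simp add: cotup_def)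
  qed (use C in \<open>auto simp: Hom_iff\<close>)
  show "seq (Suc 0) (src \<A> p) (src \<A> i) [bi1 (src \<A> i) (src \<A> p), bp2 (src \<A> i) (src \<A> p)]"
    using biproduct_conflation[of "src \<A> p" "src \<A> i"] C by (simp add: seq_single)
qed (use conflationD[OF c] in \<open>auto simp: Hom_iff\<close>)

lemma push_own_inflation:
  assumes c: "conf i p"
  shows "push i (cls [i, p]) = ext_zero (Suc 0) (tgt \<A> p) (src \<A> p)"
  unfolding zero_seq_1
proof (rule push_cls[OF seq_conflation[OF c]])
  note C = conflationD[OF c]
  show "mor \<A> [i, p] [bi1 (src \<A> p) (tgt \<A> p), bp2 (src \<A> p) (tgt \<A> p)] i (idn \<A> (tgt \<A> p))"
  proof (rule mor1I[of _ _ _ "tup (idn \<A> (src \<A> p)) p"])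
    show "tup (idn \<A> (src \<A> p)) p \<cdot> i = bi1 (src \<A> p) (tgt \<A> p) \<cdot> i" using C by (simp add: tup_def)
  qed (use C in \<open>auto simp: Hom_iff\<close>)
  show "seq (Suc 0) (tgt \<A> p) (src \<A> p) [bi1 (src \<A> p) (tgt \<A> p), bp2 (src \<A> p) (tgt \<A> p)]"
    using biproduct_conflation[of "tgt \<A> p" "src \<A> p"] C by (simp add: seq_single)
qed (use conflationD[OF c] in \<open>auto simp: Hom_iff\<close>)

text \<open>A splitting of the push-out along \<open>p\<close> gives a map \<open>s\<close> from the middle term to \<open>tgt p\<close>; the
  kernel of \<open>s\<close> is the middle term of the lift.\<close>

lemma ext1_exact_middle:
  assumes c: "conf i p" and E: "\<gamma> \<in> ext (Suc 0) Z (src \<A> p)" and z: "push p \<gamma> = ext_zero (Suc 0) Z (tgt \<A> p)"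
  shows "\<exists>\<gamma>'\<in>ext (Suc 0) Z (src \<A> i). \<gamma> = push i \<gamma>'"
proof -
  note C = conflationD[OF c] and S = short_exactD[OF conflationD(1)[OF c]]
  obtain a b where ab: "\<gamma> = cls [a, b]" "conf a b" "src \<A> a = src \<A> p" "tgt \<A> b = Z"
    using E by (auto elim!: extE simp: seq_single)
  note D = conflationD[OF ab(2)] and Sa = short_exactD[OF conflationD(1)[OF ab(2)]]
  have s: "seq (Suc 0) Z (src \<A> p) [a, b]" using ab by (auto simp: seq_single)
  obtain a' b' where ab': "push p \<gamma> = cls [a', b']" "conf a' b'" "src \<A> a' = tgt \<A> p" "tgt \<A> b' = Z"
    "mor \<A> [a, b] [a', b'] p (idn \<A> Z)"
    using push_conflation[OF ab(2), of p "tgt \<A> p"] C ab unfolding Hom_iff by metis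
  note D' = conflationD[OF ab'(2)]
  obtain q where q: "q \<in> arr \<A>" "src \<A> q = tgt \<A> a" "tgt \<A> q = tgt \<A> a'" "q \<cdot> a = a' \<cdot> p" "b = b' \<cdot> q"
    using ab'(5) by (rule mor1E) (use D ab in \<open>auto simp: Hom_iff\<close>)
  obtain r where r: "r \<in> arr \<A>" "src \<A> r = tgt \<A> a'" "tgt \<A> r = src \<A> a'" "r \<cdot> a' = idn \<A> (src \<A> a')"
    using cls_zero_retract[OF ab'(2)] z ab' by auto
  define s where "s = r \<cdot> q"
  have sa: "s \<in> arr \<A>" "src \<A> s = tgt \<A> a" "tgt \<A> s = tgt \<A> p" using q r ab' by (auto simp: s_def)
  have "s \<cdot> a = r \<cdot> (a' \<cdot> p)" unfolding s_def q(4)[symmetric] by (rule assoc) (use q r D in auto)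
  also have "\<dots> = (r \<cdot> a') \<cdot> p" by (rule assoc[symmetric]) (use r D' C ab' in auto)
  finally have sp: "s \<cdot> a = p" using r ab' C by simp
  have es: "epi_arr \<A> s"
  proof (rule epiI)
    fix u T assume u: "T \<in> obj \<A>" "u \<in> arr \<A>" "tgt \<A> u = T" "src \<A> u = tgt \<A> s" "u \<cdot> s = zer (src \<A> s) T"
    have "u \<cdot> p = (u \<cdot> s) \<cdot> a" unfolding sp[symmetric] by (rule assoc[symmetric]) (use u sa D in auto)
    hence "u \<cdot> p = zer (src \<A> p) T" using u sa D ab by simp
    thus "u = zer (tgt \<A> s) T" using epi_cancel_zer[OF S(4)] u sa by auto
  qed (use sa in auto)
  obtain k where k: "is_kernel \<A> k s" using kernel_exists sa by blast
  note K = kernelD[OF k] and sk = short_exactD[OF epi_kernel_short_exact[OF es k]]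
  have ai: "a \<cdot> i \<in> arr \<A>" "src \<A> (a \<cdot> i) = src \<A> i" "tgt \<A> (a \<cdot> i) = tgt \<A> a" using C D ab by auto
  have "s \<cdot> (a \<cdot> i) = (s \<cdot> a) \<cdot> i" by (rule assoc[symmetric]) (use C D ab sa in auto)
  hence "s \<cdot> (a \<cdot> i) = zer (src \<A> i) (tgt \<A> s)" unfolding sp using C sa by simp
  then obtain l where l: "l \<in> arr \<A>" "src \<A> l = src \<A> i" "tgt \<A> l = src \<A> k" "k \<cdot> l = a \<cdot> i"
    using K(6)[of "a \<cdot> i"] ai sa by auto
  have bk: "b \<cdot> k \<in> arr \<A>" "src \<A> (b \<cdot> k) = src \<A> k" "tgt \<A> (b \<cdot> k) = Z" using D K sa ab by auto
  \<comment> \<open>The lift consists of the arrow induced by \<open>a \<cdot> i\<close> into the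
    kernel of \<open>s\<close> and of the restriction of \<open>b\<close> to this kernel. That the
    restriction is epi uses that an arrow vanishing on the kernel factors through the epimorphism
    \<open>s\<close>.\<close>
  have "short_exact \<A> l (b \<cdot> k)"
  proof (rule epi_kernel_short_exact[OF epiI is_kernelI[OF monoI]])
    fix u T assume u: "T \<in> obj \<A>" "u \<in> arr \<A>" "tgt \<A> u = T" "src \<A> u = tgt \<A> (b \<cdot> k)" "u \<cdot> (b \<cdot> k) = zer (src \<A> (b \<cdot> k)) T"
    have "(u \<cdot> b) \<cdot> k = zer (src \<A> k) (tgt \<A> (u \<cdot> b))" using u bk D(3,4) K(1,3) sa by simp
    then obtain m where m: "m \<in> arr \<A>" "src \<A> m = tgt \<A> s" "tgt \<A> m = T" "m \<cdot> s = u \<cdot> b"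
      using sk(10)[of "u \<cdot> b"] u bk D(3,4) sa K ab by auto
    have "m \<cdot> p = (m \<cdot> s) \<cdot> a" unfolding sp[symmetric] by (rule assoc[symmetric]) (use m sa D in auto)
    also have "\<dots> = u \<cdot> (b \<cdot> a)" unfolding m(4) by (rule assoc) (use u bk D ab in auto)
    finally have "m \<cdot> p = zer (src \<A> p) T" using u bk D ab by simp
    hence "m = zer (tgt \<A> p) T" using epi_cancel_zer[OF S(4)] m sa by auto
    hence "u \<cdot> b = zer (src \<A> b) T" using m(4) u sa D by simp
    thus "u = zer (tgt \<A> (b \<cdot> k)) T" using epi_cancel_zer[OF Sa(4)] u bk ab by auto
  next
    fix u T assume u: "T \<in> obj \<A>" "u \<in> arr \<A>" "src \<A> u = T" "tgt \<A> u = src \<A> l" "l \<cdot> u = zer T (tgt \<A> l)"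
    have "(a \<cdot> i) \<cdot> u = k \<cdot> (l \<cdot> u)" unfolding l(4)[symmetric] by (rule assoc) (use u l K in auto)
    hence "a \<cdot> (i \<cdot> u) = zer T (tgt \<A> a)" using u l K(1,3) sa C D ab by simp
    hence "i \<cdot> u = zer T (src \<A> a)" using mono_cancel_zer[OF Sa(3), of "i \<cdot> u"] u l C ab by auto
    thus "u = zer T (src \<A> l)" using mono_cancel_zer[OF S(3)] u l C ab by auto
  next
    have "(b \<cdot> k) \<cdot> l = b \<cdot> (a \<cdot> i)" unfolding l(4)[symmetric] by (rule assoc) (use l K D sa in auto)
    also have "\<dots> = (b \<cdot> a) \<cdot> i" by (rule assoc[symmetric]) (use C D ab in auto)
    finally show "(b \<cdot> k) \<cdot> l = zer (src \<A> l) (tgt \<A> (b \<cdot> k))" using C D ab l bk by simp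
  next
    fix u assume u: "u \<in> arr \<A>" "tgt \<A> u = src \<A> (b \<cdot> k)" "(b \<cdot> k) \<cdot> u = zer (src \<A> u) (tgt \<A> (b \<cdot> k))"
    have "b \<cdot> (k \<cdot> u) = zer (src \<A> (k \<cdot> u)) (tgt \<A> b)" using u bk K(1,3) D(3,4) sa ab by simp
    then obtain v where v: "v \<in> arr \<A>" "src \<A> v = src \<A> u" "tgt \<A> v = src \<A> a" "a \<cdot> v = k \<cdot> u"
      using Sa(9)[of "k \<cdot> u"] u bk K(1,3) sa D by auto
    have "p \<cdot> v = s \<cdot> (a \<cdot> v)" unfolding sp[symmetric] by (rule assoc) (use v sa D in auto)
    also have "\<dots> = (s \<cdot> k) \<cdot> u" unfolding v(4) by (rule assoc[symmetric]) (use u bk K sa in auto)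
    finally have "p \<cdot> v = zer (src \<A> v) (tgt \<A> p)" using K(1-4) u bk v sa C(3) by simp
    then obtain w where w: "w \<in> arr \<A>" "src \<A> w = src \<A> u" "tgt \<A> w = src \<A> i" "i \<cdot> w = v"
      using S(9)[of v] v ab by auto
    have "l \<cdot> w = u"
    proof (rule mono_cancel[OF K(5)])
      have "k \<cdot> (l \<cdot> w) = (k \<cdot> l) \<cdot> w" by (rule assoc[symmetric]) (use w l K in auto)
      also have "\<dots> = a \<cdot> (i \<cdot> w)" unfolding l(4) by (rule assoc) (use w C D ab in auto)
      finally show "k \<cdot> (l \<cdot> w) = k \<cdot> u" using w v by simp
    qed (use w l u bk in auto)
    thus "\<exists>w\<in>arr \<A>. src \<A> w = src \<A> u \<and> tgt \<A> w = src \<A> l \<and> l \<cdot> w = u" using w l by auto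
  qed (use l bk in auto)
  hence cl: "conf l (b \<cdot> k)" by (rule conflationI) (use l bk C D ab in auto)
  have "mor \<A> [l, b \<cdot> k] [a, b] i (idn \<A> Z)"
    by (rule mor1I[of _ _ _ k]) (use l bk K C D ab sa in \<open>auto simp: Hom_iff\<close>)
  hence "push i (cls [l, b \<cdot> k]) = cls [a, b]"
    by (intro push_cls[of "Suc 0" Z "src \<A> i"]) (use cl l bk C D ab s in \<open>auto simp: Hom_iff seq_single simp del: mor.simps\<close>)
  moreover have "cls [l, b \<cdot> k] \<in> ext (Suc 0) Z (src \<A> i)" using ext_conflation[OF cl] l bk by simp
  ultimately show ?thesis using ab(1) by auto
qed

text \<open>A splitting after the push-out along \<open>i\<close> extends \<open>i\<close> along
  \<open>a\<close> to an arrow \<open>s\<close>; then \<open>p \<cdot> s\<close> kills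
  \<open>a\<close> and induces \<alpha> on the right end.\<close>

lemma ext1_exact_left:
  assumes c: "conf i p" and E: "\<gamma> \<in> ext (Suc 0) Z (src \<A> i)" and z: "push i \<gamma> = ext_zero (Suc 0) Z (tgt \<A> i)"
  shows "\<exists>\<alpha>\<in>Hom \<A> Z (tgt \<A> p). \<gamma> = pull (cls [i, p]) \<alpha>"
proof -
  note C = conflationD[OF c]
  obtain a b where ab: "\<gamma> = cls [a, b]" "conf a b" "src \<A> a = src \<A> i" "tgt \<A> b = Z"
    using E by (auto elim!: extE simp: seq_single)
  note D = conflationD[OF ab(2)] and Sa = short_exactD[OF conflationD(1)[OF ab(2)]]
  have s: "seq (Suc 0) Z (src \<A> i) [a, b]" using ab by (auto simp: seq_single)
  obtain a' b' where ab': "push i \<gamma> = cls [a', b']" "conf a' b'" "src \<A> a' = tgt \<A> i" "tgt \<A> b' = Z"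
    "mor \<A> [a, b] [a', b'] i (idn \<A> Z)"
    using push_conflation[OF ab(2), of i "tgt \<A> i"] C ab unfolding Hom_iff by metis
  note D' = conflationD[OF ab'(2)]
  obtain q where q: "q \<in> arr \<A>" "src \<A> q = tgt \<A> a" "tgt \<A> q = tgt \<A> a'" "q \<cdot> a = a' \<cdot> i"
    using ab'(5) by (rule mor1E) (auto simp: Hom_iff)
  obtain r where r: "r \<in> arr \<A>" "src \<A> r = tgt \<A> a'" "tgt \<A> r = src \<A> a'" "r \<cdot> a' = idn \<A> (src \<A> a')"
    using cls_zero_retract[OF ab'(2)] z ab' by auto
  define s where "s = r \<cdot> q"
  have sa: "s \<in> arr \<A>" "src \<A> s = tgt \<A> a" "tgt \<A> s = tgt \<A> i" using q r ab' by (auto simp: s_def)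
  have "s \<cdot> a = r \<cdot> (a' \<cdot> i)" unfolding s_def q(4)[symmetric] by (rule assoc) (use q r D in auto)
  also have "\<dots> = (r \<cdot> a') \<cdot> i" by (rule assoc[symmetric]) (use r D' C ab' in auto)
  finally have si: "s \<cdot> a = i" using r ab' C by simp
  have "(p \<cdot> s) \<cdot> a = zer (src \<A> a) (tgt \<A> (p \<cdot> s))" using si C D sa ab by simp
  then obtain \<alpha> where al: "\<alpha> \<in> arr \<A>" "src \<A> \<alpha> = Z" "tgt \<A> \<alpha> = tgt \<A> p" "\<alpha> \<cdot> b = p \<cdot> s"
    using Sa(10)[of "p \<cdot> s"] C D sa ab by auto
  have "mor \<A> [a, b] [i, p] (idn \<A> (src \<A> i)) \<alpha>"
    by (rule mor1I[of _ _ _ s]) (use al sa si C D ab in \<open>auto simp: Hom_iff\<close>)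
  hence "pull (cls [i, p]) \<alpha> = cls [a, b]"
    by (intro pull_cls[OF seq_conflation[OF c]]) (use al s D ab in \<open>auto simp: Hom_iff simp del: mor.simps\<close>)
  thus ?thesis using al ab by (auto simp: Hom_iff)
qed

text \<open>An inflation stays an inflation when paired with an arbitrary arrow. Its cokernel is the
  push-out object, which lies in \<C> as an extension of \<open>tgt \<A> p\<close> by
  \<open>Y\<close>.\<close>

lemma pushout_conflation:
  assumes c: "conf i p" and g: "g \<in> Hom \<A> (src \<A> i) Y" "Y \<in> \<C>"
  shows "\<exists>q. conf (tup i (neg g)) q"
proof -
  note C = conflationD[OF c]
  have g': "g \<in> arr \<A>" "src \<A> g = src \<A> i" "tgt \<A> g = Y" using g by (auto simp: Hom_iff)
  obtain q r where po: "pushout_square \<A> i g q r" using pushout_exists[of i g] C g' by auto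
  note P = pushoutD[OF po]
  have b: "biproduct \<A> (tgt \<A> i) (tgt \<A> g) (biprod (tgt \<A> i) Y) (bi1 (tgt \<A> i) Y) (bi2 (tgt \<A> i) Y) (bp1 (tgt \<A> i) Y) (bp2 (tgt \<A> i) Y)"
    using biproduct_biprod[of "tgt \<A> i" Y] g' C g by simp
  note s = pushout_short_exact[OF C(1) po b]
  obtain p' where p': "p'\<in>arr \<A>" "src \<A> p' = tgt \<A> q" "tgt \<A> p' = tgt \<A> p" "p' \<cdot> q = p" "p' \<cdot> r = zer (tgt \<A> g) (tgt \<A> p)"
    using s(3) by blast
  have "tgt \<A> r \<in> \<C>" using C_ext[OF s(2)[OF p']] P g' g p' C by auto
  hence "conf (bi1 (tgt \<A> i) Y \<cdot> i \<boxplus> bi2 (tgt \<A> i) Y \<cdot> neg g) (q \<cdot> bp1 (tgt \<A> i) Y \<boxplus> r \<cdot> bp2 (tgt \<A> i) Y)"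
    by (intro conflationI[OF s(1)]) (use P g' g C in auto)
  thus ?thesis using g' C by (auto simp: tup_def)
qed

text \<open>Besides the pulled-back conflation this keeps the conflation of the pull-back object in
  the biproduct. It shows that \<open>p\<close> together with an arbitrary arrow is again a
  deflation, and it lets classes be lifted to a pull-back.\<close>

lemma pullback_conflation:
  assumes c: "conf i p" and g: "\<alpha> \<in> Hom \<A> Y (tgt \<A> p)" "Y \<in> \<C>"
  obtains i' p' \<phi> where "conf i' p'" "src \<A> i' = src \<A> i" "tgt \<A> p' = Y" "\<phi> \<in> Hom \<A> (src \<A> p') (src \<A> p)"
    "mor \<A> [i', p'] [i, p] (idn \<A> (src \<A> i)) \<alpha>" "conf (tup \<phi> p') (cotup p (neg \<alpha>))"
proof -
  interpret O: ext_category "opp \<A>" \<C> by (rule opp_ext_category)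
  note C = conflationD[OF c]
  have g': "\<alpha> \<in> arr \<A>" "src \<A> \<alpha> = Y" "tgt \<A> \<alpha> = tgt \<A> p" using g by (auto simp: Hom_iff)
  obtain \<phi> p' where po: "pushout_square (opp \<A>) p \<alpha> \<phi> p'" using O.pushout_exists[of p \<alpha>] C g' by auto
  note P = O.pushoutD[OF po]
  have b: "biproduct (opp \<A>) (tgt (opp \<A>) p) (tgt (opp \<A>) \<alpha>) (biprod (src \<A> p) Y) (bp1 (src \<A> p) Y) (bp2 (src \<A> p) Y) (bi1 (src \<A> p) Y) (bi2 (src \<A> p) Y)"
    using biproduct_biprod[of "src \<A> p" Y] g' C g by simp
  have se: "short_exact (opp \<A>) p i" using C by simp
  note s = O.pushout_short_exact[OF se po b]
  obtain i' where i': "i'\<in>arr \<A>" "tgt \<A> i' = src \<A> \<phi>" "src \<A> i' = src \<A> i" "\<phi> \<cdot> i' = i" "p' \<cdot> i' = zer (src \<A> i) (src \<A> \<alpha>)"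
    using s(3) by auto
  have "short_exact (opp \<A>) p' i'" by (rule s(2)) (use i' in auto)
  hence s': "short_exact \<A> i' p'" by simp
  have p'Y: "tgt \<A> p' = Y" using P(7) g' by simp
  have c': "conf i' p'" by (rule conflationI[OF s']) (use i' p'Y C g in auto)
  have neg: "O.neg \<alpha> = neg \<alpha>" unfolding O.neg_def neg_def by (simp add: hom_group_def)
  have phi: "\<phi> \<in> Hom \<A> (src \<A> p') (src \<A> p)" using P C by (auto simp: Hom_iff)
  have "short_exact \<A> (bi1 (src \<A> p) Y \<cdot> \<phi> \<boxplus> bi2 (src \<A> p) Y \<cdot> p') (p \<cdot> bp1 (src \<A> p) Y \<boxplus> neg \<alpha> \<cdot> bp2 (src \<A> p) Y)"
    using s(1) by (simp add: neg)
  hence "short_exact \<A> (tup \<phi> p') (cotup p (neg \<alpha>))" using phi g' p'Y by (simp add: tup_def cotup_def Hom_iff)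
  hence "conf (tup \<phi> p') (cotup p (neg \<alpha>))"
    by (rule conflationI) (use conflationD[OF c'] phi g' C p'Y in \<open>auto simp: Hom_iff\<close>)
  moreover have "mor \<A> [i', p'] [i, p] (idn \<A> (src \<A> i)) \<alpha>"
    by (rule mor1I[of _ _ _ \<phi>]) (use i' P(1-9) C(2-7) g' phi p'Y conflationD(2-7)[OF c'] in \<open>auto simp: Hom_iff\<close>)
  ultimately show thesis using that[OF c' _ p'Y phi] i' by simp
qed

section \<open>Long exact sequences in all degrees\<close>

definition "ext_exact_middle t \<longleftrightarrow> (\<forall>i p Z. \<forall>\<gamma>\<in>ext t Z (src \<A> p). conf i p \<longrightarrow> push p \<gamma> = ext_zero t Z (tgt \<A> p) \<longrightarrow>
   (\<exists>\<gamma>'\<in>ext t Z (src \<A> i). \<gamma> = push i \<gamma>'))"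

text \<open>Exactness at the connecting map: a class killed by it is joined to zero by a zigzag of morphisms
  of spliced sequences, and liftability along the first deflation is transported along each of them.\<close>

lemma lift_step:
  assumes ex: "ext_exact_middle t" and c: "conf i p" "conf i' p'" and F: "seq t Z (tgt \<A> p) F" "seq t Z (tgt \<A> p') F'"
    and K: "src \<A> i = K" "src \<A> i' = K"
    and m: "mor \<A> (splice_seq \<A> [i, p] F) (splice_seq \<A> [i', p'] F') (idn \<A> K) (idn \<A> Z)"
  shows "(\<exists>G\<in>ext t Z (src \<A> p). cls F = push p G) \<longleftrightarrow> (\<exists>G\<in>ext t Z (src \<A> p'). cls F' = push p' G)"
proof -
  note C = conflationD[OF c(1)] and C' = conflationD[OF c(2)]
  obtain j fs where j: "F = j # fs" "j \<in> arr \<A>" "src \<A> j = tgt \<A> p" using seqD(3,11)[OF F(1)] by auto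
  obtain j' fs' where j': "F' = j' # fs'" "j' \<in> arr \<A>" "src \<A> j' = tgt \<A> p'" using seqD(3,11)[OF F(2)] by auto
  obtain \<alpha> where al: "\<alpha> \<in> Hom \<A> (tgt \<A> p) (tgt \<A> p')" "mor \<A> [i, p] [i', p'] (idn \<A> K) \<alpha>" "mor \<A> F F' \<alpha> (idn \<A> Z)"
    using mor_split[of i p j fs i' p' j' fs' "idn \<A> K" "idn \<A> Z"] m j j' C(1) C'(1) by auto
  have pF: "push \<alpha> (cls F) = cls F'" by (rule push_cls[OF F(1) al(1) C'(7) F(2) al(3)])
  have a: "\<alpha> \<in> arr \<A>" "src \<A> \<alpha> = tgt \<A> p" "tgt \<A> \<alpha> = tgt \<A> p'" using al by (auto simp: Hom_iff)
  obtain m where m: "m \<in> Hom \<A> (tgt \<A> i) (tgt \<A> i')" "\<alpha> \<cdot> p = p' \<cdot> m" using al(2) by (rule mor1E)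
  have pH: "p \<in> Hom \<A> (src \<A> p) (tgt \<A> p)" "p' \<in> Hom \<A> (src \<A> p') (tgt \<A> p')" "m \<in> Hom \<A> (src \<A> p) (src \<A> p')" using C C' m by (auto simp: Hom_iff)
  show ?thesis
  proof
    assume "\<exists>G\<in>ext t Z (src \<A> p). cls F = push p G"
    then obtain G where G: "G \<in> ext t Z (src \<A> p)" "cls F = push p G" by blast
    have "cls F' = push p' (push m G)" unfolding pF[symmetric] G(2)
      using push_push[OF G(1) pH(1) al(1)] push_push[OF G(1) pH(3,2)] m C C' by simp
    thus "\<exists>G\<in>ext t Z (src \<A> p'). cls F' = push p' G" using push_in[OF G(1) pH(3)] C' by blast
  next
    assume "\<exists>G\<in>ext t Z (src \<A> p'). cls F' = push p' G"
    then obtain G where G: "G \<in> ext t Z (src \<A> p')" "cls F' = push p' G" by blast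
    \<comment> \<open>The pull-back of \<open>i'\<close>, \<open>p'\<close> along \<alpha> is
      equivalent to \<open>i\<close>, \<open>p\<close>, so an arrow \<theta> of middle terms
      converts lifts along \<open>p2\<close> into lifts along \<open>p\<close>.\<close>
    obtain i2 p2 \<phi> where b: "conf i2 p2" "src \<A> i2 = K" "tgt \<A> p2 = tgt \<A> p" "\<phi> \<in> Hom \<A> (src \<A> p2) (src \<A> p')"
      "mor \<A> [i2, p2] [i', p'] (idn \<A> K) \<alpha>" "conf (tup \<phi> p2) (cotup p' (neg \<alpha>))"
      using pullback_conflation[OF c(2) al(1) C(7)] K by metis
    note B = conflationD[OF b(1)]
    have "cls [i2, p2] = pull (cls [i', p']) \<alpha>"
      by (rule pull_cls[symmetric, OF seq_conflation[OF c(2)] al(1) C(7)]) (use seq_conflation[OF b(1)] b K in \<open>auto simp del: mor.simps\<close>)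
    also have "\<dots> = cls [i, p]"
      by (rule pull_cls[OF seq_conflation[OF c(2)] al(1) C(7)]) (use seq_conflation[OF c(1)] al(2) K in \<open>auto simp del: mor.simps\<close>)
    finally have "mor \<A> [i2, p2] [i, p] (idn \<A> K) (idn \<A> (tgt \<A> p))" by (intro cls1_mor[OF b(1) c(1)]) (use b K in auto)
    then obtain \<theta> where th: "\<theta> \<in> Hom \<A> (tgt \<A> i2) (tgt \<A> i)" "idn \<A> (tgt \<A> p) \<cdot> p2 = p \<cdot> \<theta>" by (rule mor1E)
    hence th: "\<theta> \<in> Hom \<A> (src \<A> p2) (src \<A> p)" "p2 = p \<cdot> \<theta>" using B C b by auto
    have Fi: "cls F \<in> ext t Z (tgt \<A> p)" using F extI by blast
    note P = pair_proj[OF G(1) Fi]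
    \<comment> \<open>Both components of this pair have the same image over
      \<open>tgt \<A> p'\<close>, so the deflation with components \<open>p'\<close> and minus
      \<alpha> kills it, and the pair lifts to the pull-back object.\<close>
    let ?w = "pair Z G (cls F)" and ?X = "biprod (src \<A> p') (tgt \<A> p)"
    have h: "bp1 (src \<A> p') (tgt \<A> p) \<in> Hom \<A> ?X (src \<A> p')" "bp2 (src \<A> p') (tgt \<A> p) \<in> Hom \<A> ?X (tgt \<A> p)"
      "p' \<cdot> bp1 (src \<A> p') (tgt \<A> p) \<in> Hom \<A> ?X (tgt \<A> p')" "neg \<alpha> \<cdot> bp2 (src \<A> p') (tgt \<A> p) \<in> Hom \<A> ?X (tgt \<A> p')"
      "neg \<alpha> \<in> Hom \<A> (tgt \<A> p) (tgt \<A> p')"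
      using C C' a by (auto simp: Hom_iff)
    have "push (cotup p' (neg \<alpha>)) ?w = push (p' \<cdot> bp1 (src \<A> p') (tgt \<A> p) \<boxplus> neg \<alpha> \<cdot> bp2 (src \<A> p') (tgt \<A> p)) ?w"
      using a by (simp add: cotup_def)
    also have "\<dots> = bsum Z (tgt \<A> p') (push \<alpha> (cls F)) (push (neg \<alpha>) (cls F))"
      using push_add[OF P(1) h(3,4) C'(7)] push_push[OF P(1) h(1) pH(2)] push_push[OF P(1) h(2,5)] P G pF C C' by simp
    also have "\<dots> = push (\<alpha> \<boxplus> neg \<alpha>) (cls F)" using push_add[OF Fi al(1) h(5) C'(7)] by simp
    also have "\<dots> = ext_zero t Z (tgt \<A> p')" using a push_zer[OF Fi C'(7)] by simp
    finally have z: "push (cotup p' (neg \<alpha>)) ?w = ext_zero t Z (tgt \<A> (cotup p' (neg \<alpha>)))" using a C' by simp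
    have "src \<A> (cotup p' (neg \<alpha>)) = ?X" "src \<A> (tup \<phi> p2) = src \<A> p2" using a C' b B by (auto simp: Hom_iff)
    then obtain H where H: "H \<in> ext t Z (src \<A> p2)" "?w = push (tup \<phi> p2) H"
      using ex[unfolded ext_exact_middle_def, rule_format, OF _ b(6), of ?w Z] z P(1) by auto
    have t: "tup \<phi> p2 \<in> Hom \<A> (src \<A> p2) ?X" using b B by (auto simp: Hom_iff)
    have "cls F = push (bp2 (src \<A> p') (tgt \<A> p) \<cdot> tup \<phi> p2) H"
      using P(3) H push_push[OF H(1) t h(2)] C C' by simp
    also have "\<dots> = push (p \<cdot> \<theta>) H" using b B C' th by (simp add: Hom_iff)
    also have "\<dots> = push p (push \<theta> H)" using push_push[OF H(1) th(1) pH(1)] C by simp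
    finally show "\<exists>G\<in>ext t Z (src \<A> p). cls F = push p G" using push_in[OF H(1) th(1)] C by blast
  qed
qed

text \<open>Phrased as an equation between products instead of a vanishing product: the zigzag then
  starts at a splice whose tail is visibly liftable, and the equation can be carried to the opposite
  category, where the zero class is built from other chosen data.\<close>

lemma ext_exact_right_aux:
  assumes ex: "ext_exact_middle t" and c: "conf i p" and F: "\<gamma> \<in> ext t Z (tgt \<A> p)" "\<gamma>0 \<in> ext t Z (src \<A> p)"
    and eq: "yprod (cls [i, p]) \<gamma> = yprod (cls [i, p]) (push p \<gamma>0)"
  shows "\<exists>\<gamma>'\<in>ext t Z (src \<A> p). \<gamma> = push p \<gamma>'"
proof -
  note C = conflationD[OF c]
  have pH: "p \<in> Hom \<A> (src \<A> p) (tgt \<A> p)" using C by (simp add: Hom_iff)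
  obtain E where E: "seq t Z (tgt \<A> p) E" "\<gamma> = cls E" using F(1) by (rule extE)
  obtain E0 where E0: "seq t Z (tgt \<A> p) E0" "push p \<gamma>0 = cls E0" using push_in[OF F(2) pH C(7)] by (rule extE)
  let ?K = "src \<A> i"
  \<comment> \<open>The invariant speaks of all ways to write \<open>S\<close> as a splice, because
    its list contains only the composite of a deflation with the next arrow and so need not
    determine the first conflation.\<close>
  let ?P = "\<lambda>S. \<forall>i p F. conf i p \<longrightarrow> src \<A> i = ?K \<longrightarrow> seq t Z (tgt \<A> p) F \<longrightarrow> S = splice_seq \<A> [i, p] F \<longrightarrow>
     (\<exists>G\<in>ext t Z (src \<A> p). cls F = push p G)"
  have s: "seq (Suc t) Z ?K (splice_seq \<A> [i, p] E0)" using seq_splice1[OF c E0(1)] .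
  have t: "0 < t" using seqD(2)[OF E(1)] .
  have eq': "cls (splice_seq \<A> [i, p] E0) = cls (splice_seq \<A> [i, p] E)"
    using eq prod_cls[OF seq_conflation[OF c] E(1)] prod_cls[OF seq_conflation[OF c] E0(1)] unfolding E(2) E0(2) by simp
  have "?P (splice_seq \<A> [i, p] E) \<and> seq (Suc t) Z ?K (splice_seq \<A> [i, p] E)"
  proof (rule cls_induct[OF eq' s])
    show "?P (splice_seq \<A> [i, p] E0)"
    proof (intro allI impI)
      fix i' p' F' assume a: "conf i' p'" "src \<A> i' = ?K" "seq t Z (tgt \<A> p') F'" "splice_seq \<A> [i, p] E0 = splice_seq \<A> [i', p'] F'"
      have "mor \<A> (splice_seq \<A> [i, p] E0) (splice_seq \<A> [i', p'] F') (idn \<A> ?K) (idn \<A> Z)" using seq_mor_id[OF s] a(4) by simp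
      from lift_step[OF ex c a(1) E0(1) a(3) refl a(2) this] show "\<exists>G\<in>ext t Z (src \<A> p'). cls F' = push p' G"
        using F(2) E0(2) by metis
    qed
    fix X Y assume X: "seq (Suc t) Z ?K X" "seq (Suc t) Z ?K Y"
      and m: "mor \<A> X Y (idn \<A> ?K) (idn \<A> Z) \<or> mor \<A> Y X (idn \<A> ?K) (idn \<A> Z)" and ih: "?P X"
    obtain a b G where x: "conf a b" "src \<A> a = ?K" "seq t Z (tgt \<A> b) G" "X = splice_seq \<A> [a, b] G" using seq_split[OF X(1) t] by auto
    have g: "\<exists>H\<in>ext t Z (src \<A> b). cls G = push b H" using ih x by blast
    show "?P Y"
    proof (intro allI impI)
      fix i' p' F' assume y: "conf i' p'" "src \<A> i' = ?K" "seq t Z (tgt \<A> p') F'" "Y = splice_seq \<A> [i', p'] F'"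
      show "\<exists>G\<in>ext t Z (src \<A> p'). cls F' = push p' G"
        using m lift_step[OF ex x(1) y(1) x(3) y(3) x(2) y(2)] lift_step[OF ex y(1) x(1) y(3) x(3) y(2) x(2)] g
        unfolding x(4) y(4) by metis
    qed
  qed
  thus ?thesis using c E by blast
qed

lemma ext_exact_right_zero:
  assumes ex: "ext_exact_middle t" and c: "conf i p" and F: "\<gamma> \<in> ext t Z (tgt \<A> p)"
    and z: "yprod (cls [i, p]) \<gamma> = ext_zero (Suc t) Z (src \<A> i)"
  shows "\<exists>\<gamma>'\<in>ext t Z (src \<A> p). \<gamma> = push p \<gamma>'"
proof -
  note C = conflationD[OF c] and o = ext_obj[OF F]
  have pH: "p \<in> Hom \<A> (src \<A> p) (tgt \<A> p)" using C by (simp add: Hom_iff)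
  show ?thesis
    by (rule ext_exact_right_aux[OF ex c F, of "ext_zero t Z (src \<A> p)"])
      (use z o C push_ext_zero[OF pH] prod_ext_zero_right[OF ext_conflation[OF c], of Z t] zero_in in auto)
qed

lemma ext_split_conflation:
  assumes "\<gamma> \<in> ext (Suc t) Z B" "0 < t"
  obtains i p \<mu> where "conf i p" "src \<A> i = B" "\<mu> \<in> ext t Z (tgt \<A> p)" "\<gamma> = yprod (cls [i, p]) \<mu>"
proof -
  obtain E where E: "seq (Suc t) Z B E" "\<gamma> = cls E" using assms(1) by (rule extE)
  obtain i p F where F: "conf i p" "src \<A> i = B" "seq t Z (tgt \<A> p) F" "E = splice_seq \<A> [i, p] F" using seq_split[OF E(1) assms(2)] by auto
  show thesis by (rule that[OF F(1,2) extI[OF F(3)]]) (use prod_cls[OF seq_conflation[OF F(1)] F(3)] E F in simp)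
qed

text \<open>An alternating induction, which is why the statement was made a predicate on the degree:
  middle exactness in degree t gives exactness at the connecting map in degree t, and this gives
  middle exactness in degree t + 1. Split off the first conflation, \<gamma> = [a,b]\<mu>. Since
  p[a,b] = [a',b'] kills \<mu>, the latter is b'\<nu>; and p kills [a,b]b', which therefore lifts in
  degree one.\<close>

lemma ext_exact_middle: "ext_exact_middle (Suc t)"
proof (induction t)
  case 0
  thus ?case unfolding ext_exact_middle_def using ext1_exact_middle by blast
next
  case (Suc t)
  show ?case unfolding ext_exact_middle_def
  proof (intro allI ballI impI)
    fix i p Z \<gamma> assume g: "\<gamma> \<in> ext (Suc (Suc t)) Z (src \<A> p)" and c: "conf i p" and z: "push p \<gamma> = ext_zero (Suc (Suc t)) Z (tgt \<A> p)"
    note C = conflationD[OF c]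
    obtain a b \<mu> where ab: "conf a b" "src \<A> a = src \<A> p" "\<mu> \<in> ext (Suc t) Z (tgt \<A> b)" "\<gamma> = yprod (cls [a, b]) \<mu>"
      using ext_split_conflation[OF g] by auto
    have pH: "p \<in> Hom \<A> (src \<A> a) (tgt \<A> p)" "i \<in> Hom \<A> (src \<A> i) (src \<A> p)" using C ab by (auto simp: Hom_iff)
    obtain a' b' where ab': "conf a' b'" "src \<A> a' = tgt \<A> p" "tgt \<A> b' = tgt \<A> b" "push p (cls [a, b]) = cls [a', b']"
      using push_conflation[OF ab(1) pH(1) C(7)] by metis
    have k: "cls [a, b] \<in> ext (Suc 0) (tgt \<A> b) (src \<A> a)" by (rule ext_conflation[OF ab(1)])
    have "yprod (cls [a', b']) \<mu> = ext_zero (Suc (Suc t)) Z (src \<A> a')"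
      using prod_push[OF k ab(3) pH(1) C(7)] z ab ab' by simp
    then obtain \<nu> where n: "\<nu> \<in> ext (Suc t) Z (src \<A> b')" "\<mu> = push b' \<nu>"
      using ext_exact_right_zero[OF Suc ab'(1), of \<mu> Z] ab ab' by auto
    note B' = conflationD[OF ab'(1)]
    have bH: "b' \<in> Hom \<A> (src \<A> b') (tgt \<A> b)" using B' ab' by (auto simp: Hom_iff)
    have k': "pull (cls [a, b]) b' \<in> ext (Suc 0) (src \<A> b') (src \<A> p)" using pull_in[OF k bH B'(6)] ab by simp
    have "push p (pull (cls [a, b]) b') = ext_zero (Suc 0) (src \<A> b') (tgt \<A> p)"
      using push_pull[OF k pH(1) bH C(7) B'(6)] pull_own_deflation[OF ab'(1)] ab' by simp
    then obtain \<epsilon> where e: "\<epsilon> \<in> ext (Suc 0) (src \<A> b') (src \<A> i)" "pull (cls [a, b]) b' = push i \<epsilon>"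
      using ext1_exact_middle[OF c k'] by auto
    have "\<gamma> = yprod (pull (cls [a, b]) b') \<nu>" using prod_mid[OF k n(1) bH] ab n by simp
    also have "\<dots> = push i (yprod \<epsilon> \<nu>)" unfolding e(2) by (rule prod_push[OF e(1) n(1) pH(2)]) (use C in auto)
    finally show "\<exists>\<gamma>'\<in>ext (Suc (Suc t)) Z (src \<A> i). \<gamma> = push i \<gamma>'" using prod_in[OF e(1) n(1)] by auto
  qed
qed

lemma exact_middle:
  assumes "conf i p" "\<gamma> \<in> ext t Z (src \<A> p)" "push p \<gamma> = ext_zero t Z (tgt \<A> p)"
  shows "\<exists>\<gamma>'\<in>ext t Z (src \<A> i). \<gamma> = push i \<gamma>'"
proof (cases t)
  case (Suc k)
  show ?thesis using ext_exact_middle[of k] assms unfolding ext_exact_middle_def Suc by blast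
qed (use ext_obj[OF assms(2)] in simp)

lemma exact_right:
  assumes "conf i p" "\<gamma> \<in> ext t Z (tgt \<A> p)" "yprod (cls [i, p]) \<gamma> = ext_zero (Suc t) Z (src \<A> i)"
  shows "\<exists>\<gamma>'\<in>ext t Z (src \<A> p). \<gamma> = push p \<gamma>'"
proof (cases t)
  case (Suc k)
  show ?thesis using ext_exact_right_zero[OF ext_exact_middle[of k] assms(1)] assms unfolding Suc by blast
qed (use ext_obj[OF assms(2)] in simp)

text \<open>The same splitting as for middle exactness, now with \<open>i\<close>: degree-one
  exactness writes [a,b]b' as the pull-back of [i,p] along some \<alpha>, and the push-out of \<nu>
  along \<alpha> is the required class.\<close>

lemma exact_left:
  assumes c: "conf i p" and g: "\<gamma> \<in> ext (Suc t) Z (src \<A> i)" "0 < t" and z: "push i \<gamma> = ext_zero (Suc t) Z (tgt \<A> i)"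
  shows "\<exists>\<gamma>'\<in>ext t Z (tgt \<A> p). \<gamma> = yprod (cls [i, p]) \<gamma>'"
proof -
  note C = conflationD[OF c]
  obtain a b \<mu> where ab: "conf a b" "src \<A> a = src \<A> i" "\<mu> \<in> ext t Z (tgt \<A> b)" "\<gamma> = yprod (cls [a, b]) \<mu>"
    using ext_split_conflation[OF g] by auto
  have pH: "i \<in> Hom \<A> (src \<A> a) (tgt \<A> i)" and iC: "tgt \<A> i \<in> \<C>" using C ab by (auto simp: Hom_iff)
  obtain a' b' where ab': "conf a' b'" "src \<A> a' = tgt \<A> i" "tgt \<A> b' = tgt \<A> b" "push i (cls [a, b]) = cls [a', b']"
    using push_conflation[OF ab(1) pH(1) iC] by metis
  have k: "cls [a, b] \<in> ext (Suc 0) (tgt \<A> b) (src \<A> a)" by (rule ext_conflation[OF ab(1)])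
  have "yprod (cls [a', b']) \<mu> = ext_zero (Suc t) Z (src \<A> a')"
    using prod_push[OF k ab(3) pH(1) iC] z ab ab' by simp
  then obtain \<nu> where n: "\<nu> \<in> ext t Z (src \<A> b')" "\<mu> = push b' \<nu>"
    using exact_right[OF ab'(1), of \<mu> t Z] ab ab' by auto
  note B' = conflationD[OF ab'(1)]
  have bH: "b' \<in> Hom \<A> (src \<A> b') (tgt \<A> b)" using B' ab' by (auto simp: Hom_iff)
  have k': "pull (cls [a, b]) b' \<in> ext (Suc 0) (src \<A> b') (src \<A> i)" using pull_in[OF k bH B'(6)] ab by simp
  have "push i (pull (cls [a, b]) b') = ext_zero (Suc 0) (src \<A> b') (tgt \<A> i)"
    using push_pull[OF k pH(1) bH iC B'(6)] pull_own_deflation[OF ab'(1)] ab' by simp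
  then obtain \<alpha> where e: "\<alpha> \<in> Hom \<A> (src \<A> b') (tgt \<A> p)" "pull (cls [a, b]) b' = pull (cls [i, p]) \<alpha>"
    using ext1_exact_left[OF c k'] by auto
  have "\<gamma> = yprod (pull (cls [a, b]) b') \<nu>" using prod_mid[OF k n(1) bH] ab n by simp
  also have "\<dots> = yprod (cls [i, p]) (push \<alpha> \<nu>)" unfolding e(2) by (rule prod_mid[OF ext_conflation[OF c] n(1) e(1)])
  finally show ?thesis using push_in[OF n(1) e(1) C(7)] by blast
qed

text \<open>The dual of \<open>exact_right\<close>. Zero is represented by \<open>E0\<close> over
  the middle term; its pull-back \<open>E1\<close> along \<open>j\<close> turns the hypothesis into
  an equivalence of two spliced lists, which can be reversed.\<close>

lemma exact_right_op:
  assumes c: "conf j q" and g: "\<gamma> \<in> ext t (src \<A> j) L" and z: "yprod \<gamma> (cls [j, q]) = ext_zero (Suc t) (tgt \<A> q) L"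
  shows "\<exists>\<gamma>'\<in>ext t (tgt \<A> j) L. \<gamma> = pull \<gamma>' j"
proof (cases t)
  case (Suc k)
  interpret O: ext_category "opp \<A>" \<C> by (rule opp_ext_category)
  note C = conflationD[OF c] and o = ext_obj[OF g]
  have jH: "j \<in> Hom \<A> (src \<A> j) (tgt \<A> j)" and jC: "tgt \<A> j \<in> \<C>" using C by (auto simp: Hom_iff)
  obtain E where E: "seq t (src \<A> j) L E" "\<gamma> = cls E" using g by (rule extE)
  obtain E0 where E0: "seq t (tgt \<A> j) L E0" "ext_zero t (tgt \<A> j) L = cls E0" using zero_in[of "tgt \<A> j" L t] o jC by (auto elim: extE)
  obtain E1 where E1: "seq t (src \<A> j) L E1" "pull (cls E0) j = cls E1" using pull_ex[OF E0(1) jH] C by metis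
  have E1z: "cls E1 = ext_zero t (src \<A> j) L"
    unfolding E1(2)[symmetric] E0(2)[symmetric] by (rule pull_ext_zero[OF jH]) (use o jC C in auto)
  have "yprod (cls E1) (cls [j, q]) = ext_zero (t + Suc 0) (tgt \<A> q) L"
    unfolding E1z by (rule prod_ext_zero_left[OF ext_conflation[OF c]]) (use o in auto)
  hence eq: "cls (splice_seq \<A> E [j, q]) = cls (splice_seq \<A> E1 [j, q])"
    using z prod_cls[OF E(1) seq_conflation[OF c]] prod_cls[OF E1(1) seq_conflation[OF c]] E by simp
  have y: "splice_seq (opp \<A>) [q, j] (rev X) = rev (splice_seq \<A> X [j, q])" if "X \<noteq> []" for X
    using that by (cases X rule: rev_cases) (auto simp: splice_seq_def)
  have s: "ext_seq (opp \<A>) \<C> t L (src \<A> j) (rev E)" "ext_seq (opp \<A>) \<C> t L (src \<A> j) (rev E1)" "ext_seq (opp \<A>) \<C> t L (tgt \<A> j) (rev E0)"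
    using E E1 E0 by (simp_all add: seq_rev)
  have cq: "conflation (opp \<A>) \<C> q j" using c by simp
  have p1: "yoneda_prod (opp \<A>) \<C> (ext_class (opp \<A>) \<C> [q, j]) (ext_class (opp \<A>) \<C> (rev X)) = ext_class (opp \<A>) \<C> (rev (splice_seq \<A> X [j, q]))"
    if "ext_seq (opp \<A>) \<C> t L (src \<A> j) (rev X)" for X
    using O.prod_cls[OF O.seq_conflation[OF cq], of t L "rev X"] that O.seqD(7)[OF that] y[of X] by simp
  have p2: "ext_push (opp \<A>) \<C> j (ext_class (opp \<A>) \<C> (rev E0)) = ext_class (opp \<A>) \<C> (rev E1)"
    using opp_push[of j "cls E0"] E1 by (simp add: opp_cls)
  have "\<exists>\<gamma>'\<in>ext_set (opp \<A>) \<C> t L (src (opp \<A>) j). ext_class (opp \<A>) \<C> (rev E) = ext_push (opp \<A>) \<C> j \<gamma>'"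
  proof (rule O.ext_exact_right_aux[OF _ cq])
    show "O.ext_exact_middle t" unfolding Suc by (rule O.ext_exact_middle)
    show "ext_class (opp \<A>) \<C> (rev E) \<in> ext_set (opp \<A>) \<C> t L (tgt (opp \<A>) j)" using O.extI[OF s(1)] by simp
    show "ext_class (opp \<A>) \<C> (rev E0) \<in> ext_set (opp \<A>) \<C> t L (src (opp \<A>) j)" using O.extI[OF s(3)] by simp
    show "yoneda_prod (opp \<A>) \<C> (ext_class (opp \<A>) \<C> [q, j]) (ext_class (opp \<A>) \<C> (rev E)) =
      yoneda_prod (opp \<A>) \<C> (ext_class (opp \<A>) \<C> [q, j]) (ext_push (opp \<A>) \<C> j (ext_class (opp \<A>) \<C> (rev E0)))"
      unfolding p1[OF s(1)] p2 p1[OF s(2)] by (simp only: opp_cls_eq eq)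
  qed
  then obtain G where G: "ext_seq (opp \<A>) \<C> t L (tgt \<A> j) (rev (rev G))" "ext_class (opp \<A>) \<C> (rev E) = ext_push (opp \<A>) \<C> j (ext_class (opp \<A>) \<C> (rev (rev G)))"
    by (auto elim!: O.extE)
  have "seq t (tgt \<A> j) L (rev G)" using G(1) by (simp only: seq_rev)
  moreover have "rev ` cls E = rev ` pull (cls (rev G)) j" using G(2) unfolding opp_cls opp_push .
  hence "cls E = pull (cls (rev G)) j" by (simp add: inj_image_eq_iff)
  ultimately show ?thesis using E extI by blast
qed (use ext_obj[OF g] in simp)

end

section \<open>The composition in an n-Frobenius category\<close>

locale n_frobenius_category = ext_category +
  fixes n :: nat
  assumes n_pos: "1 \<le> n" and frob: "n_frobenius \<A> \<C> n"
begin

abbreviation "np \<equiv> n_projective \<A> \<C> n"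

section \<open>Unit conflations and dimension shifting\<close>

lemma np_C [simp]: "np P \<Longrightarrow> P \<in> \<C>"
  by (simp add: n_projective_def)

lemma np_left:
  assumes "np P" "\<gamma> \<in> ext k P Y" "n < k"
  shows "\<gamma> = ext_zero k P Y"
proof -
  have "carrier (Ext \<A> \<C> k P Y) = {\<one>\<^bsub>Ext \<A> \<C> k P Y\<^esub>}"
    using assms(1,3) ext_obj[OF assms(2)] unfolding n_projective_def by blast
  thus ?thesis using assms(2) by simp
qed

lemma np_right:
  assumes "np P" "\<gamma> \<in> ext k Y P" "n < k"
  shows "\<gamma> = ext_zero k Y P"
proof -
  have "n_injective \<A> \<C> n P" using assms(1) frob by (simp add: n_frobenius_def)
  hence "carrier (Ext \<A> \<C> k Y P) = {\<one>\<^bsub>Ext \<A> \<C> k Y P\<^esub>}"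
    using assms(3) ext_obj[OF assms(2)] unfolding n_injective_def by blast
  thus ?thesis using assms(2) by simp
qed

text \<open>Vanishing is tested on the injective side, which suffices because the two classes
  coincide and which fits the exact sequences in the second variable.\<close>

lemma npI:
  assumes P: "P \<in> \<C>" and *: "\<And>k Y \<gamma>. \<lbrakk>n < k; Y \<in> \<C>; \<gamma> \<in> ext k Y P\<rbrakk> \<Longrightarrow> \<gamma> = ext_zero k Y P"
  shows "np P"
proof -
  have "carrier (Ext \<A> \<C> k Y P) = {\<one>\<^bsub>Ext \<A> \<C> k Y P\<^esub>}" if "n < k" "Y \<in> \<C>" for k Y
  proof -
    have "\<one>\<^bsub>Ext \<A> \<C> k Y P\<^esub> \<in> carrier (Ext \<A> \<C> k Y P)" using zero_in[OF that(2) P, of k] that(1) by simp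
    moreover have "\<gamma> = \<one>\<^bsub>Ext \<A> \<C> k Y P\<^esub>" if "\<gamma> \<in> carrier (Ext \<A> \<C> k Y P)" for \<gamma>
      using *[OF \<open>n < k\<close> \<open>Y \<in> \<C>\<close>, of \<gamma>] that by simp
    ultimately show ?thesis by blast
  qed
  hence "n_injective \<A> \<C> n P" unfolding n_injective_def using P by blast
  thus ?thesis using frob by (simp add: n_frobenius_def)
qed

lemma enough_injectives:
  assumes "A \<in> \<C>"
  obtains i p where "conf i p" "src \<A> i = A" "np (src \<A> p)"
proof -
  obtain i where "inflation \<A> \<C> i" "src \<A> i = A" "n_injective \<A> \<C> n (tgt \<A> i)"
    using frob assms unfolding n_frobenius_def by blast
  moreover then obtain p where p: "conf i p" by (auto simp: inflation_def)
  ultimately show thesis using that[OF p] conflationD(4)[OF p] frob by (simp add: n_frobenius_def)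
qed

lemma np_extension:
  assumes c: "conf i p" and P: "np (src \<A> i)" "np (tgt \<A> p)"
  shows "np (src \<A> p)"
proof (rule npI)
  note C = conflationD[OF c]
  have H: "p \<in> Hom \<A> (src \<A> p) (tgt \<A> p)" "i \<in> Hom \<A> (src \<A> i) (src \<A> p)" using C by (auto simp: Hom_iff)
  fix k Y \<gamma> assume g: "n < k" "Y \<in> \<C>" "\<gamma> \<in> ext k Y (src \<A> p)"
  have "push p \<gamma> = ext_zero k Y (tgt \<A> p)" using np_right[OF P(2) push_in[OF g(3) H(1)] g(1)] C by simp
  then obtain \<gamma>' where g': "\<gamma>' \<in> ext k Y (src \<A> i)" "\<gamma> = push i \<gamma>'" using exact_middle[OF c g(3)] by blast
  show "\<gamma> = ext_zero k Y (src \<A> p)" unfolding g'(2) np_right[OF P(1) g'(1) g(1)]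
    by (rule push_ext_zero[OF H(2)]) (use C g in auto)
qed (use conflationD[OF c] in simp)

text \<open>The length varies while the bound n in \<open>np\<close> stays fixed, as inductions on
  the length need; \<open>unit_conflation\<close> ties the two together.\<close>

definition "unit_seq t A B E \<longleftrightarrow> seq t A B E \<and> (\<forall>d\<in>set (butlast E). np (tgt \<A> d))"

lemma unit_conflation_unit_seq: "unit_conflation \<A> \<C> n A B E \<longleftrightarrow> unit_seq n A B E"
  by (simp add: unit_conflation_def unit_seq_def)

lemma unit_seq_seq: "unit_seq t A B E \<Longrightarrow> seq t A B E"
  by (simp add: unit_seq_def)

lemma unit_seq_single: "unit_seq (Suc 0) A B E \<longleftrightarrow> (\<exists>i p. E = [i, p] \<and> conf i p \<and> src \<A> i = B \<and> tgt \<A> p = A \<and> np (src \<A> p))"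
  using conflationD(4) by (auto simp: unit_seq_def seq_single)

lemma unit_seq_splice:
  assumes c: "conf i p" "np (src \<A> p)" and F: "seq t A (tgt \<A> p) F"
  shows "unit_seq (Suc t) A (src \<A> i) (splice_seq \<A> [i, p] F) \<longleftrightarrow> unit_seq t A (tgt \<A> p) F"
proof -
  obtain j d fs where f: "F = j # d # fs" using seqD(11)[OF F] by auto
  have "src \<A> j = tgt \<A> p" "j \<in> arr \<A>" using seqD(3)[OF F] f by auto
  thus ?thesis using seq_splice1[OF c(1) F] F c conflationD[OF c(1)] f by (simp add: unit_seq_def)
qed

lemma unit_seq_split:
  assumes E: "unit_seq (Suc t) A B E" "0 < t"
  obtains i p F where "conf i p" "src \<A> i = B" "np (src \<A> p)" "unit_seq t A (tgt \<A> p) F" "E = splice_seq \<A> [i, p] F"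
proof -
  obtain i p F where F: "conf i p" "src \<A> i = B" "seq t A (tgt \<A> p) F" "E = splice_seq \<A> [i, p] F"
    using seq_split[OF unit_seq_seq[OF E(1)] E(2)] by auto
  obtain j d fs where f: "F = j # d # fs" using seqD(11)[OF F(3)] by auto
  have np: "np (src \<A> p)" using E(1) conflationD(4)[OF F(1)] f unfolding unit_seq_def F(4) by simp
  show thesis by (rule that[OF F(1,2) np _ F(4)]) (use unit_seq_splice[OF F(1) np F(3)] E F in simp)
qed

lemma unit_seq_prod:
  assumes "conf i p" "src \<A> i = B" "unit_seq t A (tgt \<A> p) F" "y \<in> ext k Z A"
  shows "yprod (cls (splice_seq \<A> [i, p] F)) y = yprod (cls [i, p]) (yprod (cls F) y)" "yprod (cls F) y \<in> ext (t + k) Z (tgt \<A> p)"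
proof -
  note s = seq_conflation[OF assms(1)] unit_seq_seq[OF assms(3)]
  show "yprod (cls (splice_seq \<A> [i, p] F)) y = yprod (cls [i, p]) (yprod (cls F) y)"
    using prod_assoc[OF extI[OF s(1)] extI[OF s(2)] assms(4)] prod_cls[OF s] by simp
  show "yprod (cls F) y \<in> ext (t + k) Z (tgt \<A> p)" by (rule prod_in[OF extI[OF s(2)] assms(4)])
qed

text \<open>By exactness \<open>y\<close> comes from an Ext group into the middle term, which is
  n-injective, and such groups vanish in degrees above n.\<close>

lemma shift_inj1:
  assumes c: "conf i p" "np (src \<A> p)" and y: "y \<in> ext k Z (tgt \<A> p)" "n < k" and z: "yprod (cls [i, p]) y = ext_zero (Suc k) Z (src \<A> i)"
  shows "y = ext_zero k Z (tgt \<A> p)"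
proof -
  note C = conflationD[OF c(1)] and o = ext_obj[OF y(1)]
  obtain w where w: "w \<in> ext k Z (src \<A> p)" "y = push p w" using exact_right[OF c(1) y(1) z] by blast
  show ?thesis unfolding w(2) np_right[OF c(2) w(1) y(2)]
    by (rule push_ext_zero) (use C o in \<open>auto simp: Hom_iff\<close>)
qed

lemma shift_inj0:
  "\<lbrakk>unit_seq t A B E; y \<in> ext k Z A; n < k; yprod (cls E) y = ext_zero (t + k) Z B\<rbrakk> \<Longrightarrow> y = ext_zero k Z A"
proof (induction t arbitrary: B E)
  case 0
  thus ?case using seqD(2) unit_seq_seq by blast
next
  case (Suc t)
  show ?case
  proof (cases "t = 0")
    case True
    thus ?thesis using Suc shift_inj1 by (auto simp: unit_seq_single)
  next
    case False
    obtain i p F where F: "conf i p" "src \<A> i = B" "np (src \<A> p)" "unit_seq t A (tgt \<A> p) F" "E = splice_seq \<A> [i, p] F"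
      using unit_seq_split[OF Suc(2)] False by auto
    note p = unit_seq_prod[OF F(1,2,4) Suc(3)]
    have "yprod (cls F) y = ext_zero (t + k) Z (tgt \<A> p)"
      by (rule shift_inj1[OF F(1,3) p(2)]) (use Suc(4,5) p F in auto)
    thus ?thesis using Suc(1)[OF F(4) Suc(3,4)] by simp
  qed
qed

text \<open>Conflations are divided out one at a time: the push-out of the class along
  \<open>i\<close> lands in an n-injective in degree above n, hence vanishes, and
  \<open>exact_left\<close> applies.\<close>

lemma shift_surj:
  "\<lbrakk>unit_seq t A B E; w \<in> ext (t + k) Z B; n < k\<rbrakk> \<Longrightarrow> \<exists>y\<in>ext k Z A. w = yprod (cls E) y"
proof (induction t arbitrary: B E w)
  case 0
  thus ?case using seqD(2) unit_seq_seq by blast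
next
  case (Suc t)
  have *: "\<exists>y\<in>ext (t + k) Z (tgt \<A> p). w = yprod (cls [i, p]) y" if c: "conf i p" "src \<A> i = B" "np (src \<A> p)" for i p
  proof -
    note C = conflationD[OF c(1)]
    have w: "w \<in> ext (Suc (t + k)) Z (src \<A> i)" using Suc(3) c by simp
    have "push i w \<in> ext (Suc (t + k)) Z (src \<A> p)" by (rule push_in[OF w]) (use C in \<open>auto simp: Hom_iff\<close>)
    hence "push i w = ext_zero (Suc (t + k)) Z (tgt \<A> i)" using np_right[OF c(3)] Suc(4) C by simp
    thus ?thesis using exact_left[OF c(1) w] Suc(4) by auto
  qed
  show ?case
  proof (cases "t = 0")
    case True
    thus ?thesis using Suc(2) * by (auto simp: unit_seq_single)
  next
    case False
    obtain i p F where F: "conf i p" "src \<A> i = B" "np (src \<A> p)" "unit_seq t A (tgt \<A> p) F" "E = splice_seq \<A> [i, p] F"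
      using unit_seq_split[OF Suc(2)] False by auto
    obtain v where v: "v \<in> ext (t + k) Z (tgt \<A> p)" "w = yprod (cls [i, p]) v" using *[OF F(1-3)] by blast
    obtain y where y: "y \<in> ext k Z A" "v = yprod (cls F) y" using Suc(1)[OF F(4) v(1) Suc(4)] by blast
    show ?thesis using y v unit_seq_prod(1)[OF F(1,2,4) y(1)] F by auto
  qed
qed

lemma shift_inj:
  assumes E: "unit_seq t A B E" and y: "y \<in> ext k Z A" "y' \<in> ext k Z A" "n < k" and eq: "yprod (cls E) y = yprod (cls E) y'"
  shows "y = y'"
proof -
  have E': "cls E \<in> ext t A B" using E unit_seq_seq extI by blast
  have Z: "Z \<in> \<C>" "0 < k" using ext_obj[OF y(1)] y by auto
  interpret group_hom "Ext \<A> \<C> k Z A" "Ext \<A> \<C> (t + k) Z B" "yprod (cls E)" by (rule prod_hom_right[OF E' Z])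
  have "inj_on (yprod (cls E)) (carrier (Ext \<A> \<C> k Z A))"
    unfolding inj_on_one_iff using shift_inj0[OF E _ y(3)] by simp
  thus ?thesis using y eq by (auto simp: inj_on_def)
qed

text \<open>Multiplication by \<open>E'\<close> is push-out along \<open>a\<close> followed by
  multiplication by \<open>E\<close>. Two of these three maps are bijective, hence so is the third.
  All degrees above n are covered, since the n-projectivity of a cokernel will need them
  all.\<close>

lemma push_between_units:
  assumes E: "unit_seq t A B E" and E': "unit_seq t X B E'" and a: "a \<in> Hom \<A> X A" "pull (cls E) a = cls E'" and k: "n < k"
  shows "\<lbrakk>y \<in> ext k Z X; y' \<in> ext k Z X; push a y = push a y'\<rbrakk> \<Longrightarrow> y = y'"
    "x \<in> ext k Z A \<Longrightarrow> \<exists>y\<in>ext k Z X. push a y = x"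
proof -
  note s = extI[OF unit_seq_seq[OF E]]
  have A: "A \<in> \<C>" using ext_obj[OF s] by simp
  have m: "yprod (cls E') y = yprod (cls E) (push a y)" if "y \<in> ext k Z X" for y
    using prod_mid[OF s that a(1)] a(2) by simp
  show "y = y'" if "y \<in> ext k Z X" "y' \<in> ext k Z X" "push a y = push a y'"
    by (rule shift_inj[OF E' that(1,2) k]) (use m that in simp)
  assume x: "x \<in> ext k Z A"
  obtain y where y: "y \<in> ext k Z X" "yprod (cls E) x = yprod (cls E') y"
    using shift_surj[OF E' prod_in[OF s x] k] by blast
  have "push a y = x"
    by (rule shift_inj[OF E push_in[OF y(1) a(1) A] x k]) (use m[OF y(1)] y in simp)
  thus "\<exists>y\<in>ext k Z X. push a y = x" using y by blast
qed

text \<open>For a co-angled pair this yields quasi-invertibility from the fact that the sequences at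
  both ends are units.\<close>

lemma quasi_invertible_between_units:
  assumes E: "unit_seq t A B E" and E': "unit_seq t X B E'" and a: "a \<in> Hom \<A> X A" "pull (cls E) a = cls E'"
  shows "quasi_invertible \<A> \<C> n a"
proof -
  have AX: "A \<in> \<C>" "X \<in> \<C>" using seqD(4) unit_seq_seq E E' by blast+
  have a': "a \<in> arr \<A>" "src \<A> a = X" "tgt \<A> a = A" using a by (auto simp: Hom_iff)
  have "push a \<in> iso (Ext \<A> \<C> (n + 1) Z X) (Ext \<A> \<C> (n + 1) Z A)" if Z: "Z \<in> \<C>" for Z
  proof -
    interpret group_hom "Ext \<A> \<C> (n + 1) Z X" "Ext \<A> \<C> (n + 1) Z A" "push a" by (rule push_hom[OF a(1) Z AX(2,1)]) simp
    note p = push_between_units[OF E E' a, of "n + 1" _ Z]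
    have "x = ext_zero (n + 1) Z X" if x: "x \<in> ext (n + 1) Z X" "push a x = ext_zero (n + 1) Z A" for x
      by (rule p(1)[OF _ x(1)]) (use x push_ext_zero[OF a(1) Z AX(2,1)] zero_in Z AX in auto)
    moreover have "ext (n + 1) Z A \<subseteq> push a ` ext (n + 1) Z X" using p(2) by fastforce
    ultimately show ?thesis unfolding iso_iff by simp
  qed
  thus ?thesis using a' AX by (simp add: quasi_invertible_def)
qed

section \<open>The subgroup \<P> as the kernel of multiplication by a class\<close>

lemma prod_proj_ext:
  assumes z: "\<zeta> \<in> proj_ext \<A> \<C> n X L" and y: "y \<in> ext k Z X" "n < k"
  shows "yprod \<zeta> y = ext_zero (n + k) Z L"
proof -
  obtain \<eta> h P where e: "\<zeta> = pull \<eta> h" "np P" "h \<in> Hom \<A> X P" "\<eta> \<in> ext n P L"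
    using z by (auto simp: proj_ext_def)
  \<comment> \<open>The n-projective \<open>P\<close> is also n-injective, so every class into it of
    degree above n vanishes.\<close>
  have "push h y = ext_zero k Z P" using np_right[OF e(2) push_in[OF y(1) e(3)] y(2)] e(2) by simp
  thus ?thesis using prod_mid[OF e(4) y(1) e(3)] prod_ext_zero_right[OF e(4), of Z k] e(1) ext_obj[OF y(1)] by simp
qed

text \<open>The class \<open>\<mu>\<close> is spliced from inflations into n-injectives, starting at \<open>X\<close>.\<close>

lemma resolution:
  assumes X: "X \<in> \<C>"
  shows "\<exists>Z. \<exists>\<mu>\<in>ext (Suc k) Z X. \<forall>L. \<forall>\<zeta>\<in>ext n X L. yprod \<zeta> \<mu> = ext_zero (n + Suc k) Z L \<longrightarrow> \<zeta> \<in> proj_ext \<A> \<C> n X L"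
proof (induction k)
  case 0
  obtain j q where j: "conf j q" "src \<A> j = X" "np (src \<A> q)" using enough_injectives[OF X] by blast
  note C = conflationD[OF j(1)]
  have "\<zeta> \<in> proj_ext \<A> \<C> n X L" if z: "\<zeta> \<in> ext n X L" "yprod \<zeta> (cls [j, q]) = ext_zero (n + Suc 0) (tgt \<A> q) L" for L \<zeta>
  proof -
    \<comment> \<open>Here the degree is exactly n: the class extends to the n-injective, where Ext
      need not vanish. The classes that extend in this way are elements of \<P> by definition, since
      the n-injective is n-projective.\<close>
    obtain \<zeta>' where "\<zeta>' \<in> ext n (src \<A> q) L" "\<zeta> = pull \<zeta>' j"
      using exact_right_op[OF j(1), of \<zeta> n L] z j C by auto
    moreover have "j \<in> Hom \<A> X (src \<A> q)" using j C by (simp add: Hom_iff)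
    ultimately show ?thesis using j(3) unfolding proj_ext_def by auto
  qed
  moreover have "cls [j, q] \<in> ext (Suc 0) (tgt \<A> q) X" using ext_conflation[OF j(1)] j(2) by simp
  ultimately show ?case by blast
next
  case (Suc k)
  then obtain Z \<mu> where m: "\<mu> \<in> ext (Suc k) Z X"
    and ih: "\<And>L \<zeta>. \<zeta>\<in>ext n X L \<Longrightarrow> yprod \<zeta> \<mu> = ext_zero (n + Suc k) Z L \<Longrightarrow> \<zeta> \<in> proj_ext \<A> \<C> n X L" by blast
  have Z: "Z \<in> \<C>" using ext_obj[OF m] by simp
  obtain j q where j: "conf j q" "src \<A> j = Z" "np (src \<A> q)" using enough_injectives[OF Z] by blast
  note C = conflationD[OF j(1)]
  have jH: "j \<in> Hom \<A> Z (tgt \<A> j)" using C j by (simp add: Hom_iff)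
  have je: "cls [j, q] \<in> ext (Suc 0) (tgt \<A> q) Z" using ext_conflation[OF j(1)] j(2) by simp
  let ?m = "yprod \<mu> (cls [j, q])"
  have mi: "?m \<in> ext (Suc (Suc k)) (tgt \<A> q) X" using prod_in[OF m je] by simp
  have "\<zeta> \<in> proj_ext \<A> \<C> n X L" if z: "\<zeta> \<in> ext n X L" "yprod \<zeta> ?m = ext_zero (n + Suc (Suc k)) (tgt \<A> q) L" for L \<zeta>
  proof (rule ih[OF z(1)])
    note o = ext_obj[OF z(1)]
    have zm: "yprod \<zeta> \<mu> \<in> ext (n + Suc k) (src \<A> j) L" using prod_in[OF z(1) m] j by simp
    have "yprod (yprod \<zeta> \<mu>) (cls [j, q]) = ext_zero (Suc (n + Suc k)) (tgt \<A> q) L" using prod_assoc[OF z(1) m je] z(2) by simp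
    then obtain \<xi> where x: "\<xi> \<in> ext (n + Suc k) (tgt \<A> j) L" "yprod \<zeta> \<mu> = pull \<xi> j" using exact_right_op[OF j(1) zm] by blast
    \<comment> \<open>From the second inflation on the degree exceeds n, so the extension to the
      n-injective vanishes and the kernel does not grow.\<close>
    have "\<xi> = ext_zero (n + Suc k) (tgt \<A> j) L" by (rule np_left[OF _ x(1)]) (use j C in auto)
    thus "yprod \<zeta> \<mu> = ext_zero (n + Suc k) Z L" using x pull_ext_zero[OF jH] o Z j C by simp
  qed
  thus ?case using mi by blast
qed

lemma prod_eq_if_diff_proj_ext:
  assumes z: "\<zeta> \<in> ext n X L" "\<zeta>' \<in> ext n X L" and y: "y \<in> ext k Z X" "n < k"
    and p: "\<zeta> \<otimes>\<^bsub>Ext \<A> \<C> n X L\<^esub> inv\<^bsub>Ext \<A> \<C> n X L\<^esub> \<zeta>' \<in> proj_ext \<A> \<C> n X L"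
  shows "yprod \<zeta> y = yprod \<zeta>' y"
proof -
  have L: "L \<in> \<C>" using ext_obj[OF z(1)] by simp
  let ?G = "Ext \<A> \<C> n X L" and ?H = "Ext \<A> \<C> (n + k) Z L"
  interpret group_hom ?G ?H "\<lambda>\<zeta>. yprod \<zeta> y" by (rule prod_hom_left[OF y(1) L]) (use n_pos in simp)
  let ?p = "\<zeta> \<otimes>\<^bsub>?G\<^esub> inv\<^bsub>?G\<^esub> \<zeta>'"
  have c: "\<zeta> \<in> carrier ?G" "\<zeta>' \<in> carrier ?G" using z by auto
  have pc: "?p \<in> carrier ?G" using c G.m_closed G.inv_closed by metis
  have "\<zeta> = ?p \<otimes>\<^bsub>?G\<^esub> \<zeta>'" using c G.m_assoc G.l_inv G.r_one G.inv_closed by metis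
  hence "yprod \<zeta> y = yprod ?p y \<otimes>\<^bsub>?H\<^esub> yprod \<zeta>' y" using hom_mult[OF pc c(2)] by metis
  also have "yprod ?p y = \<one>\<^bsub>?H\<^esub>" using prod_proj_ext[OF p y] by simp
  finally show ?thesis using H.l_one[OF hom_closed[OF c(2)]] by simp
qed

definition "detects Z \<mu> X \<longleftrightarrow> \<mu> \<in> ext (n + 1) Z X \<and>
   (\<forall>L. \<forall>\<zeta>\<in>ext n X L. yprod \<zeta> \<mu> = ext_zero (n + (n + 1)) Z L \<longrightarrow> \<zeta> \<in> proj_ext \<A> \<C> n X L)"

lemma detects_ex: "X \<in> \<C> \<Longrightarrow> \<exists>Z \<mu>. detects Z \<mu> X"
  using resolution[of X n] by (auto simp: detects_def)

lemma proj_ext_subset: "L \<in> \<C> \<Longrightarrow> X \<in> \<C> \<Longrightarrow> proj_ext \<A> \<C> n X L \<subseteq> ext n X L"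
  by (auto simp: proj_ext_def intro: pull_in)

text \<open>This is what shows \<P> to be a subgroup; its elements \<eta>h involve varying
  n-projectives, so closure under sums is not evident from the definition.\<close>

lemma proj_ext_kernel:
  assumes d: "detects Z \<mu> X" and L: "L \<in> \<C>"
  shows "proj_ext \<A> \<C> n X L = kernel (Ext \<A> \<C> n X L) (Ext \<A> \<C> (n + (n + 1)) Z L) (\<lambda>\<zeta>. yprod \<zeta> \<mu>)"
proof -
  have m: "\<mu> \<in> ext (n + 1) Z X" using d by (simp add: detects_def)
  show ?thesis using d prod_proj_ext[OF _ m, of _ L] proj_ext_subset[OF L] ext_obj[OF m]
    unfolding kernel_def detects_def by auto
qed

lemma prod_detect_hom:
  assumes d: "detects Z \<mu> X" and L: "L \<in> \<C>"
  shows "group_hom (Ext \<A> \<C> n X L) (Ext \<A> \<C> (n + (n + 1)) Z L) (\<lambda>\<zeta>. yprod \<zeta> \<mu>)"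
  using d L n_pos by (intro prod_hom_left) (auto simp: detects_def)

lemma diff_proj_ext_iff:
  assumes d: "detects Z \<mu> X" and z: "\<zeta> \<in> ext n X L" "\<zeta>' \<in> ext n X L"
  shows "\<zeta> \<otimes>\<^bsub>Ext \<A> \<C> n X L\<^esub> inv\<^bsub>Ext \<A> \<C> n X L\<^esub> \<zeta>' \<in> proj_ext \<A> \<C> n X L \<longleftrightarrow> yprod \<zeta> \<mu> = yprod \<zeta>' \<mu>"
proof -
  have L: "L \<in> \<C>" using ext_obj[OF z(1)] by simp
  let ?G = "Ext \<A> \<C> n X L" and ?H = "Ext \<A> \<C> (n + (n + 1)) Z L" and ?h = "\<lambda>\<zeta>. yprod \<zeta> \<mu>"
  interpret group_hom ?G ?H ?h by (rule prod_detect_hom[OF d L])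
  have c: "\<zeta> \<in> carrier ?G" "\<zeta>' \<in> carrier ?G" "?h \<zeta> \<in> carrier ?H" "?h \<zeta>' \<in> carrier ?H" using z hom_closed by auto
  have "\<zeta> \<otimes>\<^bsub>?G\<^esub> inv\<^bsub>?G\<^esub> \<zeta>' \<in> proj_ext \<A> \<C> n X L \<longleftrightarrow> ?h (\<zeta> \<otimes>\<^bsub>?G\<^esub> inv\<^bsub>?G\<^esub> \<zeta>') = \<one>\<^bsub>?H\<^esub>"
    unfolding proj_ext_kernel[OF d L] kernel_def using G.m_closed[OF c(1) G.inv_closed[OF c(2)]] by (simp del: carrier_Ext mult_Ext one_Ext)
  also have "\<dots> \<longleftrightarrow> ?h \<zeta> \<otimes>\<^bsub>?H\<^esub> inv\<^bsub>?H\<^esub> (?h \<zeta>') = \<one>\<^bsub>?H\<^esub>"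
    using hom_mult[OF c(1) G.inv_closed[OF c(2)]] hom_inv[OF c(2)] by (simp del: carrier_Ext mult_Ext one_Ext)
  also have "\<dots> \<longleftrightarrow> ?h \<zeta> = ?h \<zeta>'" using c(3,4) H.right_cancel H.inv_closed H.r_inv by (metis H.inv_equality H.inv_inv)
  finally show ?thesis .
qed

text \<open>All comparisons in the quotient by \<P> are reduced to comparing single products with
  \<mu>.\<close>

lemma stable_class_eq_iff:
  assumes d: "detects Z \<mu> X" and z: "\<zeta> \<in> ext n X L" "\<zeta>' \<in> ext n X L"
  shows "stable_class \<A> \<C> n X L \<zeta> = stable_class \<A> \<C> n X L \<zeta>' \<longleftrightarrow> yprod \<zeta> \<mu> = yprod \<zeta>' \<mu>"
proof -
  have L: "L \<in> \<C>" using ext_obj[OF z(1)] by simp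
  let ?G = "Ext \<A> \<C> n X L" and ?H = "Ext \<A> \<C> (n + (n + 1)) Z L" and ?h = "\<lambda>\<zeta>. yprod \<zeta> \<mu>" and ?P = "proj_ext \<A> \<C> n X L"
  interpret group_hom ?G ?H ?h by (rule prod_detect_hom[OF d L])
  have c: "\<zeta> \<in> carrier ?G" "\<zeta>' \<in> carrier ?G" using z by auto
  have P: "subgroup ?P ?G" unfolding proj_ext_kernel[OF d L] by (rule subgroup_kernel)
  have "?P #>\<^bsub>?G\<^esub> \<zeta> = ?P #>\<^bsub>?G\<^esub> \<zeta>' \<longleftrightarrow> \<zeta> \<in> ?P #>\<^bsub>?G\<^esub> \<zeta>'"
    using G.repr_independence[OF _ c(2) P, of \<zeta>] G.repr_independenceD[OF P c(1), of \<zeta>'] by metis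
  also have "\<dots> \<longleftrightarrow> \<zeta> \<otimes>\<^bsub>?G\<^esub> inv\<^bsub>?G\<^esub> \<zeta>' \<in> ?P"
  proof
    assume "\<zeta> \<in> ?P #>\<^bsub>?G\<^esub> \<zeta>'"
    then obtain p where p: "p \<in> ?P" "\<zeta> = p \<otimes>\<^bsub>?G\<^esub> \<zeta>'" unfolding r_coset_def by blast
    hence "p \<in> carrier ?G" using subgroup.subset[OF P] by blast
    hence "\<zeta> \<otimes>\<^bsub>?G\<^esub> inv\<^bsub>?G\<^esub> \<zeta>' = p" unfolding p(2) using c(2) G.m_assoc G.r_inv G.r_one G.inv_closed by metis
    thus "\<zeta> \<otimes>\<^bsub>?G\<^esub> inv\<^bsub>?G\<^esub> \<zeta>' \<in> ?P" using p by simp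
  next
    assume a: "\<zeta> \<otimes>\<^bsub>?G\<^esub> inv\<^bsub>?G\<^esub> \<zeta>' \<in> ?P"
    have "\<zeta> = (\<zeta> \<otimes>\<^bsub>?G\<^esub> inv\<^bsub>?G\<^esub> \<zeta>') \<otimes>\<^bsub>?G\<^esub> \<zeta>'" using c G.m_assoc G.l_inv G.r_one G.inv_closed by metis
    thus "\<zeta> \<in> ?P #>\<^bsub>?G\<^esub> \<zeta>'" unfolding r_coset_def using a by blast
  qed
  finally show ?thesis unfolding stable_class_def diff_proj_ext_iff[OF d z] .
qed

section \<open>Uniqueness of the value of the composition\<close>

lemma carrier_stable_Ext: "carrier (stable_Ext \<A> \<C> n X L) = stable_class \<A> \<C> n X L ` ext n X L"
  by (auto simp: stable_Ext_def FactGroup_def RCOSETS_def stable_class_def)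

lemma composition_value:
  assumes d: "detects Z \<mu> M" and b: "\<beta> \<in> ext n N L"
    and rf: "right_unit_factorization \<A> \<C> n M B \<gamma> A \<delta> f" and cp: "co_angled_pair \<A> \<C> n B N \<delta>N A \<delta> X a b"
    and pi: "pull_inverse \<A> \<C> n X A L (pull \<beta> a) b \<epsilon>"
  shows "pull \<epsilon> f \<in> ext n M L \<and> (\<exists>y\<in>ext (n + 1) Z N. yprod \<delta>N y = yprod \<gamma> \<mu> \<and> yprod (pull \<epsilon> f) \<mu> = yprod \<beta> y)"
proof -
  have A: "A \<in> \<C>" and f: "f \<in> Hom \<A> M A" and g: "\<gamma> = pull \<delta> f" and de: "\<delta> \<in> unit_ext \<A> \<C> n A B"
    using rf by (auto simp: right_unit_factorization_def)
  have dN: "\<delta>N \<in> unit_ext \<A> \<C> n N B" and ab: "a \<in> Hom \<A> X N" "b \<in> Hom \<A> X A" and q: "quasi_invertible \<A> \<C> n b"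
    and eq: "pull \<delta>N a = pull \<delta> b" using cp by (auto simp: co_angled_pair_def)
  have e: "\<epsilon> \<in> ext n A L" and e': "pull \<beta> a \<otimes>\<^bsub>Ext \<A> \<C> n X L\<^esub> inv\<^bsub>Ext \<A> \<C> n X L\<^esub> (pull \<epsilon> b) \<in> proj_ext \<A> \<C> n X L"
    using pi by (auto simp: pull_inverse_def)
  have m: "\<mu> \<in> ext (n + 1) Z M" using d by (simp add: detects_def)
  have MZ: "M \<in> \<C>" "Z \<in> \<C>" using ext_obj[OF m] by auto
  have ue: "\<delta> \<in> ext n A B" "\<delta>N \<in> ext n N B"
    using de dN by (auto simp: unit_ext_def unit_conflation_unit_seq intro!: extI unit_seq_seq)
  have N: "N \<in> \<C>" "L \<in> \<C>" using ext_obj[OF b] by auto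
  have bs: "src \<A> b = X" "tgt \<A> b = A" and X: "X \<in> \<C>" using q ab by (auto simp: Hom_iff quasi_invertible_def)
  have "push b \<in> iso (Ext \<A> \<C> (n + 1) Z X) (Ext \<A> \<C> (n + 1) Z A)" using q MZ bs unfolding quasi_invertible_def by metis
  hence bij: "push b ` ext (n + 1) Z X = ext (n + 1) Z A" by (auto simp: iso_def bij_betw_def)
  have fm: "push f \<mu> \<in> ext (n + 1) Z A" by (rule push_in[OF m f A])
  then obtain x where x: "x \<in> ext (n + 1) Z X" "push b x = push f \<mu>" using bij by (metis imageE)
  have y: "push a x \<in> ext (n + 1) Z N" by (rule push_in[OF x(1) ab(1) N(1)])
  have "yprod \<delta>N (push a x) = yprod (pull \<delta> b) x" using prod_mid[OF ue(2) x(1) ab(1)] eq by simp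
  also have "\<dots> = yprod \<delta> (push f \<mu>)" using prod_mid[OF ue(1) x(1) ab(2)] x by simp
  also have "\<dots> = yprod \<gamma> \<mu>" using prod_mid[OF ue(1) m f] g by simp
  finally have 1: "yprod \<delta>N (push a x) = yprod \<gamma> \<mu>" .
  have pb: "pull \<beta> a \<in> ext n X L" "pull \<epsilon> b \<in> ext n X L" using pull_in b e ab X by blast+
  have "yprod (pull \<beta> a) x = yprod (pull \<epsilon> b) x"
    by (rule prod_eq_if_diff_proj_ext[OF pb x(1) _ e']) simp
  moreover have "yprod (pull \<epsilon> f) \<mu> = yprod (pull \<epsilon> b) x"
    using prod_mid[OF e m f] prod_mid[OF e x(1) ab(2)] x by simp
  ultimately have "yprod (pull \<epsilon> f) \<mu> = yprod \<beta> (push a x)" using prod_mid[OF b x(1) ab(1)] by simp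
  thus ?thesis using 1 y pull_in[OF e f MZ(1)] by blast
qed

lemma composition_values_unique:
  assumes g: "\<gamma> \<in> ext n M B" "\<gamma>' \<in> ext n M B" and b: "\<beta> \<in> ext n N L" "\<beta>' \<in> ext n N L"
    and dN: "\<delta>N \<in> unit_ext \<A> \<C> n N B"
    and eq: "stable_class \<A> \<C> n M B \<gamma> = stable_class \<A> \<C> n M B \<gamma>'" "stable_class \<A> \<C> n N L \<beta> = stable_class \<A> \<C> n N L \<beta>'"
    and v: "v \<in> composition_values \<A> \<C> n M N B L \<delta>N \<beta> \<gamma>" "v' \<in> composition_values \<A> \<C> n M N B L \<delta>N \<beta>' \<gamma>'"
  shows "v = v' \<and> v \<in> carrier (stable_Ext \<A> \<C> n M L)"
proof -
  have M: "M \<in> \<C>" "N \<in> \<C>" using ext_obj g b by blast+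
  obtain Z \<mu> where d: "detects Z \<mu> M" using detects_ex[OF M(1)] by blast
  have *: "\<exists>w\<in>ext n M L. v = stable_class \<A> \<C> n M L w \<and> (\<exists>y\<in>ext (n + 1) Z N. yprod \<delta>N y = yprod \<gamma> \<mu> \<and> yprod w \<mu> = yprod \<beta> y)"
    if "\<beta> \<in> ext n N L" "v \<in> composition_values \<A> \<C> n M N B L \<delta>N \<beta> \<gamma>" for v \<beta> \<gamma>
    using that(2) composition_value[OF d that(1)] unfolding composition_values_def by blast
  obtain w y where w: "w\<in>ext n M L" "v = stable_class \<A> \<C> n M L w" "y\<in>ext (n + 1) Z N" "yprod \<delta>N y = yprod \<gamma> \<mu>" "yprod w \<mu> = yprod \<beta> y"
    using *[OF b(1) v(1)] by blast
  obtain w' y' where w': "w'\<in>ext n M L" "v' = stable_class \<A> \<C> n M L w'" "y'\<in>ext (n + 1) Z N" "yprod \<delta>N y' = yprod \<gamma>' \<mu>" "yprod w' \<mu> = yprod \<beta>' y'"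
    using *[OF b(2) v(2)] by blast
  have gm: "yprod \<gamma> \<mu> = yprod \<gamma>' \<mu>" using stable_class_eq_iff[OF d g] eq by simp
  obtain E where E: "\<delta>N = cls E" "unit_seq n N B E" using dN by (auto simp: unit_ext_def unit_conflation_unit_seq)
  have yy: "y = y'" by (rule shift_inj[OF E(2) w(3) w'(3)]) (use w w' gm E in auto)
  \<comment> \<open>A second detecting class, at \<open>N\<close>, turns equality of the cosets of
    \<beta> and \<beta>' into a difference in \<P>; this difference annihilates \<open>y\<close>,
    whose degree n + 1 exceeds n.\<close>
  obtain Z' \<nu> where d': "detects Z' \<nu> N" using detects_ex[OF M(2)] by blast
  have "\<beta> \<otimes>\<^bsub>Ext \<A> \<C> n N L\<^esub> inv\<^bsub>Ext \<A> \<C> n N L\<^esub> \<beta>' \<in> proj_ext \<A> \<C> n N L"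
    using stable_class_eq_iff[OF d' b] diff_proj_ext_iff[OF d' b] eq by simp
  hence "yprod \<beta> y = yprod \<beta>' y" by (intro prod_eq_if_diff_proj_ext[OF b w(3)]) simp_all
  hence "yprod w \<mu> = yprod w' \<mu>" using w w' yy by simp
  thus ?thesis using stable_class_eq_iff[OF d w(1) w'(1)] w w' by (simp add: carrier_stable_Ext)
qed

end

section \<open>Existence of the data\<close>

lemma pushout_square_sym: "pushout_square \<A> i g q r \<Longrightarrow> pushout_square \<A> g i r q"
  unfolding pushout_square_def by (auto; metis)

context n_frobenius_category
begin

text \<open>Embed the middle term into an n-injective and compose with \<open>i\<close>. The new
  cokernel is the push-out, an extension of the cokernel of the embedding by
  \<open>tgt \<A> p\<close>, so it lies in \<C>; the induced arrow \<alpha> is the change of the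
  right end.\<close>

lemma injective_hull:
  assumes c: "conf i p"
  obtains i' p' \<alpha> where "conf i' p'" "src \<A> i' = src \<A> i" "np (src \<A> p')" "mor \<A> [i, p] [i', p'] (idn \<A> (src \<A> i)) \<alpha>"
    "\<alpha> \<in> Hom \<A> (tgt \<A> p) (tgt \<A> p')"
proof -
  note C = conflationD[OF c]
  obtain u q where u: "conf u q" "src \<A> u = src \<A> p" "np (src \<A> q)" using enough_injectives[OF C(6)] by blast
  note U = conflationD[OF u(1)]
  obtain p' \<alpha> where po: "pushout_square \<A> u p p' \<alpha>" using pushout_exists[of u p] U C u by auto
  note P = pushoutD[OF po]
  have s: "short_exact \<A> (u \<cdot> i) p'" by (rule short_exact_cmp[OF C(1) U(1) po]) (use C u in simp)
  obtain q' where q': "q'\<in>arr \<A>" "src \<A> q' = tgt \<A> p'" "tgt \<A> q' = tgt \<A> q" "q' \<cdot> p' = q" "q' \<cdot> \<alpha> = zer (tgt \<A> p) (tgt \<A> q)"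
    using pushout_short_exact(3)[OF U(1) po biproduct_biprod] U C by auto
  have "short_exact \<A> \<alpha> q'" by (rule pushout_short_exact(2)[OF U(1) po biproduct_biprod]) (use U C q' in auto)
  hence "tgt \<A> \<alpha> \<in> \<C>" by (rule C_ext) (use P C q' U in auto)
  hence cc: "conf (u \<cdot> i) p'" by (intro conflationI[OF s]) (use P U C u in auto)
  show thesis
  proof (rule that[OF cc])
    show "src \<A> (u \<cdot> i) = src \<A> i" using U C u by simp
    show "np (src \<A> p')" using P(6) U(4) u(3) by simp
    show "mor \<A> [i, p] [u \<cdot> i, p'] (idn \<A> (src \<A> i)) \<alpha>"
      by (rule mor1I[of _ _ _ u]) (use P(1-9) U C u in \<open>auto simp: Hom_iff\<close>)
    show "\<alpha> \<in> Hom \<A> (tgt \<A> p) (tgt \<A> p')" using P by (simp add: Hom_iff)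
  qed
qed

text \<open>Each hull of a first conflation changes the left end of the remaining sequence by some
  \<alpha>. The arrow \<open>g\<close> on the left is arbitrary so that the induction hypothesis can
  absorb this change; a push-out first reduces to the identity.\<close>

lemma unit_hull:
  "\<lbrakk>seq t A1 B1 E; g \<in> Hom \<A> B1 B; B \<in> \<C>\<rbrakk> \<Longrightarrow> \<exists>A E'' f. unit_seq t A B E'' \<and> mor \<A> E E'' g f"
proof (induction t arbitrary: B1 B E g)
  case 0
  thus ?case using seqD(2) by blast
next
  case (Suc t)
  obtain E' where E': "seq (Suc t) A1 B E'" "mor \<A> E E' g (idn \<A> A1)" using push_ex[OF Suc(2-4)] by metis
  have "\<exists>A E'' f. unit_seq (Suc t) A B E'' \<and> mor \<A> E' E'' (idn \<A> B) f"
  proof (cases "t = 0")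
    case True
    obtain i p where e: "E' = [i, p]" "conf i p" "src \<A> i = B" using E'(1) True by (auto simp: seq_single)
    obtain i' p' \<alpha> where "conf i' p'" "src \<A> i' = src \<A> i" "np (src \<A> p')" "mor \<A> [i, p] [i', p'] (idn \<A> (src \<A> i)) \<alpha>"
      using injective_hull[OF e(2)] by metis
    thus ?thesis using True e unfolding True unit_seq_single by blast
  next
    case False
    obtain i p F where e: "conf i p" "src \<A> i = B" "seq t A1 (tgt \<A> p) F" "E' = splice_seq \<A> [i, p] F"
      using seq_split[OF E'(1)] False by auto
    obtain i' p' \<alpha> where h: "conf i' p'" "src \<A> i' = B" "np (src \<A> p')" "mor \<A> [i, p] [i', p'] (idn \<A> B) \<alpha>"
      "\<alpha> \<in> Hom \<A> (tgt \<A> p) (tgt \<A> p')" using injective_hull[OF e(1)] e(2) by metis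
    note C = conflationD[OF e(1)] and H = conflationD[OF h(1)]
    obtain A F' f where F': "unit_seq t A (tgt \<A> p') F'" "mor \<A> F F' \<alpha> f" using Suc(1)[OF e(3) h(5) H(7)] by blast
    note s = unit_seq_seq[OF F'(1)]
    have "mor \<A> (splice_seq \<A> [i, p] F) (splice_seq \<A> [i', p'] F') (idn \<A> B) f"
      by (rule mor_splice_seq[OF h(4) F'(2)]) (use C H seqD(6-9)[OF e(3)] seqD(6-9)[OF s] in auto)
    thus ?thesis using unit_seq_splice[OF h(1,3) s] F' e h by auto
  qed
  then obtain A E'' f where E'': "unit_seq (Suc t) A B E''" "mor \<A> E' E'' (idn \<A> B) f" by blast
  have "mor \<A> E E'' (idn \<A> B \<cdot> g) (f \<cdot> idn \<A> A1)" by (rule seq_mor_cmp[OF E'(2) E''(2) Suc(2) E'(1) unit_seq_seq[OF E''(1)]])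
  thus ?case using E'' Suc(3,4) by (auto simp: Hom_iff)
qed

text \<open>Pulling back changes only the last middle term, and the new one is an extension of the
  old one by the n-projective kernel of \<open>a\<close>.\<close>

lemma unit_pull:
  assumes E: "unit_seq t A B E" and c: "conf k a" "tgt \<A> a = A" and np: "np (src \<A> k)"
  shows "\<exists>E'. unit_seq t (src \<A> a) B E' \<and> pull (cls E) a = cls E'"
proof -
  interpret O: ext_category "opp \<A>" \<C> by (rule opp_ext_category)
  note s = unit_seq_seq[OF E] and C = conflationD[OF c(1)]
  have aH: "a \<in> Hom \<A> (src \<A> a) A" using C c by (simp add: Hom_iff)
  obtain E' where pb: "seq_pullback \<A> E a E'" using seq_pullback_exists[OF s aH] by blast
  note y = seq_pullbackD[OF s aH C(6) pb]
  obtain es d p d' p' q where e: "E = es @ [d, p]" "E' = es @ [d', p']" and sq: "pullback_square \<A> q p' p a"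
    "d' \<in> Hom \<A> (src \<A> d) (src \<A> q)" using pb unfolding seq_pullback_def by auto
  \<comment> \<open>The square is read with its legs exchanged: the kernel of \<open>a\<close>, not
    that of \<open>p\<close>, then reappears as the kernel of the comparison arrow
    \<open>q\<close>.\<close>
  have "pushout_square (opp \<A>) a p p' q" using sq(1) unfolding pushout_opp[symmetric] by (rule pushout_square_sym)
  note po = this and P = O.pushoutD[OF this]
  have p: "src \<A> p = tgt \<A> d" "p \<in> arr \<A>" using seqD(3)[OF s] e by (auto simp: is_path_append)
  have npd: "np (tgt \<A> d)" "\<forall>x\<in>set es. np (tgt \<A> x)" using E e by (auto simp: unit_seq_def butlast_append)
  have se: "short_exact (opp \<A>) a k" using C by simp
  have b: "biproduct (opp \<A>) (tgt (opp \<A>) a) (tgt (opp \<A>) p) (O.biprod (src \<A> a) (src \<A> p)) (O.bi1 (src \<A> a) (src \<A> p))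
     (O.bi2 (src \<A> a) (src \<A> p)) (O.bp1 (src \<A> a) (src \<A> p)) (O.bp2 (src \<A> a) (src \<A> p))"
    using O.biproduct_biprod[of "src \<A> a" "src \<A> p"] C p arr_obj(1)[OF p(2)] by simp
  obtain k' where k': "k'\<in>arr \<A>" "tgt \<A> k' = src \<A> p'" "src \<A> k' = src \<A> k" "p' \<cdot> k' = k" "q \<cdot> k' = zer (src \<A> k) (src \<A> p)"
    using O.pushout_short_exact(3)[OF se po b] by auto
  have "short_exact (opp \<A>) q k'" by (rule O.pushout_short_exact(2)[OF se po b]) (use k' in auto)
  hence "conf k' q" by (intro conflationI) (use k' C npd p P in auto)
  hence "np (src \<A> q)" by (rule np_extension) (use k' np npd p P in auto)
  moreover have "tgt \<A> d' = src \<A> q" using sq(2) by (simp add: Hom_iff)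
  ultimately have "unit_seq t (src \<A> a) B E'" using y(1) npd e by (auto simp: unit_seq_def butlast_append)
  thus ?thesis using pull_cls[OF s aH C(6) y(1,2)] by blast
qed

text \<open>The arrow \<open>p\<close> is the deflation of the last conflation, which splits when
  pulled back along it; a product with a zero factor vanishes, so the whole sequence becomes zero as
  well.\<close>

lemma unit_seq_last:
  "unit_seq t A B E \<Longrightarrow> \<exists>i p. conf i p \<and> tgt \<A> p = A \<and> np (src \<A> p) \<and> pull (cls E) p = ext_zero t (src \<A> p) B"
proof (induction t arbitrary: B E)
  case 0
  thus ?case using seqD(2) unit_seq_seq by blast
next
  case (Suc t)
  show ?case
  proof (cases "t = 0")
    case True
    then obtain i p where "E = [i, p]" "conf i p" "src \<A> i = B" "tgt \<A> p = A" "np (src \<A> p)" using Suc(2) by (auto simp: unit_seq_single)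
    thus ?thesis using pull_own_deflation[of i p] True by auto
  next
    case False
    obtain i p F where F: "conf i p" "src \<A> i = B" "np (src \<A> p)" "unit_seq t A (tgt \<A> p) F" "E = splice_seq \<A> [i, p] F"
      using unit_seq_split[OF Suc(2)] False by auto
    obtain j q where q: "conf j q" "tgt \<A> q = A" "np (src \<A> q)" "pull (cls F) q = ext_zero t (src \<A> q) (tgt \<A> p)" using Suc(1)[OF F(4)] by blast
    note s = seq_conflation[OF F(1)] unit_seq_seq[OF F(4)] and Q = conflationD[OF q(1)]
    have qH: "q \<in> Hom \<A> (src \<A> q) A" using Q q by (simp add: Hom_iff)
    have "pull (cls E) q = yprod (cls [i, p]) (ext_zero t (src \<A> q) (tgt \<A> p))"
      using prod_pull[OF extI[OF s(1)] extI[OF s(2)] qH Q(6)] prod_cls[OF s] q F by simp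
    thus ?thesis using q prod_ext_zero_right[OF extI[OF s(1)], of "src \<A> q" t] Q F False by auto
  qed
qed

text \<open>Above degree n the push-out along \<open>c\<close> is bijective. Injectivity kills the
  image of \<open>x\<close> under the connecting map, so \<open>x\<close> comes from the middle
  term; surjectivity moves it back to \<open>N\<close>, and the composite of \<open>c\<close> and
  \<open>d\<close> is zero.\<close>

lemma cokernel_np:
  assumes c: "conf c d" and EN: "unit_seq n N B EN" and E: "unit_seq n A B E" and e: "src \<A> c = N" "tgt \<A> c = A"
    and p: "pull (cls E) c = cls EN"
  shows "np (tgt \<A> d)"
proof (rule npI)
  note C = conflationD[OF c]
  have cH: "c \<in> Hom \<A> N A" and dH: "d \<in> Hom \<A> A (tgt \<A> d)" using C e by (auto simp: Hom_iff)
  have NA: "N \<in> \<C>" "A \<in> \<C>" using C e by auto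
  fix k Z x assume k: "n < k" and Z: "Z \<in> \<C>" and x: "x \<in> ext k Z (tgt \<A> d)"
  note cd = ext_conflation[OF c]
  let ?y = "yprod (cls [c, d]) x"
  have y: "?y \<in> ext (Suc k) Z N" using prod_in[OF cd x] e by simp
  have "push c ?y = yprod (push c (cls [c, d])) x" by (rule prod_push[symmetric, OF cd x, of c A]) (use cH e NA in auto)
  also have "\<dots> = ext_zero (Suc k) Z A" unfolding push_own_inflation[OF c] using prod_ext_zero_left[OF x, of "src \<A> d" "Suc 0"] C e NA by simp
  finally have "push c ?y = push c (ext_zero (Suc k) Z N)" using push_ext_zero[OF cH Z NA] by simp
  hence "?y = ext_zero (Suc k) Z N"
    by (intro push_between_units(1)[OF E EN cH p _ y]) (use k Z NA zero_in in auto)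
  then obtain v where v: "v \<in> ext k Z A" "x = push d v" using exact_right[OF c x] e C by auto
  obtain w where w: "w \<in> ext k Z N" "push c w = v" using push_between_units(2)[OF E EN cH p k v(1)] by blast
  have "x = push (zer N (tgt \<A> d)) w" using push_push[OF w(1) cH dH] w v C e NA by simp
  thus "x = ext_zero k Z (tgt \<A> d)" using push_zer[OF w(1)] C by simp
qed (use conflationD[OF c] in simp)

lemma composition_values_nonempty:
  assumes g: "\<gamma> \<in> ext n M B" and b: "\<beta> \<in> ext n N L" and dN: "\<delta>N \<in> unit_ext \<A> \<C> n N B"
  shows "composition_values \<A> \<C> n M N B L \<delta>N \<beta> \<gamma> \<noteq> {}"
proof -
  obtain EN where EN: "\<delta>N = cls EN" "unit_seq n N B EN" using dN by (auto simp: unit_ext_def unit_conflation_unit_seq)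
  obtain Eg where Eg: "seq n M B Eg" "\<gamma> = cls Eg" using g by (rule extE)
  note sN = unit_seq_seq[OF EN(2)]
  have o: "M \<in> \<C>" "N \<in> \<C>" "B \<in> \<C>" "L \<in> \<C>" using ext_obj[OF g] ext_obj[OF b] by auto
  \<comment> \<open>A unit conflation receiving both sequences over the identity of \<open>B\<close>
    is obtained as a hull of their direct sum along the codiagonal, restricted to the two
    summands.\<close>
  let ?D = "map2 (dsum_arr \<A>) EN Eg"
  note D = seq_dsum[OF sN Eg(1)]
  have cod: "cotup (idn \<A> B) (idn \<A> B) \<in> Hom \<A> (biprod B B) B" using o by (simp add: Hom_iff)
  obtain A0 E0 f0 where E0: "unit_seq n A0 B E0" "mor \<A> ?D E0 (cotup (idn \<A> B) (idn \<A> B)) f0"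
    using unit_hull[OF D cod o(3)] by blast
  note s0 = unit_seq_seq[OF E0(1)]
  have A0: "A0 \<in> \<C>" using seqD(4)[OF s0] .
  have f0: "f0 \<in> Hom \<A> (biprod N M) A0" by (rule seq_mor_Hom(2)[OF E0(2) D s0])
  have inj: "mor \<A> EN ?D (bi1 B B) (bi1 N M)" "mor \<A> Eg ?D (bi2 B B) (bi2 N M)"
  proof -
    have z: "mor \<A> EN Eg (zer B B) (zer N M)" "mor \<A> Eg EN (zer B B) (zer M N)"
      using mor_zero[of EN Eg B B N M] mor_zero[of Eg EN B B M N] seqD(1,3)[OF sN] seqD(1,3)[OF Eg(1)] o by auto
    show "mor \<A> EN ?D (bi1 B B) (bi1 N M)" "mor \<A> Eg ?D (bi2 B B) (bi2 N M)"
      using mor_tup[OF seq_mor_id[OF sN] z(1)] mor_tup[OF z(2) seq_mor_id[OF Eg(1)]] seqD(6)[OF sN] seqD(6)[OF Eg(1)] o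
      by (simp_all add: tup_def)
  qed
  define c0 where "c0 = f0 \<cdot> bi1 N M"
  define m0 where "m0 = f0 \<cdot> bi2 N M"
  have c0: "c0 \<in> Hom \<A> N A0" "mor \<A> EN E0 (idn \<A> B) c0"
    using seq_mor_cmp[OF inj(1) E0(2) sN D s0] f0 o by (auto simp: c0_def Hom_iff)
  have m0: "m0 \<in> Hom \<A> M A0" "mor \<A> Eg E0 (idn \<A> B) m0"
    using seq_mor_cmp[OF inj(2) E0(2) Eg(1) D s0] f0 o by (auto simp: m0_def Hom_iff)
  have p0: "pull (cls E0) c0 = \<delta>N" "pull (cls E0) m0 = \<gamma>"
    using pull_cls[OF s0 c0(1) o(2) sN c0(2)] pull_cls[OF s0 m0(1) o(1) Eg(1) m0(2)] EN Eg by auto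
  note ca = c0(1)[unfolded Hom_iff] and ma = m0(1)[unfolded Hom_iff]
  \<comment> \<open>To replace \<open>c0\<close> by an inflation, \<open>A0\<close> is enlarged by
    an n-injective containing \<open>N\<close>. The projection back to \<open>A0\<close> has this
    n-injective as kernel, so the pulled-back sequence is still a unit.\<close>
  obtain j q where j: "conf j q" "src \<A> j = N" "np (src \<A> q)" using enough_injectives[OF o(2)] by blast
  note J = conflationD[OF j(1)]
  define I where "I = src \<A> q"
  have I: "I \<in> \<C>" "np I" "tgt \<A> j = I" "j \<in> arr \<A>" using j J by (auto simp: I_def)
  define A where "A = biprod I A0"
  have A: "A \<in> \<C>" using I A0 by (simp add: A_def)
  have prH: "bp2 I A0 \<in> Hom \<A> A A0" using I A0 by (simp add: A_def Hom_iff)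
  obtain E1 where E1: "unit_seq n A B E1" "pull (cls E0) (bp2 I A0) = cls E1"
    using unit_pull[OF E0(1) biproduct_conflation[OF A0 I(1)]] I A0 by (auto simp: A_def)
  define \<delta> where "\<delta> = cls E1"
  note d = extI[OF s0] and d1 = extI[OF unit_seq_seq[OF E1(1)], folded \<delta>_def]
  have cH: "tup j c0 \<in> Hom \<A> N A" using I j ca by (simp add: A_def Hom_iff)
  have fH: "bi2 I A0 \<cdot> m0 \<in> Hom \<A> M A" using I A0 ma by (simp add: A_def Hom_iff)
  have dc: "pull \<delta> (tup j c0) = \<delta>N"
    using pull_pull[OF d prH cH A o(2)] E1(2) p0 I A0 ca j by (simp add: \<delta>_def)
  have df: "\<gamma> = pull \<delta> (bi2 I A0 \<cdot> m0)"
    using pull_pull[OF d prH fH A o(1)] E1(2) p0 I A0 ma by (simp add: \<delta>_def)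
  \<comment> \<open>\<open>pushout_conflation\<close> negates the second component, hence the
    negative of \<open>c0\<close> is supplied.\<close>
  obtain d' where cd: "conf (tup j c0) d'" using pushout_conflation[OF j(1), of "neg c0" A0] ca A0 j by (auto simp: Hom_iff)
  note CD = conflationD[OF cd]
  define c where "c = tup j c0"
  have c: "c \<in> arr \<A>" "src \<A> c = N" "tgt \<A> c = A" "c \<in> Hom \<A> N A" using cH by (auto simp: c_def Hom_iff)
  have npD: "np (tgt \<A> d')"
    by (rule cokernel_np[OF cd EN(2) E1(1)]) (use c dc EN in \<open>auto simp: c_def \<delta>_def\<close>)
  \<comment> \<open>The obstruction to extending \<beta> along \<open>c\<close> lies in Ext of
    degree n + 1 out of the n-projective cokernel.\<close>
  have "yprod \<beta> (cls [c, d']) = ext_zero (Suc n) (tgt \<A> d') L"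
    using np_left[OF npD prod_in[OF b, of "cls [c, d']" "Suc 0"]] ext_conflation[OF cd] c by (simp add: c_def)
  then obtain \<epsilon> where e: "\<epsilon> \<in> ext n A L" "\<beta> = pull \<epsilon> c"
    using exact_right_op[OF cd, of \<beta> n L] b c by (auto simp: c_def)
  obtain i p where p: "conf i p" "tgt \<A> p = A" "np (src \<A> p)" "pull \<delta> p = ext_zero n (src \<A> p) B"
    using unit_seq_last[OF E1(1)] by (auto simp: \<delta>_def)
  note P = conflationD[OF p(1)]
  define X where "X = biprod (src \<A> p) N"
  define a where "a = bp2 (src \<A> p) N"
  define bb where "bb = cotup p c"
  have X: "X \<in> \<C>" using P o by (simp add: X_def)
  have aH: "a \<in> Hom \<A> X N" "bp1 (src \<A> p) N \<in> Hom \<A> X (src \<A> p)" using P o by (simp_all add: a_def X_def Hom_iff)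
  have bH: "bb \<in> Hom \<A> X A" using P c p by (simp add: bb_def X_def Hom_iff)
  have adef: "deflation \<A> \<C> a" using biproduct_conflation[OF o(2) P(6)] by (auto simp: deflation_def a_def)
  have bdef: "deflation \<A> \<C> bb"
  proof -
    \<comment> \<open>The sign built into \<open>pullback_conflation\<close> is compensated in the
      same way.\<close>
    have nc: "neg c \<in> Hom \<A> N (tgt \<A> p)" using c p by (simp add: Hom_iff)
    show ?thesis by (rule pullback_conflation[OF p(1) nc o(2)]) (use c in \<open>auto simp: deflation_def bb_def\<close>)
  qed
  obtain EY where EY: "unit_seq n X B EY" "pull \<delta>N a = cls EY"
    using unit_pull[OF EN(2) biproduct_conflation[OF o(2) P(6)]] p o EN P by (auto simp: X_def a_def)
  have pH: "p \<in> Hom \<A> (src \<A> p) A" using P p by (simp add: Hom_iff)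
  \<comment> \<open>The summand of \<open>bb\<close> through \<open>p\<close> pulls \<delta> back to
    zero, so only \<open>c \<cdot> a\<close> contributes, and \<delta> pulled back along
    \<open>c\<close> is \<open>\<delta>N\<close>.\<close>
  have db: "pull \<delta> bb = pull \<delta>N a"
  proof -
    have h: "p \<cdot> bp1 (src \<A> p) N \<in> Hom \<A> X A" "c \<cdot> a \<in> Hom \<A> X A" using aH c pH by (auto simp: Hom_iff)
    have "pull \<delta> bb = pull \<delta> (p \<cdot> bp1 (src \<A> p) N \<boxplus> c \<cdot> a)" using c by (simp add: bb_def cotup_def a_def)
    also have "\<dots> = bsum X B (pull \<delta> (p \<cdot> bp1 (src \<A> p) N)) (pull \<delta> (c \<cdot> a))" by (rule pull_add[OF d1 h X])
    also have "pull \<delta> (p \<cdot> bp1 (src \<A> p) N) = ext_zero n X B"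
      using pull_pull[OF d1 pH aH(2) P(6) X] p(4) pull_ext_zero[OF aH(2) P(6) o(3) X, of n] n_pos by simp
    also have "pull \<delta> (c \<cdot> a) = pull \<delta>N a" using pull_pull[OF d1 c(4) aH(1) o(2) X] dc by (simp add: c_def)
    also have "bsum X B (ext_zero n X B) (pull \<delta>N a) = pull \<delta>N a"
    proof -
      interpret comm_group "Ext \<A> \<C> n X B" by (rule Ext_comm_group) (use X o n_pos in auto)
      show ?thesis using l_one[of "pull \<delta>N a"] EY extI[OF unit_seq_seq[OF EY(1)]] by simp
    qed
    finally show ?thesis .
  qed
  have qa: "quasi_invertible \<A> \<C> n a" "quasi_invertible \<A> \<C> n bb"
    using quasi_invertible_between_units[OF EN(2) EY(1) aH(1)] quasi_invertible_between_units[OF E1(1) EY(1) bH] EY EN db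
    by (auto simp: \<delta>_def)
  have ue: "\<delta> \<in> unit_ext \<A> \<C> n A B" "pull \<delta>N a \<in> unit_ext \<A> \<C> n X B"
    using E1 EY by (auto simp: unit_ext_def unit_conflation_unit_seq \<delta>_def)
  have cp: "co_angled_pair \<A> \<C> n B N \<delta>N A \<delta> X a bb"
    unfolding co_angled_pair_def using dN ue aH bH adef bdef qa db by simp
  have rf: "right_unit_factorization \<A> \<C> n M B \<gamma> A \<delta> (bi2 I A0 \<cdot> m0)"
    unfolding right_unit_factorization_def using A ue fH df by simp
  \<comment> \<open>The condition on \<epsilon> is tested by a detecting class at \<open>X\<close>.
    The push-outs of \<mu> along \<open>bb\<close> and along \<open>c \<cdot> a\<close> have the
    same product with \<delta>, so injectivity of the shift identifies them; and \<epsilon> pulled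
    back along \<open>c\<close> is \<beta>.\<close>
  obtain Z \<mu> where det: "detects Z \<mu> X" using detects_ex[OF X] by blast
  have m: "\<mu> \<in> ext (n + 1) Z X" using det by (simp add: detects_def)
  have caH: "c \<cdot> a \<in> Hom \<A> X A" using aH c by (auto simp: Hom_iff)
  have eb: "pull \<epsilon> bb \<in> ext n X L" "pull \<beta> a \<in> ext n X L" using pull_in[OF e(1) bH X] pull_in[OF b aH(1) X] by auto
  have "push bb \<mu> = push (c \<cdot> a) \<mu>"
  proof (rule shift_inj[OF E1(1) push_in[OF m bH A] push_in[OF m caH A]])
    have "pull \<delta> (c \<cdot> a) = pull \<delta> bb" using pull_pull[OF d1 c(4) aH(1) o(2) X] dc db by (simp add: c_def)
    thus "yprod (cls E1) (push bb \<mu>) = yprod (cls E1) (push (c \<cdot> a) \<mu>)"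
      using prod_mid[OF d1 m bH] prod_mid[OF d1 m caH] by (simp add: \<delta>_def)
  qed simp
  moreover have "pull \<beta> a = pull \<epsilon> (c \<cdot> a)" using pull_pull[OF e(1) c(4) aH(1) o(2) X] e(2) by simp
  ultimately have "yprod (pull \<beta> a) \<mu> = yprod (pull \<epsilon> bb) \<mu>"
    using prod_mid[OF e(1) m bH] prod_mid[OF e(1) m caH] by simp
  hence "pull_inverse \<A> \<C> n X A L (pull \<beta> a) bb \<epsilon>"
    unfolding pull_inverse_def using diff_proj_ext_iff[OF det eb(2,1)] e by simp
  thus ?thesis unfolding composition_values_def using rf cp by blast
qed

end

text \<open>Agreement of all values over all representatives gives independence of the choices and
  of the representatives at once. Extensionality of the functions makes the resulting one
  unique.\<close>

lemma ex1_quotient_function: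
  assumes ne: "\<And>x y. x \<in> X \<Longrightarrow> y \<in> Y \<Longrightarrow> V x y \<noteq> {}"
    and un: "\<And>x y x' y' v v'. \<lbrakk>x \<in> X; y \<in> Y; x' \<in> X; y' \<in> Y; p x = p x'; q y = q y'; v \<in> V x y; v' \<in> V x' y'\<rbrakk> \<Longrightarrow> v = v' \<and> v \<in> T"
  shows "\<exists>!F. F \<in> p ` X \<times> q ` Y \<rightarrow>\<^sub>E T \<and> (\<forall>x\<in>X. \<forall>y\<in>Y. V x y = {F (p x, q y)})"
proof -
  define F where "F = restrict (\<lambda>(u, w). SOME v. \<exists>x\<in>X. \<exists>y\<in>Y. u = p x \<and> w = q y \<and> v \<in> V x y) (p ` X \<times> q ` Y)"
  have F: "V x y = {F (p x, q y)} \<and> F (p x, q y) \<in> T" if xy: "x \<in> X" "y \<in> Y" for x y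
  proof -
    have "\<exists>v. \<exists>x'\<in>X. \<exists>y'\<in>Y. p x = p x' \<and> q y = q y' \<and> v \<in> V x' y'" using ne[OF xy] xy by blast
    from someI_ex[OF this] obtain x' y' where x': "x' \<in> X" "y' \<in> Y" "p x = p x'" "q y = q y'" "F (p x, q y) \<in> V x' y'"
      using xy by (auto simp: F_def)
    have "v = F (p x, q y) \<and> v \<in> T" if "v \<in> V x y" for v using un[OF xy x'(1-4) that x'(5)] .
    thus ?thesis using ne[OF xy] by blast
  qed
  show ?thesis
  proof (rule ex1I[of _ F])
    have ext: "F \<in> extensional (p ` X \<times> q ` Y)" by (simp add: F_def)
    show FT: "F \<in> p ` X \<times> q ` Y \<rightarrow>\<^sub>E T \<and> (\<forall>x\<in>X. \<forall>y\<in>Y. V x y = {F (p x, q y)})"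
      unfolding PiE_iff using F ext by blast
    fix G assume G: "G \<in> p ` X \<times> q ` Y \<rightarrow>\<^sub>E T \<and> (\<forall>x\<in>X. \<forall>y\<in>Y. V x y = {G (p x, q y)})"
    show "G = F"
    proof (rule PiE_ext)
      show "G \<in> p ` X \<times> q ` Y \<rightarrow>\<^sub>E T" "F \<in> p ` X \<times> q ` Y \<rightarrow>\<^sub>E T" using G FT by blast+
      show "G z = F z" if "z \<in> p ` X \<times> q ` Y" for z using that G F by fastforce
    qed
  qed
qed

theorem theorem7p8:
  fixes \<A> :: "('o, 'a) addcat" and \<C> :: "'o set" and n :: nat
    and M N K \<Omega>N \<Omega>K :: 'o and \<delta>N :: "'a list set"
  assumes "abelian_category \<A>"
    and "additive_ext_closed \<A> \<C>"
    and "n \<ge> 1"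
    and "n_frobenius \<A> \<C> n"
    and "M \<in> \<C>" and "N \<in> \<C>" and "K \<in> \<C>"
    and "is_syzygy \<A> \<C> n K \<Omega>K"
    and "\<delta>N \<in> unit_ext \<A> \<C> n N \<Omega>N"
  shows "\<exists>!F. F \<in> carrier (stable_Ext \<A> \<C> n N \<Omega>K) \<times> carrier (stable_Ext \<A> \<C> n M \<Omega>N)
                  \<rightarrow>\<^sub>E carrier (stable_Ext \<A> \<C> n M \<Omega>K) \<and>
           (\<forall>\<beta>\<in>carrier (Ext \<A> \<C> n N \<Omega>K). \<forall>\<gamma>\<in>carrier (Ext \<A> \<C> n M \<Omega>N).
              composition_values \<A> \<C> n M N \<Omega>N \<Omega>K \<delta>N \<beta> \<gamma> =
                {F (stable_class \<A> \<C> n N \<Omega>K \<beta>, stable_class \<A> \<C> n M \<Omega>N \<gamma>)})"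
proof -
  interpret n_frobenius_category \<A> \<C> n
    using assms(1-4) by (intro_locales) (simp_all add: abelian_category_def ext_category_axioms_def n_frobenius_category_axioms_def)
  show ?thesis unfolding carrier_stable_Ext[of N] carrier_stable_Ext[of M \<Omega>N] carrier_Ext
  proof (rule ex1_quotient_function[where V = "composition_values \<A> \<C> n M N \<Omega>N \<Omega>K \<delta>N"
        and p = "stable_class \<A> \<C> n N \<Omega>K" and q = "stable_class \<A> \<C> n M \<Omega>N"])
    fix \<beta> \<gamma> assume b: "\<beta> \<in> ext n N \<Omega>K" and g: "\<gamma> \<in> ext n M \<Omega>N"
    show "composition_values \<A> \<C> n M N \<Omega>N \<Omega>K \<delta>N \<beta> \<gamma> \<noteq> {}"
      by (rule composition_values_nonempty[OF g b assms(9)])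
    fix \<beta>' \<gamma>' v v' assume b': "\<beta>' \<in> ext n N \<Omega>K" and g': "\<gamma>' \<in> ext n M \<Omega>N"
      and eq: "stable_class \<A> \<C> n N \<Omega>K \<beta> = stable_class \<A> \<C> n N \<Omega>K \<beta>'"
        "stable_class \<A> \<C> n M \<Omega>N \<gamma> = stable_class \<A> \<C> n M \<Omega>N \<gamma>'"
      and v: "v \<in> composition_values \<A> \<C> n M N \<Omega>N \<Omega>K \<delta>N \<beta> \<gamma>"
        "v' \<in> composition_values \<A> \<C> n M N \<Omega>N \<Omega>K \<delta>N \<beta>' \<gamma>'"
    show "v = v' \<and> v \<in> carrier (stable_Ext \<A> \<C> n M \<Omega>K)"
      by (rule composition_values_unique[OF g g' b b' assms(9) eq(2,1) v])
  qed
qed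

end
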